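(* Given a stable assignment instance $(G,<,\mathbf{q})$ with $G=(A\cup B,E)$ and a set $\overline A\subseteq A$ of consenting students, Kesten's EADAM with consent (described below) can be implemented so as to run in time $O(|E|)$; that is, its output can be computed in time $O(|E|)$.
   Context: A stable assignment instance is $(G,<,\mathbf{q})$ with $G=(A\cup B,E)$ a finite simple bipartite graph (students $A$, schools $B$), $<_v$ a strict total order on the neighbours of each vertex $v$, and positive integer quotas $q_b$, $b\in B$; for a subgraph $G'$, $(G',<,\mathbf{q})$ has preferences restricted to $G'$. Student-proposing Gale–Shapley proceeds in steps: at each step, every student who is currently not temporarily accepted by any school and has schools left on his list that he has not applied to applies to the most preferred such school; each school $b$ then temporarily accepts its $q_b$ most preferred students among those it currently holds together with its new applicants, and rejects the others. It stops when no student applies; the temporarily accepted pairs form its output. A student $a$ is an interrupter for school $b$ at step $k'$ (and $ab$ an interrupting pair at step $k'$) if $a$ is temporarily accepted by $b$ at some step $k<k'$, $a$ is rejected by $b$ at step $k'$, and some student is rejected by $b$ during steps $k,k+1,\dots,k'-1$. Kesten's EADAM with consenting set $\overline A$: let $G^0=G$, $i=0$, and run student-proposing Gale–Shapley on $(G^0,<,\mathbf{q})$ to get $M^0$. While this run has an interrupter belonging to $\overline A$: let $k'$ be the largest step at which such a consenting interrupter exists, let $E'$ be the set of interrupting pairs $ab$ at step $k'$ with $a\in\overline A$, let $G^{i+1}$ be $G^i$ with the edges of $E'$ removed, set $i:=i+1$, and run student-proposing Gale–Shapley on $(G^i,<,\mathbf{q})$ to obtain $M^i$. Output the final $M^i$.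 *)

theory Defs
  imports Complex_Main "HOL-Library.Landau_Symbols"
begin

text \<open>
  Students and schools live in separate types, so the two sides of the graph are
  disjoint by construction. \<open>(x, y) \<in> pref v\<close> reads \<open>x <\<^sub>v y\<close>: vertex \<open>v\<close> prefers \<open>y\<close> to \<open>x\<close>.
\<close>

record ('a, 'b) assignment_instance =
  students :: "'a set"
  schools :: "'b set"
  edges :: "('a \<times> 'b) set"
  student_pref :: "'a \<Rightarrow> ('b \<times> 'b) set"
  school_pref :: "'b \<Rightarrow> ('a \<times> 'a) set"
  quota :: "'b \<Rightarrow> nat"

definition student_nbrs :: "('a, 'b) assignment_instance \<Rightarrow> 'a \<Rightarrow> 'b set" where
  "student_nbrs I a = {b. (a, b) \<in> edges I}"

definition school_nbrs :: "('a, 'b) assignment_instance \<Rightarrow> 'b \<Rightarrow> 'a set" where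
  "school_nbrs I b = {a. (a, b) \<in> edges I}"

definition stable_assignment_instance :: "('a, 'b) assignment_instance \<Rightarrow> bool" where
  "stable_assignment_instance I \<longleftrightarrow>
     finite (students I) \<and> finite (schools I) \<and> edges I \<subseteq> students I \<times> schools I \<and>
     (\<forall>a\<in>students I. student_pref I a \<subseteq> student_nbrs I a \<times> student_nbrs I a \<and>
        strict_linear_order_on (student_nbrs I a) (student_pref I a)) \<and>
     (\<forall>b\<in>schools I. school_pref I b \<subseteq> school_nbrs I b \<times> school_nbrs I b \<and>
        strict_linear_order_on (school_nbrs I b) (school_pref I b)) \<and>
     (\<forall>b\<in>schools I. quota I b > 0)"

definition remove_edges ::
  "('a, 'b) assignment_instance \<Rightarrow> ('a \<times> 'b) set \<Rightarrow> ('a, 'b) assignment_instance" where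
  "remove_edges I D = I\<lparr>
     edges := edges I - D,
     student_pref := (\<lambda>a. Restr (student_pref I a) {b. (a, b) \<in> edges I - D}),
     school_pref := (\<lambda>b. Restr (school_pref I b) {a. (a, b) \<in> edges I - D})\<rparr>"


section \<open>Student-proposing Gale--Shapley\<close>

text \<open>
  A state \<open>(P, H)\<close> consists of the applications \<open>P\<close> made so far and the pairs \<open>H\<close>
  that are currently temporarily accepted.
\<close>

definition gs_applications ::
  "('a, 'b) assignment_instance \<Rightarrow> ('a \<times> 'b) set \<times> ('a \<times> 'b) set \<Rightarrow> ('a \<times> 'b) set" where
  "gs_applications I = (\<lambda>(P, H). {(a, b). (a, b) \<in> edges I - P \<and> (\<forall>b'. (a, b') \<notin> H) \<and>
     (\<forall>b'. (a, b') \<in> edges I - P \<and> b' \<noteq> b \<longrightarrow> (b', b) \<in> student_pref I a)})"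

definition gs_choice ::
  "('a, 'b) assignment_instance \<Rightarrow> ('a \<times> 'b) set \<Rightarrow> ('a \<times> 'b) set" where
  "gs_choice I C = {(a, b). (a, b) \<in> C \<and>
     card {a'. (a', b) \<in> C \<and> (a, a') \<in> school_pref I b} < quota I b}"

definition gs_step ::
  "('a, 'b) assignment_instance \<Rightarrow> ('a \<times> 'b) set \<times> ('a \<times> 'b) set
     \<Rightarrow> ('a \<times> 'b) set \<times> ('a \<times> 'b) set" where
  "gs_step I = (\<lambda>(P, H). let N = gs_applications I (P, H) in (P \<union> N, gs_choice I (H \<union> N)))"

text \<open>
  The state after \<open>k\<close> steps; step \<open>k \<ge> 1\<close> leads from \<open>gs_state I (k - 1)\<close> to \<open>gs_state I k\<close>.
  The sequence is continued beyond the step at which the procedure stops, where it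
  is stationary and no student is rejected any more.
\<close>

definition gs_state ::
  "('a, 'b) assignment_instance \<Rightarrow> nat \<Rightarrow> ('a \<times> 'b) set \<times> ('a \<times> 'b) set" where
  "gs_state I k = (gs_step I ^^ k) ({}, {})"

definition gs_accepted :: "('a, 'b) assignment_instance \<Rightarrow> nat \<Rightarrow> ('a \<times> 'b) set" where
  "gs_accepted I k = snd (gs_state I k)"

definition gs_rejected :: "('a, 'b) assignment_instance \<Rightarrow> nat \<Rightarrow> ('a \<times> 'b) set" where
  "gs_rejected I k = (if k = 0 then {}
     else (gs_accepted I (k - 1) \<union> gs_applications I (gs_state I (k - 1))) - gs_accepted I k)"

definition gs_output :: "('a, 'b) assignment_instance \<Rightarrow> ('a \<times> 'b) set" where
  "gs_output I = gs_accepted I (LEAST k. gs_applications I (gs_state I k) = {})"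


section \<open>Kesten's EADAM with consent\<close>

definition interrupting_pair :: "('a, 'b) assignment_instance \<Rightarrow> 'a \<Rightarrow> 'b \<Rightarrow> nat \<Rightarrow> bool" where
  "interrupting_pair I a b k' \<longleftrightarrow>
     (\<exists>k<k'. (a, b) \<in> gs_accepted I k \<and> (a, b) \<in> gs_rejected I k' \<and>
        (\<exists>l\<in>{k..<k'}. \<exists>a'. (a', b) \<in> gs_rejected I l))"

definition consenting_interrupting_pairs ::
  "('a, 'b) assignment_instance \<Rightarrow> 'a set \<Rightarrow> nat \<Rightarrow> ('a \<times> 'b) set" where
  "consenting_interrupting_pairs I Abar k' = {(a, b). a \<in> Abar \<and> interrupting_pair I a b k'}"

inductive eadam ::
  "'a set \<Rightarrow> ('a, 'b) assignment_instance \<Rightarrow> ('a \<times> 'b) set \<Rightarrow> bool" for Abar where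
  stop: "(\<And>k. consenting_interrupting_pairs I Abar k = {}) \<Longrightarrow> eadam Abar I (gs_output I)"
| continue: "\<lbrakk>consenting_interrupting_pairs I Abar k' \<noteq> {};
     \<And>k. k > k' \<Longrightarrow> consenting_interrupting_pairs I Abar k = {};
     eadam Abar (remove_edges I (consenting_interrupting_pairs I Abar k')) M\<rbrakk>
   \<Longrightarrow> eadam Abar I M"


section \<open>Machine model\<close>

text \<open>
  A random access machine, programmed in a structured language with finitely many
  scalar variables and finitely many arrays per program. Every operation, including
  array access at a computed index, costs one unit. The only arithmetic is successor
  and predecessor, so in \<open>t\<close> time units a value can exceed the constants of the
  program and the values of the input by at most \<open>t\<close>, and no computing power is
  hidden in the unit cost of operations on large numbers.
\<close>

type_synonym vname = string
type_synonym aname = string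

datatype aexp = Const nat | Var vname | Read aname aexp | Inc aexp | Dec aexp

datatype bexp = Less aexp aexp | Equal aexp aexp | Neg bexp | Conj bexp bexp

datatype com =
    Skip
  | Assign vname aexp
  | Store aname aexp aexp \<comment> \<open>array, index, value\<close>
  | Seq com com
  | Cond bexp com com
  | While bexp com

record store =
  scalars :: "vname \<Rightarrow> nat"
  arrays :: "aname \<Rightarrow> nat \<Rightarrow> nat"

fun aval :: "aexp \<Rightarrow> store \<Rightarrow> nat" where
  "aval (Const n) s = n"
| "aval (Var x) s = scalars s x"
| "aval (Read X e) s = arrays s X (aval e s)"
| "aval (Inc e) s = aval e s + 1"
| "aval (Dec e) s = aval e s - 1"

fun acost :: "aexp \<Rightarrow> nat" where
  "acost (Const n) = 1"
| "acost (Var x) = 1"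
| "acost (Read X e) = 1 + acost e"
| "acost (Inc e) = 1 + acost e"
| "acost (Dec e) = 1 + acost e"

fun bval :: "bexp \<Rightarrow> store \<Rightarrow> bool" where
  "bval (Less e1 e2) s \<longleftrightarrow> aval e1 s < aval e2 s"
| "bval (Equal e1 e2) s \<longleftrightarrow> aval e1 s = aval e2 s"
| "bval (Neg b) s \<longleftrightarrow> \<not> bval b s"
| "bval (Conj b1 b2) s \<longleftrightarrow> bval b1 s \<and> bval b2 s"

fun bcost :: "bexp \<Rightarrow> nat" where
  "bcost (Less e1 e2) = 1 + acost e1 + acost e2"
| "bcost (Equal e1 e2) = 1 + acost e1 + acost e2"
| "bcost (Neg b) = 1 + bcost b"
| "bcost (Conj b1 b2) = 1 + bcost b1 + bcost b2"

text \<open>\<open>exec c s t s'\<close>: started in \<open>s\<close>, the program \<open>c\<close> halts in \<open>s'\<close> after \<open>t\<close> time units.\<close>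

inductive exec :: "com \<Rightarrow> store \<Rightarrow> nat \<Rightarrow> store \<Rightarrow> bool" where
  Skip: "exec Skip s 1 s"
| Assign: "exec (Assign x e) s (1 + acost e)
     (s\<lparr>scalars := (scalars s)(x := aval e s)\<rparr>)"
| Store: "exec (Store X i e) s (1 + acost i + acost e)
     (s\<lparr>arrays := (arrays s)(X := (arrays s X)(aval i s := aval e s))\<rparr>)"
| Seq: "\<lbrakk>exec c1 s t1 s'; exec c2 s' t2 s''\<rbrakk> \<Longrightarrow> exec (Seq c1 c2) s (t1 + t2) s''"
| Cond_True: "\<lbrakk>bval b s; exec c1 s t s'\<rbrakk> \<Longrightarrow> exec (Cond b c1 c2) s (1 + bcost b + t) s'"
| Cond_False: "\<lbrakk>\<not> bval b s; exec c2 s t s'\<rbrakk> \<Longrightarrow> exec (Cond b c1 c2) s (1 + bcost b + t) s'"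
| While_False: "\<not> bval b s \<Longrightarrow> exec (While b c) s (1 + bcost b) s"
| While_True: "\<lbrakk>bval b s; exec c s t1 s'; exec (While b c) s' t2 s''\<rbrakk>
     \<Longrightarrow> exec (While b c) s (1 + bcost b + t1 + t2) s''"


section \<open>Input and output format\<close>

text \<open>The preference list for the order \<open>r\<close> on \<open>N\<close>, most preferred element first.\<close>

definition pref_list :: "('v \<times> 'v) set \<Rightarrow> 'v set \<Rightarrow> 'v list" where
  "pref_list r N = (THE xs. set xs = N \<and> sorted_wrt (\<lambda>x y. (y, x) \<in> r) xs)"

definition student_lists ::
  "('a, 'b) assignment_instance \<Rightarrow> 'a list \<Rightarrow> ('a \<times> 'b) list" where
  "student_lists I as =
     concat (map (\<lambda>a. map (\<lambda>b. (a, b)) (pref_list (student_pref I a) (student_nbrs I a))) as)"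

definition school_lists ::
  "('a, 'b) assignment_instance \<Rightarrow> 'b list \<Rightarrow> ('a \<times> 'b) list" where
  "school_lists I bs =
     concat (map (\<lambda>b. map (\<lambda>a. (a, b)) (pref_list (school_pref I b) (school_nbrs I b))) bs)"

definition array_of_list :: "nat list \<Rightarrow> nat \<Rightarrow> nat" where
  "array_of_list xs i = (if i < length xs then xs ! i else 0)"

text \<open>
  Vertices are named by natural numbers. The initial store holds the number of edges, the
  concatenated preference lists of the students (taken in the order \<open>as\<close>) and of the schools
  (in the order \<open>bs\<close>), each as a pair of arrays of length \<open>|E|\<close>, the quotas indexed by schools
  and the characteristic function of the set of consenting students. All other memory is zero.
\<close>

definition initial_store ::
  "(nat, nat) assignment_instance \<Rightarrow> nat set \<Rightarrow> nat list \<Rightarrow> nat list \<Rightarrow> store" where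
  "initial_store I Abar as bs = \<lparr>
     scalars = (\<lambda>_. 0)(''edges'' := card (edges I)),
     arrays = (\<lambda>_ _. 0)(
       ''student_lists_student'' := array_of_list (map fst (student_lists I as)),
       ''student_lists_school'' := array_of_list (map snd (student_lists I as)),
       ''school_lists_student'' := array_of_list (map fst (school_lists I bs)),
       ''school_lists_school'' := array_of_list (map snd (school_lists I bs)),
       ''quota'' := (\<lambda>b. if b \<in> schools I then quota I b else 0),
       ''consent'' := (\<lambda>a. if a \<in> Abar then 1 else 0))\<rparr>"

text \<open>
  In the output array, cell \<open>a\<close> holds \<open>b + 1\<close> if student \<open>a\<close> is assigned to school \<open>b\<close>,
  and \<open>0\<close> if \<open>a\<close> is unassigned.
\<close>

definition outputs :: "store \<Rightarrow> (nat \<times> nat) set \<Rightarrow> bool" where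
  "outputs s M \<longleftrightarrow> (\<forall>a b. arrays s ''output'' a = b + 1 \<longleftrightarrow> (a, b) \<in> M)"

end

theory Submission
  imports Defs "HOL-Library.Confluence"
begin

text \<open>
  EADAM is compared with a trading process that starts from a stable assignment. A school is settled
  when the students waiting for it that are not yet settled are all blocked by a settled
  student who does not consent; settled consenting students are passed over. The remaining schools
  trade along the cycles of the map from a school to the one holding the first student in its
  waiting line. Steps of this process commute, so the assignment it ends in is unique, and since the
  student-optimal stable assignment is reached from any other by rotations, which are trades, the
  stable assignment at the start does not matter.

  Suppose that the Gale--Shapley run has no consenting interrupter after step \<open>k'\<close>, and let a student
  arrive after \<open>k'\<close> at the school where it ends up. If this school is unsettled, the first
  student in its waiting line cannot have been rejected before that arrival, which otherwise would
  have displaced a consenting interrupter; so this first student arrives even later at its own final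
  school, and so on, which is impossible. Hence all students arriving after \<open>k'\<close> are
  settled without any trade. In particular the students interrupting at the last step are settled, so
  deleting their interrupting pairs does not affect the process; and if there is no consenting
  interrupter at all, nobody trades.

  The process takes linear time: cursors run down the lists of the schools, and a stack holds a path of
  the map above until it closes up to a cycle or ends in a school that can be settled.
\<close>

section \<open>Gale--Shapley\<close>

text \<open>EADAM may rerun Gale--Shapley once per deleted batch of edges, while a linear bound
  leaves time for a constant number of passes over the lists. So the rounds are not simulated: the
  output \<open>M\<close> is characterized by a process whose result survives each round, and the
  induction in \<open>eadam_of_settled\<close> carries one and the same \<open>M\<close> from an
  instance to its reduction. The obstacle is the starting point. The Gale--Shapley output
  \<open>G\<close> of an instance is stable in the reduced instance but need not be its
  Gale--Shapley output; hence the claim is made for every stable start \<open>N\<close>, and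
  rotations lead from \<open>N\<close> to \<open>G\<close>. The same generality lets the program
  begin with the outcome of offers made by the schools. Confluence serves two purposes: the program
  may treat the schools in any order, and a run may be rearranged so that all settling possible
  without a trade comes first, which is what makes the deleted edges harmless.\<close>

lemma top_ranked_card:
  fixes r :: "('v \<times> 'v) set" and q :: nat
  assumes C: "finite C" and tr: "trans r" and ir: "irrefl r" and tot: "total_on C r"
  defines "T \<equiv> {a \<in> C. card {a' \<in> C. (a, a') \<in> r} < q}"
  shows "card T \<le> q"
    and "a \<in> C - T \<Longrightarrow> card T = q"
    and "a \<in> C - T \<Longrightarrow> a' \<in> T \<Longrightarrow> (a, a') \<in> r"
proof -
  \<comment> \<open>The rank counted from the top. It is injective on \<open>C\<close> with values
    below \<open>card C\<close>, hence onto them, and \<open>T\<close> is the preimage of the ranks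
    below \<open>q\<close>.\<close>
  define g where "g = (\<lambda>x. card {y \<in> C. (x, y) \<in> r})"
  have mono: "g y < g x" if "x \<in> C" "y \<in> C" "(x, y) \<in> r" for x y
    unfolding g_def
  proof (rule psubset_card_mono)
    show "finite {y \<in> C. (x, y) \<in> r}" using C by simp
    show "{z \<in> C. (y, z) \<in> r} \<subset> {z \<in> C. (x, z) \<in> r}"
      using that tr ir by (auto simp: irrefl_def dest: transD)
  qed
  have inj: "inj_on g C"
  proof (rule inj_onI)
    fix x y assume xy: "x \<in> C" "y \<in> C" "g x = g y"
    show "x = y"
    proof (rule ccontr)
      assume "x \<noteq> y"
      then have "(x, y) \<in> r \<or> (y, x) \<in> r" using tot xy by (auto simp: total_on_def)
      then show False using mono xy by fastforce
    qed
  qed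
  have T: "T = {x \<in> C. g x < q}" by (simp add: T_def g_def)
  have injT: "inj_on g T" by (rule inj_on_subset[OF inj]) (simp add: T)
  have "card (g ` T) \<le> card {..<q}" by (rule card_mono) (auto simp: T)
  then show "card T \<le> q" using injT by (simp add: card_image)
  have lt: "g x < card C" if "x \<in> C" for x
    unfolding g_def by (rule psubset_card_mono) (use C that ir in \<open>auto simp: irrefl_def\<close>)
  have "g ` C = {..<card C}"
    by (rule card_subset_eq) (use lt inj in \<open>auto simp: card_image\<close>)
  then have img: "g ` T = {..<q}" if "q \<le> card C"
  proof -
    have "x \<in> g ` T" if "x < q" for x
    proof -
      have "x \<in> g ` C" using \<open>g ` C = {..<card C}\<close> \<open>q \<le> card C\<close> that by simp
      then show ?thesis using that by (auto simp: T)
    qed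
    then show ?thesis by (auto simp: T)
  qed
  {
    assume a: "a \<in> C - T"
    then have "q \<le> card C" using lt[of a] by (auto simp: T)
    then have "card (g ` T) = q" using img by simp
    then show "card T = q" using injT by (simp add: card_image)
    assume a': "a' \<in> T"
    show "(a, a') \<in> r"
    proof (rule ccontr)
      assume "(a, a') \<notin> r"
      moreover have "a \<noteq> a'" "a' \<in> C" using a a' T by auto
      ultimately have "(a', a) \<in> r" using tot a by (auto simp: total_on_def)
      then show False using mono[of a' a] a a' by (auto simp: T)
    qed
  }
qed

lemma linear_order_has_top:
  assumes "finite A" "A \<noteq> {}" "trans r" "irrefl r" "total_on A r"
  obtains x where "x \<in> A" "\<And>y. y \<in> A \<Longrightarrow> y \<noteq> x \<Longrightarrow> (y, x) \<in> r"
proof -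
  have "\<exists>x\<in>A. \<forall>y\<in>A. y \<noteq> x \<longrightarrow> (y, x) \<in> r"
    using assms(1,2,5)
  proof (induction A rule: finite_ne_induct)
    case (insert z F)
    then obtain x where x: "x \<in> F" "\<forall>y\<in>F. y \<noteq> x \<longrightarrow> (y, x) \<in> r"
      by (auto simp: total_on_def)
    have "z \<noteq> x" using insert x by auto
    then have "(z, x) \<in> r \<or> (x, z) \<in> r" using insert.prems x by (auto simp: total_on_def)
    then show ?case using x assms(3) by (metis insert_iff transD)
  qed auto
  then show thesis using that by blast
qed

section \<open>Assignments and stability\<close>

definition assigned :: "('a \<Rightarrow> 'b option) \<Rightarrow> 'b \<Rightarrow> 'a set" where
  "assigned M b = {a. M a = Some b}"

definition wants ::
  "('a, 'b) assignment_instance \<Rightarrow> ('a \<Rightarrow> 'b option) \<Rightarrow> 'a \<Rightarrow> 'b \<Rightarrow> bool" where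
  "wants I M a b \<longleftrightarrow> (a, b) \<in> edges I \<and> (\<forall>c. M a = Some c \<longrightarrow> (c, b) \<in> student_pref I a)"

definition assignment :: "('a, 'b) assignment_instance \<Rightarrow> ('a \<Rightarrow> 'b option) \<Rightarrow> bool" where
  "assignment I M \<longleftrightarrow> (\<forall>a b. M a = Some b \<longrightarrow> (a, b) \<in> edges I) \<and>
     (\<forall>b. card (assigned M b) \<le> quota I b)"

text \<open>Phrased through the students who want a school instead of blocking pairs, to match
  \<open>pick\<close> and \<open>blocked\<close>, which speak of the same waiting lines.\<close>

definition stable :: "('a, 'b) assignment_instance \<Rightarrow> ('a \<Rightarrow> 'b option) \<Rightarrow> bool" where
  "stable I M \<longleftrightarrow> assignment I M \<and> (\<forall>a b. wants I M a b \<longrightarrow>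
     card (assigned M b) = quota I b \<and> (\<forall>a'. M a' = Some b \<longrightarrow> (a, a') \<in> school_pref I b))"

locale assignment_problem =
  fixes I :: "('a, 'b) assignment_instance"
  assumes inst: "stable_assignment_instance I"
begin

lemma finite_edges: "finite (edges I)"
  using inst finite_subset[of "edges I" "students I \<times> schools I"]
  by (auto simp: stable_assignment_instance_def)

lemma edge_ends: "(a, b) \<in> edges I \<Longrightarrow> a \<in> students I \<and> b \<in> schools I"
  using inst by (auto simp: stable_assignment_instance_def)

lemma student_pref_props:
  assumes "(a, b) \<in> edges I"
  shows "trans (student_pref I a)" "irrefl (student_pref I a)"
    "total_on (student_nbrs I a) (student_pref I a)"
    "student_pref I a \<subseteq> student_nbrs I a \<times> student_nbrs I a"
  using inst edge_ends[OF assms]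
  by (auto simp: stable_assignment_instance_def strict_linear_order_on_def)

lemma school_pref_props:
  assumes "(a, b) \<in> edges I"
  shows "trans (school_pref I b)" "irrefl (school_pref I b)"
    "total_on (school_nbrs I b) (school_pref I b)"
    "school_pref I b \<subseteq> school_nbrs I b \<times> school_nbrs I b"
  using inst edge_ends[OF assms]
  by (auto simp: stable_assignment_instance_def strict_linear_order_on_def)

lemma student_pref_linear:
  assumes "(a, b) \<in> edges I"
  shows "(a, b') \<in> edges I \<Longrightarrow> b \<noteq> b' \<Longrightarrow> (b, b') \<in> student_pref I a \<or> (b', b) \<in> student_pref I a"
    and "(b, b') \<in> student_pref I a \<Longrightarrow> (a, b') \<in> edges I"
    and "(b', b) \<in> student_pref I a \<Longrightarrow> (a, b') \<in> edges I"
    and "(b, b) \<notin> student_pref I a"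
    and "(b, b') \<in> student_pref I a \<Longrightarrow> (b', b) \<notin> student_pref I a"
    and "(b, b') \<in> student_pref I a \<Longrightarrow> (b', b'') \<in> student_pref I a \<Longrightarrow> (b, b'') \<in> student_pref I a"
  using student_pref_props[OF assms] assms
  by (simp_all add: total_on_def student_nbrs_def irrefl_def) (blast dest: transD)+

lemma school_pref_linear:
  assumes "(a, b) \<in> edges I"
  shows "(a', b) \<in> edges I \<Longrightarrow> a \<noteq> a' \<Longrightarrow> (a, a') \<in> school_pref I b \<or> (a', a) \<in> school_pref I b"
    and "(a, a') \<in> school_pref I b \<Longrightarrow> (a', b) \<in> edges I"
    and "(a', a) \<in> school_pref I b \<Longrightarrow> (a', b) \<in> edges I"
    and "(a, a) \<notin> school_pref I b"
    and "(a, a') \<in> school_pref I b \<Longrightarrow> (a', a) \<notin> school_pref I b"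
    and "(a, a') \<in> school_pref I b \<Longrightarrow> (a', a'') \<in> school_pref I b \<Longrightarrow> (a, a'') \<in> school_pref I b"
  using school_pref_props[OF assms] assms
  by (simp_all add: total_on_def school_nbrs_def irrefl_def) (blast dest: transD)+

section \<open>The run of Gale--Shapley\<close>

definition P :: "nat \<Rightarrow> ('a \<times> 'b) set" where "P k = fst (gs_state I k)"
definition H :: "nat \<Rightarrow> ('a \<times> 'b) set" where "H k = snd (gs_state I k)"
definition new :: "nat \<Rightarrow> ('a \<times> 'b) set" where "new k = gs_applications I (gs_state I k)"

lemma state_0: "P 0 = {}" "H 0 = {}"
  by (simp_all add: P_def H_def gs_state_def)

lemma state_Suc: "P (Suc k) = P k \<union> new k" "H (Suc k) = gs_choice I (H k \<union> new k)"
  by (simp_all add: P_def H_def new_def gs_state_def gs_step_def split_beta Let_def)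

lemma accepted_H: "gs_accepted I k = H k"
  by (simp add: gs_accepted_def H_def)

lemma rejected_Suc: "gs_rejected I (Suc k) = (H k \<union> new k) - H (Suc k)"
  by (simp add: gs_rejected_def accepted_H new_def)

lemma new_iff: "(a, b) \<in> new k \<longleftrightarrow> (a, b) \<in> edges I \<and> (a, b) \<notin> P k \<and> (\<forall>b'. (a, b') \<notin> H k) \<and>
    (\<forall>b'. (a, b') \<in> edges I \<and> (a, b') \<notin> P k \<and> b' \<noteq> b \<longrightarrow> (b', b) \<in> student_pref I a)"
  by (auto simp: new_def gs_applications_def P_def H_def split_beta)

lemma H_Suc_subset: "H (Suc k) \<subseteq> H k \<union> new k"
  by (auto simp: state_Suc gs_choice_def)

lemma H_subset_P: "H k \<subseteq> P k"
  by (induction k) (use H_Suc_subset in \<open>auto simp: state_0 state_Suc(1)\<close>)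

lemma P_subset_edges: "P k \<subseteq> edges I"
  by (induction k) (auto simp: state_0 state_Suc(1) new_iff)

lemma new_unique: "(a, b) \<in> new k \<Longrightarrow> (a, b') \<in> new k \<Longrightarrow> b = b'"
  using student_pref_linear(5) by (metis new_iff)

lemma H_unique: "(a, b) \<in> H k \<Longrightarrow> (a, b') \<in> H k \<Longrightarrow> b = b'"
proof (induction k arbitrary: b b')
  case (Suc k)
  then have "(a, b) \<in> H k \<union> new k" "(a, b') \<in> H k \<union> new k" using H_Suc_subset by auto
  then show ?case using Suc.IH new_unique new_iff by blast
qed (simp add: state_0)

lemma P_upclosed: "(a, b) \<in> P k \<Longrightarrow> (b, b') \<in> student_pref I a \<Longrightarrow> (a, b') \<in> P k"
proof (induction k arbitrary: b b')
  case (Suc k)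
  have e: "(a, b) \<in> edges I" using Suc.prems P_subset_edges by blast
  have "(a, b') \<in> edges I" "b' \<noteq> b" "(b', b) \<notin> student_pref I a"
    using student_pref_linear[OF e] Suc.prems by blast+
  then show ?case using Suc by (auto simp: state_Suc(1) new_iff)
qed (simp add: state_0)

text \<open>All rejections up to step \<open>k\<close> in one increasing set: whoever has applied
  and is not held has been turned down.\<close>

definition gone :: "nat \<Rightarrow> ('a \<times> 'b) set" where "gone k = P k - H k"

lemma gone_Suc: "gone (Suc k) = gone k \<union> gs_rejected I (Suc k)"
  using H_Suc_subset[of k] by (auto simp: gone_def rejected_Suc state_Suc(1) new_iff dest: H_subset_P[THEN subsetD])

lemma rejected_not_gone: "x \<in> gs_rejected I (Suc k) \<Longrightarrow> x \<notin> gone k"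
  by (cases x) (auto simp: rejected_Suc gone_def new_iff)

lemma gone_mono: "k \<le> l \<Longrightarrow> gone k \<subseteq> gone l"
  by (induction l rule: dec_induct) (auto simp: gone_Suc)

lemma gone_rejected: "x \<in> gone k \<Longrightarrow> \<exists>l\<le>k. 0 < l \<and> x \<in> gs_rejected I l"
proof (induction k)
  case (Suc k)
  then show ?case by (auto simp: gone_Suc le_Suc_eq)
qed (simp add: gone_def state_0)

text \<open>A student applies in the order of its list and only while nobody holds it, so everything
  above its present school has been tried and lost.\<close>

lemma P_upclosed_gone:
  assumes "(a, b) \<in> H k \<union> new k" "(b, c) \<in> student_pref I a"
  shows "(a, c) \<in> gone k"
proof -
  have e: "(a, b) \<in> edges I" using assms(1) H_subset_P P_subset_edges new_iff by blast
  have ec: "(a, c) \<in> edges I" "c \<noteq> b" "(c, b) \<notin> student_pref I a"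
    using student_pref_linear[OF e] assms(2) by blast+
  have "(a, c) \<in> P k"
    using assms ec P_upclosed[OF subsetD[OF H_subset_P]] by (auto simp: new_iff)
  moreover have "(a, c) \<notin> H k" using assms(1) H_unique ec(2) new_iff by blast
  ultimately show ?thesis by (simp add: gone_def)
qed

definition held :: "nat \<Rightarrow> 'b \<Rightarrow> 'a set" where "held k b = {a. (a, b) \<in> H k}"

lemma finite_held: "finite {a. (a, b) \<in> edges I}" "finite (held k b)"
proof -
  show f: "finite {a. (a, b) \<in> edges I}"
    by (rule finite_subset[of _ "fst ` edges I"]) (use finite_edges in \<open>force+\<close>)
  show "finite (held k b)"
    by (rule finite_subset[OF _ f]) (use H_subset_P P_subset_edges in \<open>auto simp: held_def\<close>)
qed

lemma held_Suc:
  fixes k :: nat and b :: 'b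
  defines "C \<equiv> {a. (a, b) \<in> H k \<union> new k}"
  shows "card (held (Suc k) b) \<le> quota I b"
    and "a \<in> C - held (Suc k) b \<Longrightarrow> card (held (Suc k) b) = quota I b"
    and "a \<in> C - held (Suc k) b \<Longrightarrow> a' \<in> held (Suc k) b \<Longrightarrow> (a, a') \<in> school_pref I b"
proof -
  have sub: "C \<subseteq> {a. (a, b) \<in> edges I}"
    using H_subset_P P_subset_edges new_iff by (auto simp: C_def)
  have fC: "finite C" using sub finite_held(1) finite_subset by blast
  have hs: "held (Suc k) b = {a \<in> C. card {a' \<in> C. (a, a') \<in> school_pref I b} < quota I b}"
    by (auto simp: held_def state_Suc gs_choice_def C_def)
  have *: "trans (school_pref I b) \<and> irrefl (school_pref I b) \<and> total_on C (school_pref I b)" if "x \<in> C" for x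
    using school_pref_props[of x b] that sub by (auto simp: school_nbrs_def intro: total_on_subset)
  show "card (held (Suc k) b) \<le> quota I b"
  \<comment> \<open>The order of \<open>b\<close> is known to be linear only if \<open>b\<close> has
    an edge, so an empty \<open>C\<close> is treated apart.\<close>
  proof (cases "C = {}")
    case True then show ?thesis by (simp add: hs)
  next
    case False
    then show ?thesis using * top_ranked_card(1)[OF fC] unfolding hs by blast
  qed
  show "a \<in> C - held (Suc k) b \<Longrightarrow> card (held (Suc k) b) = quota I b"
    using * top_ranked_card(2)[OF fC] unfolding hs by blast
  show "a \<in> C - held (Suc k) b \<Longrightarrow> a' \<in> held (Suc k) b \<Longrightarrow> (a, a') \<in> school_pref I b"
    using * top_ranked_card(3)[OF fC] unfolding hs by blast
qed

lemma held_quota: "card (held k b) \<le> quota I b"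
  by (cases k) (auto simp: held_Suc(1), simp add: held_def state_0)

text \<open>A newcomer \<open>x\<close> to a full school must push out some \<open>y\<close>; then
  \<open>x\<close> beats \<open>y\<close>, and \<open>y\<close> beats everybody rejected before. So
  after its first rejection a school stays full and its students only get better.\<close>

lemma gone_full:
  "(a, b) \<in> gone k \<Longrightarrow> card (held k b) = quota I b \<and> (\<forall>a'\<in>held k b. (a, a') \<in> school_pref I b)"
proof (induction k arbitrary: a)
  case (Suc k)
  define C where "C = {a. (a, b) \<in> H k \<union> new k}"
  note hS = held_Suc[where k=k and b=b, folded C_def]
  have sub: "C \<subseteq> {a. (a, b) \<in> edges I}"
    using H_subset_P P_subset_edges new_iff by (auto simp: C_def)
  have fC: "finite C" using sub finite_held(1) finite_subset by blast
  have hsub: "held (Suc k) b \<subseteq> C" using H_Suc_subset by (auto simp: held_def C_def)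
  have kC: "held k b \<subseteq> C" by (auto simp: held_def C_def)
  show ?case
  proof (cases "(a, b) \<in> gs_rejected I (Suc k)")
    case True
    then have "a \<in> C - held (Suc k) b" by (auto simp: rejected_Suc C_def held_def)
    then show ?thesis using hS by blast
  next
    case False
    then have g: "(a, b) \<in> gone k" using Suc.prems by (simp add: gone_Suc)
    have ea: "(a, b) \<in> edges I" using g P_subset_edges by (auto simp: gone_def)
    note IH = Suc.IH[OF g]
    have full: "card (held (Suc k) b) = quota I b"
    proof (cases "C - held (Suc k) b = {}")
      case True
      then have "held k b \<subseteq> held (Suc k) b" using kC by blast
      then have "quota I b \<le> card (held (Suc k) b)" using IH finite_held(2) card_mono by metis
      then show ?thesis using hS(1) by simp
    next
      case False
      then show ?thesis using hS(2) by blast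
    qed
    moreover have "(a, x) \<in> school_pref I b" if x: "x \<in> held (Suc k) b" for x
    proof (cases "x \<in> held k b")
      case True then show ?thesis using IH by blast
    next
      case False
      have "\<not> held k b \<subseteq> held (Suc k) b"
      proof
        assume "held k b \<subseteq> held (Suc k) b"
        then have "held k b = held (Suc k) b"
          using full IH finite_held(2) card_subset_eq by metis
        then show False using x False by simp
      qed
      then obtain y where y: "y \<in> held k b" "y \<notin> held (Suc k) b" by blast
      then have "(y, x) \<in> school_pref I b" using hS(3) kC x by blast
      then show ?thesis using IH y school_pref_linear(6)[OF ea] by blast
    qed
    ultimately show ?thesis by blast
  qed
qed (simp add: gone_def state_0)

text \<open>A school that has rejected somebody is full, so it can only take in a new student by
  rejecting one that it holds.\<close>

lemma gone_displaced:
  assumes d: "(d, c) \<in> gone k" and a: "(a, c) \<in> H (Suc k)" "(a, c) \<notin> H k"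
  obtains e where "(e, c) \<in> H k" "(e, c) \<in> gs_rejected I (Suc k)" "(d, e) \<in> school_pref I c"
proof -
  have d': "(d, c) \<in> gone (Suc k)" using d by (simp add: gone_Suc)
  have "\<not> held k c \<subseteq> held (Suc k) c"
  proof
    assume "held k c \<subseteq> held (Suc k) c"
    then have "held k c = held (Suc k) c"
      using gone_full[OF d] gone_full[OF d'] finite_held(2) card_subset_eq by metis
    then show False using a by (auto simp: held_def)
  qed
  then obtain e where "(e, c) \<in> H k" "(e, c) \<notin> H (Suc k)" by (auto simp: held_def)
  then show thesis using that gone_full[OF d] by (auto simp: held_def rejected_Suc)
qed

lemma ex_stop: "\<exists>k. new k = {}"
proof (rule ccontr)
  assume "\<not> ?thesis"
  then have ne: "new k \<noteq> {}" for k by blast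
  have fP: "finite (P k)" for k using P_subset_edges finite_edges finite_subset by blast
  have "k \<le> card (P k)" for k
  proof (induction k)
    case (Suc k)
    have "P k \<subset> P (Suc k)" using ne[of k] by (auto simp: state_Suc(1) new_iff)
    then have "card (P k) < card (P (Suc k))" using fP psubset_card_mono by blast
    then show ?case using Suc by simp
  qed simp
  then have "Suc (card (edges I)) \<le> card (P (Suc (card (edges I))))" by blast
  also have "\<dots> \<le> card (edges I)" using P_subset_edges finite_edges card_mono by blast
  finally show False by simp
qed

definition T :: nat where "T = (LEAST k. new k = {})"

lemma new_T: "new T = {}"
  unfolding T_def using ex_stop by (rule LeastI_ex)

lemma gs_output_H: "gs_output I = H T"
  by (simp add: gs_output_def T_def new_def accepted_H)

text \<open>Without applications a school chooses among the students it holds, which fit its quota,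
  so it drops nobody.\<close>

lemma state_Suc_T: "gs_state I (Suc T) = gs_state I T"
proof -
  have "H (Suc T) = H T"
  proof
    show "H (Suc T) \<subseteq> H T" using H_Suc_subset[of T] new_T by simp
    show "H T \<subseteq> H (Suc T)"
    proof (clarify)
      fix a b assume ab: "(a, b) \<in> H T"
      show "(a, b) \<in> H (Suc T)"
      proof (rule ccontr)
        assume n: "(a, b) \<notin> H (Suc T)"
        then have "card (held (Suc T) b) = quota I b"
          using held_Suc(2)[of a b T] ab by (auto simp: held_def)
        moreover have "held (Suc T) b \<subset> held T b"
          using H_Suc_subset[of T] new_T ab n by (auto simp: held_def)
        ultimately have "quota I b < card (held T b)"
          using finite_held(2) psubset_card_mono by metis
        then show False using held_quota[of T b] by simp
      qed
    qed
  qed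
  moreover have "P (Suc T) = P T" by (simp add: state_Suc new_T)
  ultimately show ?thesis by (simp add: P_def H_def prod_eq_iff)
qed

lemma state_after_T: "T \<le> k \<Longrightarrow> gs_state I k = gs_state I T"
proof (induction k rule: dec_induct)
  case (step n)
  have "gs_state I (Suc n) = gs_step I (gs_state I n)" by (simp add: gs_state_def)
  also have "\<dots> = gs_state I (Suc T)" using step.IH by (simp add: gs_state_def)
  finally show ?case using state_Suc_T by simp
qed simp

lemma rejected_le_T: "x \<in> gs_rejected I k \<Longrightarrow> k \<le> T"
proof (rule ccontr)
  assume x: "x \<in> gs_rejected I k" and "\<not> k \<le> T"
  then obtain n where n: "k = Suc n" "T \<le> n" by (cases k) auto
  then have "H (Suc n) = H n" "new n = {}"
    using state_after_T[of n] state_after_T[of "Suc n"] new_T by (auto simp: H_def new_def)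
  then show False using x n by (simp add: rejected_Suc)
qed

lemma gone_le_T: "x \<in> gone k \<Longrightarrow> x \<in> gone T"
proof (cases "k \<le> T")
  case False
  then show "x \<in> gone k \<Longrightarrow> x \<in> gone T"
    using state_after_T[of k] by (simp add: gone_def P_def H_def)
qed (use gone_mono in blast)

definition G :: "'a \<Rightarrow> 'b option" where
  "G a = (if \<exists>b. (a, b) \<in> H T then Some (THE b. (a, b) \<in> H T) else None)"

lemma G_iff: "G a = Some b \<longleftrightarrow> (a, b) \<in> H T"
proof -
  have "(THE b. (a, b) \<in> H T) = b" if "(a, b) \<in> H T" for b
    using that H_unique by blast
  then show ?thesis by (auto simp: G_def)
qed

lemma G_output: "{(a, b). G a = Some b} = gs_output I"
  by (auto simp: G_iff gs_output_H)

lemma assigned_G: "assigned G b = held T b"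
  by (simp add: assigned_def held_def G_iff)

lemma unmatched_all_tried:
  assumes "G a = None" "(a, b) \<in> edges I"
  shows "(a, b) \<in> P T"
proof (rule ccontr)
  assume n: "(a, b) \<notin> P T"
  define A where "A = {b. (a, b) \<in> edges I - P T}"
  have "finite A"
    by (rule finite_subset[of _ "snd ` edges I"]) (use finite_edges in \<open>force simp: A_def\<close>)+
  moreover have "A \<noteq> {}" using n assms by (auto simp: A_def)
  moreover have "total_on A (student_pref I a)"
    by (rule total_on_subset[OF student_pref_props(3)[OF assms(2)]]) (auto simp: A_def student_nbrs_def)
  ultimately obtain x where "x \<in> A" "\<And>y. y \<in> A \<Longrightarrow> y \<noteq> x \<Longrightarrow> (y, x) \<in> student_pref I a"
    using linear_order_has_top student_pref_props(1,2)[OF assms(2)] by metis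
  moreover have "\<forall>b'. (a, b') \<notin> H T" using assms(1) by (metis G_iff option.distinct(1))
  ultimately have "(a, x) \<in> new T" by (auto simp: new_iff A_def)
  then show False using new_T by simp
qed

text \<open>The bridge from the run to the trading process: waiting lines under \<open>G\<close> are
  records of rejections. A student matched below \<open>b\<close> has applied to \<open>b\<close>
  before, and an unmatched one has tried its whole list.\<close>

lemma wants_G_iff: "wants I G a b \<longleftrightarrow> (a, b) \<in> gone T"
proof
  assume w: "wants I G a b"
  then have e: "(a, b) \<in> edges I" by (simp add: wants_def)
  show "(a, b) \<in> gone T"
  proof (cases "G a")
    case None
    then show ?thesis using unmatched_all_tried[OF None e] G_iff[of a b] by (auto simp: gone_def)
  next
    case (Some c)
    then show ?thesis using w P_upclosed_gone[of a c T b] by (auto simp: wants_def G_iff)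
  qed
next
  assume g: "(a, b) \<in> gone T"
  then have e: "(a, b) \<in> edges I" using P_subset_edges by (auto simp: gone_def)
  have "(c, b) \<in> student_pref I a" if "G a = Some c" for c
  proof (rule ccontr)
    assume n: "(c, b) \<notin> student_pref I a"
    have c: "(a, c) \<in> H T" using that by (simp add: G_iff)
    have ec: "(a, c) \<in> edges I" using c H_subset_P P_subset_edges by blast
    have "c \<noteq> b" using c g by (auto simp: gone_def)
    then have "(b, c) \<in> student_pref I a" using student_pref_linear(1)[OF e ec] n by blast
    moreover obtain k where k: "(a, b) \<in> gs_rejected I (Suc k)"
      using gone_rejected[OF g] by (metis gr0_conv_Suc)
    ultimately have "(a, c) \<in> gone k"
      using P_upclosed_gone[of a b k c] by (auto simp: rejected_Suc)
    then show False using gone_le_T c by (auto simp: gone_def)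
  qed
  then show "wants I G a b" using e by (simp add: wants_def)
qed

lemma stable_G: "stable I G"
  unfolding stable_def assignment_def
proof (intro conjI allI impI)
  fix a b
  show "G a = Some b \<Longrightarrow> (a, b) \<in> edges I" using H_subset_P P_subset_edges G_iff by blast
  show "card (assigned G b) \<le> quota I b" by (simp add: assigned_G held_quota)
  assume "wants I G a b"
  then have g: "(a, b) \<in> gone T" by (simp add: wants_G_iff)
  show "card (assigned G b) = quota I b" using gone_full[OF g] by (simp add: assigned_G)
  show "(a, a') \<in> school_pref I b" if "G a' = Some b" for a'
    using gone_full[OF g] that by (auto simp: held_def G_iff)
qed

section \<open>Student-optimality of the output\<close>

lemma finite_assigned: "assignment I M \<Longrightarrow> finite (assigned M b)"
  by (rule finite_subset[OF _ finite_held(1)[of b]]) (auto simp: assigned_def assignment_def)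

text \<open>At the first rejection of an \<open>N\<close>-partner \<open>a\<close> by
  \<open>b\<close>, the school holds some \<open>a'\<close> above \<open>a\<close> that
  \<open>N\<close> does not assign to \<open>b\<close>. Since \<open>a'\<close> has not lost its own
  \<open>N\<close>-partner before, it prefers \<open>b\<close>, and so \<open>a'\<close> and
  \<open>b\<close> block \<open>N\<close>.\<close>

lemma stable_not_gone:
  assumes N: "stable I N"
  shows "N a = Some b \<Longrightarrow> (a, b) \<notin> gone k"
proof (induction k arbitrary: a b)
  case (Suc k)
  have as: "assignment I N" using N by (simp add: stable_def)
  show ?case
  proof
    assume g: "(a, b) \<in> gone (Suc k)"
    have ea: "(a, b) \<in> edges I" using as Suc.prems by (simp add: assignment_def)
    note full = gone_full[OF g]
    have na: "a \<notin> held (Suc k) b" using g by (simp add: gone_def held_def)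
    have "\<not> held (Suc k) b \<subseteq> assigned N b"
    proof
      assume "held (Suc k) b \<subseteq> assigned N b"
      then have "held (Suc k) b \<subset> assigned N b" using Suc.prems na by (auto simp: assigned_def)
      then have "quota I b < card (assigned N b)"
        using full finite_assigned[OF as] psubset_card_mono by metis
      then show False using as by (simp add: assignment_def leD)
    qed
    then obtain a' where a': "(a', b) \<in> H (Suc k)" "N a' \<noteq> Some b" "(a, a') \<in> school_pref I b"
      using full by (auto simp: held_def assigned_def)
    have ea': "(a', b) \<in> edges I" using a'(1) H_subset_P P_subset_edges by blast
    have "wants I N a' b"
      unfolding wants_def
    proof (intro conjI allI impI)
      show "(a', b) \<in> edges I" by (rule ea')
      fix c assume c: "N a' = Some c"
      have ec: "(a', c) \<in> edges I" using c as by (simp add: assignment_def)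
      show "(c, b) \<in> student_pref I a'"
      proof (rule ccontr)
        assume "(c, b) \<notin> student_pref I a'"
        then have "(b, c) \<in> student_pref I a'"
          using student_pref_linear(1)[OF ea' ec] a'(2) c by auto
        then have "(a', c) \<in> gone k" using P_upclosed_gone a'(1) H_Suc_subset by blast
        then show False using Suc.IH[OF c] by simp
      qed
    qed
    then have "(a', a) \<in> school_pref I b" using N Suc.prems by (simp add: stable_def)
    then show False using a'(3) school_pref_linear(5)[OF ea] by blast
  qed
qed (simp add: gone_def state_0)

lemma stable_le_G: "stable I N \<Longrightarrow> N a = Some b \<Longrightarrow> \<not> wants I G a b"
  using stable_not_gone by (simp add: wants_G_iff)

section \<open>Arrival times and interrupters\<close>

definition arrival :: "'a \<Rightarrow> nat" where
  "arrival a = (LEAST k. \<exists>b. G a = Some b \<and> (a, b) \<in> H k)"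

lemma arrival:
  assumes a: "G a = Some b"
  obtains n where "arrival a = Suc n" "n < T" "(a, b) \<in> new n" "(a, b) \<in> H (Suc n)" "(a, b) \<notin> H n"
proof -
  have "\<exists>k. \<exists>b. G a = Some b \<and> (a, b) \<in> H k" using a G_iff by blast
  then have "\<exists>b. G a = Some b \<and> (a, b) \<in> H (arrival a)"
    unfolding arrival_def by (rule LeastI_ex)
  then have H: "(a, b) \<in> H (arrival a)" using a by simp
  have least: "arrival a \<le> k" if "(a, b) \<in> H k" for k
    unfolding arrival_def by (rule Least_le) (use a that in blast)
  obtain n where n: "arrival a = Suc n" using H state_0 by (cases "arrival a") auto
  have "arrival a \<le> T" using least a G_iff by blast
  moreover have "(a, b) \<notin> H n" using least[of n] n by auto
  moreover have "(a, b) \<in> new n" using H H_Suc_subset[of n] n calculation by auto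
  ultimately show thesis using that n H by auto
qed

text \<open>\<open>a\<close> loses \<open>b\<close> at a step after \<open>k\<close>, and it reaches
  its final school at a later step still, because it applies there only after that loss.\<close>

lemma arrival_gt:
  assumes a: "G a = Some c" and b: "(a, b) \<in> gone T" and k: "(a, b) \<notin> gone k"
  shows "Suc k < arrival a"
proof -
  obtain n where n: "arrival a = Suc n" "(a, c) \<in> new n" by (rule arrival[OF a])
  have "(c, b) \<in> student_pref I a" using b a by (simp add: wants_G_iff[symmetric] wants_def)
  then have "(a, b) \<in> gone n" using P_upclosed_gone n by blast
  then show ?thesis using k gone_mono[of n k] n by (metis not_less_eq not_le subsetD less_Suc_eq_le)
qed

text \<open>Somebody must be rejected by \<open>c\<close> between the entry of \<open>e\<close> at
  step \<open>k\<close> and step \<open>n\<close>. If \<open>d\<close> was gone before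
  \<open>e\<close> entered, \<open>c\<close> was full and the entry itself pushed somebody out, at
  step \<open>k\<close>; otherwise the rejection of \<open>d\<close> falls into that
  interval.\<close>

lemma displaced_interrupts:
  assumes d: "(d, c) \<in> gone n" and e: "(e, c) \<in> H n" "(e, c) \<in> gs_rejected I (Suc n)"
  shows "interrupting_pair I e c (Suc n)"
proof -
  define k where "k = (LEAST k. (e, c) \<in> H k)"
  have k: "(e, c) \<in> H k" unfolding k_def using e(1) by (rule LeastI)
  have kn: "k \<le> n" unfolding k_def using e(1) by (rule Least_le)
  obtain k0 where k0: "k = Suc k0" using k state_0 by (cases k) auto
  have nk0: "(e, c) \<notin> H k0" using not_less_Least[of k0 "\<lambda>k. (e, c) \<in> H k"] k0 k_def by simp
  have "\<exists>l\<in>{k..<Suc n}. \<exists>a'. (a', c) \<in> gs_rejected I l"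
  proof (cases "(d, c) \<in> gone k0")
    case True
    then obtain e' where "(e', c) \<in> gs_rejected I (Suc k0)" using gone_displaced k nk0 k0 by metis
    then show ?thesis using k0 kn by (intro bexI[of _ k]) auto
  next
    case False
    obtain l where l: "l \<le> n" "0 < l" "(d, c) \<in> gs_rejected I l" using gone_rejected[OF d] by blast
    then obtain l0 where l0: "l = Suc l0" by (cases l) auto
    have "\<not> l \<le> k0"
    proof
      assume "l \<le> k0"
      then have "(d, c) \<in> gone k0" using gone_mono l l0 gone_Suc by blast
      then show False using False by simp
    qed
    then show ?thesis using l k0 by (intro bexI[of _ l]) auto
  qed
  then show ?thesis using k kn e(2) unfolding interrupting_pair_def accepted_H
    by (intro exI[of _ k]) auto
qed

end

section \<open>The trading process\<close>

definition settled :: "'b set \<Rightarrow> ('a \<Rightarrow> 'b option) \<Rightarrow> 'a \<Rightarrow> bool" where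
  "settled X M a \<longleftrightarrow> (\<forall>c. M a = Some c \<longrightarrow> c \<in> X)"

definition pick :: "('a, 'b) assignment_instance \<Rightarrow> 'a set \<Rightarrow> ('a \<Rightarrow> 'b option) \<Rightarrow> 'b set
    \<Rightarrow> 'b \<Rightarrow> 'a \<Rightarrow> bool" where
  "pick I Ab M X b d \<longleftrightarrow> wants I M d b \<and> \<not> settled X M d \<and>
     (\<forall>a. wants I M a b \<and> (d, a) \<in> school_pref I b \<longrightarrow> a \<in> Ab \<and> settled X M a)"

definition blocked :: "('a, 'b) assignment_instance \<Rightarrow> 'a set \<Rightarrow> ('a \<Rightarrow> 'b option) \<Rightarrow> 'b set
    \<Rightarrow> 'b \<Rightarrow> bool" where
  "blocked I Ab M X b \<longleftrightarrow> (\<forall>d. wants I M d b \<and> \<not> settled X M d \<longrightarrow>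
     (\<exists>a. wants I M a b \<and> settled X M a \<and> a \<notin> Ab \<and> (d, a) \<in> school_pref I b))"

definition exchange :: "('a \<Rightarrow> 'b option) \<Rightarrow> 'b set \<Rightarrow> ('b \<Rightarrow> 'a) \<Rightarrow> 'a \<Rightarrow> 'b option" where
  "exchange M C d = (\<lambda>a. if a \<in> d ` C then Some (inv_into C d a) else M a)"

text \<open>Schools in \<open>X\<close> are settled, and so are the students assigned to them; an unassigned student
  counts as settled. The pick of a school is its favourite student among those that want it, where
  settled consenting students are passed over but a settled student who does not consent blocks
  everybody below. A trade moves the picks of the schools in \<open>C\<close> along a permutation of \<open>C\<close>, which
  need not be a single cycle: this makes the union of two trades a trade and the steps commute.\<close>

inductive step :: "('a, 'b) assignment_instance \<Rightarrow> 'a set \<Rightarrow>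
    ('a \<Rightarrow> 'b option) \<times> 'b set \<Rightarrow> ('a \<Rightarrow> 'b option) \<times> 'b set \<Rightarrow> bool" for I Ab where
  settle: "blocked I Ab M X b \<Longrightarrow> step I Ab (M, X) (M, insert b X)"
| trade: "\<lbrakk>finite C; \<And>b. b \<in> C \<Longrightarrow> pick I Ab M X b (d b); (\<lambda>b. M (d b)) ` C = Some ` C\<rbrakk>
    \<Longrightarrow> step I Ab (M, X) (exchange M C d, X)"

lemma exchange_simps:
  assumes "inj_on d C"
  shows "b \<in> C \<Longrightarrow> exchange M C d (d b) = Some b"
    and "a \<notin> d ` C \<Longrightarrow> exchange M C d a = M a"
  using assms by (auto simp: exchange_def)

lemma exchange_eqI:
  assumes "inj_on d C" "\<And>b. b \<in> C \<Longrightarrow> M' (d b) = Some b" "\<And>a. a \<notin> d ` C \<Longrightarrow> M' a = M a"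
  shows "M' = exchange M C d"
  using assms by (auto simp: fun_eq_iff exchange_def)

text \<open>A smallest nonempty subset closed under \<open>f\<close> has an image of the same kind,
  which cannot be smaller. This finds a permuted set without naming a cycle.\<close>

lemma invariant_core:
  fixes f :: "'v \<Rightarrow> 'v"
  assumes "finite F" "F \<noteq> {}" "f ` F \<subseteq> F"
  obtains C where "C \<subseteq> F" "C \<noteq> {}" "f ` C = C"
proof -
  define Q where "Q C \<longleftrightarrow> C \<subseteq> F \<and> C \<noteq> {} \<and> f ` C \<subseteq> C" for C
  have "Q F" using assms by (simp add: Q_def)
  then obtain C where C: "Q C" and min: "\<And>C'. Q C' \<Longrightarrow> card C \<le> card C'"
    using exists_least_iff[of "\<lambda>n. \<exists>C. Q C \<and> card C = n"] by (metis not_le)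
  have "Q (f ` C)" using C by (auto simp: Q_def)
  then have "card C \<le> card (f ` C)" by (rule min)
  moreover have "finite C" using C assms(1) finite_subset by (auto simp: Q_def)
  ultimately have "f ` C = C" using C by (intro card_seteq) (auto simp: Q_def)
  then show thesis using that C by (auto simp: Q_def)
qed

section \<open>Picks and blocked schools\<close>

context assignment_problem
begin

lemma wants_edge: "wants I M a b \<Longrightarrow> (a, b) \<in> edges I"
  by (simp add: wants_def)

lemma ex_favourite:
  assumes W: "W \<noteq> {}" "\<And>a. a \<in> W \<Longrightarrow> (a, b) \<in> edges I"
  obtains x where "x \<in> W" "\<And>y. y \<in> W \<Longrightarrow> y \<noteq> x \<Longrightarrow> (y, x) \<in> school_pref I b"
proof -
  obtain a where e: "(a, b) \<in> edges I" using W by blast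
  have sub: "W \<subseteq> {a. (a, b) \<in> edges I}" using W(2) by blast
  then have "finite W" using finite_held(1) finite_subset by blast
  moreover have "total_on W (school_pref I b)"
    by (rule total_on_subset[OF school_pref_props(3)[OF e]]) (use sub in \<open>auto simp: school_nbrs_def\<close>)
  ultimately show thesis using linear_order_has_top[OF _ W(1)] school_pref_props(1,2)[OF e] that by metis
qed

lemma not_wants_own: "M a = Some b \<Longrightarrow> \<not> wants I M a b"
  using student_pref_linear(4) by (auto simp: wants_def)

lemma pick_unique: "pick I Ab M X b d \<Longrightarrow> pick I Ab M X b d' \<Longrightarrow> d = d'"
  using school_pref_linear(1) wants_edge unfolding pick_def by metis

lemma pick_not_blocked: "pick I Ab M X b d \<Longrightarrow> \<not> blocked I Ab M X b"
  unfolding pick_def blocked_def by blast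

text \<open>The best unsettled student in line is the pick: whoever stands above it also stands
  above the witness \<open>d0\<close>, which no settled dissenter precedes.\<close>

lemma not_blocked_pick:
  assumes "\<not> blocked I Ab M X b"
  shows "\<exists>d. pick I Ab M X b d"
proof -
  obtain d0 where d0: "wants I M d0 b" "\<not> settled X M d0"
    and up: "\<And>a. wants I M a b \<Longrightarrow> settled X M a \<Longrightarrow> (d0, a) \<in> school_pref I b \<Longrightarrow> a \<in> Ab"
    using assms unfolding blocked_def by blast
  have e: "(d0, b) \<in> edges I" using d0 by (simp add: wants_edge)
  define U where "U = {d. wants I M d b \<and> \<not> settled X M d}"
  obtain d1 where d1: "d1 \<in> U" "\<And>y. y \<in> U \<Longrightarrow> y \<noteq> d1 \<Longrightarrow> (y, d1) \<in> school_pref I b"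
    by (rule ex_favourite[of U b]) (use d0 wants_edge in \<open>auto simp: U_def\<close>)
  have e1: "(d1, b) \<in> edges I" using d1(1) by (auto simp: U_def wants_edge)
  have "a \<in> Ab \<and> settled X M a" if a: "wants I M a b" "(d1, a) \<in> school_pref I b" for a
  proof -
    have s: "settled X M a"
    proof (rule ccontr)
      assume "\<not> settled X M a"
      then have "a \<in> U" using a by (simp add: U_def)
      then have "a = d1 \<or> (a, d1) \<in> school_pref I b" using d1(2) by blast
      then show False using a(2) school_pref_linear(4,5)[OF e1] by blast
    qed
    have "d0 \<in> U" using d0 by (simp add: U_def)
    then have "d0 = d1 \<or> (d0, d1) \<in> school_pref I b" using d1(2) by blast
    then have "(d0, a) \<in> school_pref I b" using a(2) school_pref_linear(6)[OF e] by blast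
    then show ?thesis using up a s by blast
  qed
  then show ?thesis using d1(1) by (auto simp: pick_def U_def)
qed

section \<open>What a trade preserves\<close>

context
  fixes Ab :: "'a set" and M :: "'a \<Rightarrow> 'b option" and X C :: "'b set" and d :: "'b \<Rightarrow> 'a"
  assumes fin: "finite C" and pk: "\<And>b. b \<in> C \<Longrightarrow> pick I Ab M X b (d b)"
    and cyc: "(\<lambda>b. M (d b)) ` C = Some ` C"
begin

text \<open>A map from a finite set onto one of the same size is injective. This also keeps the
  picks of different schools apart.\<close>

lemma trade_inj: "inj_on (\<lambda>b. M (d b)) C"
  by (rule eq_card_imp_inj_on[OF fin]) (simp add: cyc card_image)

lemma trade_inj_d: "inj_on d C"
  using trade_inj by (auto simp: inj_on_def)

lemma trade_from: "b \<in> C \<Longrightarrow> \<exists>c\<in>C. M (d b) = Some c"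
  using cyc by blast

lemma trade_disjoint: "C \<inter> X = {}"
proof -
  have "b \<notin> X" if "b \<in> C" for b
  proof -
    have "Some b \<in> (\<lambda>b. M (d b)) ` C" using that cyc by simp
    then obtain b' where "b' \<in> C" "M (d b') = Some b" by force
    then show ?thesis using pk[of b'] by (auto simp: pick_def settled_def)
  qed
  then show ?thesis by blast
qed

lemmas trade_simps = exchange_simps[OF trade_inj_d, where M = M]

text \<open>A trade makes nobody worse off, so waiting lines only shrink.\<close>

lemma trade_wants: "wants I (exchange M C d) a b \<Longrightarrow> wants I M a b"
proof (cases "a \<in> d ` C")
  case True
  then obtain c where c: "c \<in> C" "a = d c" by blast
  assume w: "wants I (exchange M C d) a b"
  have "wants I M a c" using pk c by (auto simp: pick_def)
  moreover have "(c, b) \<in> student_pref I a" using w c trade_simps by (auto simp: wants_def)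
  moreover have "(a, c) \<in> edges I" using calculation by (simp add: wants_def)
  ultimately show ?thesis
    using w student_pref_linear(3,6) unfolding wants_def by metis
qed (simp add: wants_def trade_simps)

text \<open>Those who trade leave schools of \<open>C\<close> for schools of \<open>C\<close>, all
  of them outside \<open>X\<close>.\<close>

lemma trade_settled: "settled X (exchange M C d) a \<longleftrightarrow> settled X M a"
proof (cases "a \<in> d ` C")
  case True
  then obtain c where c: "c \<in> C" "a = d c" by blast
  have "\<not> settled X M a" using pk c by (auto simp: pick_def)
  moreover have "\<not> settled X (exchange M C d) a"
    using c trade_simps trade_disjoint by (auto simp: settled_def)
  ultimately show ?thesis by simp
qed (simp add: settled_def trade_simps)

lemma trade_settled_same: "settled X M a \<Longrightarrow> exchange M C d a = M a"
  using pk by (intro trade_simps(2)) (auto simp: pick_def)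

text \<open>Here and in \<open>trade_blocked\<close>: lines only shrink, settled students do not
  move, and nobody changes between settled and unsettled, so picks left in place and blocks
  persist.\<close>

lemma trade_pick: "pick I Ab M X b e \<Longrightarrow> e \<notin> d ` C \<Longrightarrow> pick I Ab (exchange M C d) X b e"
  using trade_wants trade_settled trade_simps(2) unfolding pick_def
  by (metis wants_def)

lemma trade_blocked: "blocked I Ab M X b \<Longrightarrow> blocked I Ab (exchange M C d) X b"
  unfolding blocked_def using trade_wants trade_settled trade_settled_same
  by (metis wants_def)

text \<open>What remains of the permutation outside \<open>C1\<close> is a permutation of
  \<open>C - C1\<close>, and the picks of those schools are not moved by the first part; so the
  larger trade can be completed afterwards.\<close>

lemma trade_sub:
  assumes C1: "C1 \<subseteq> C" "(\<lambda>b. M (d b)) ` C1 = Some ` C1"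
  shows "step I Ab (exchange M C1 d, X) (exchange M C d, X)"
proof -
  have fin1: "finite C1" using C1 fin finite_subset by blast
  have inj1: "inj_on d C1" using trade_inj_d C1 inj_on_subset by blast
  have injd: "inj_on d (C - C1)" by (rule inj_on_subset[OF trade_inj_d]) auto
  define M1 where "M1 = exchange M C1 d"
  have out: "d b \<notin> d ` C1" if "b \<in> C - C1" for b
    using that C1(1) inj_onD[OF trade_inj_d, of b] by blast
  have same: "M1 (d b) = M (d b)" if "b \<in> C - C1" for b
    unfolding M1_def using exchange_simps(2)[OF inj1] out that by blast
  have "step I Ab (M1, X) (exchange M1 (C - C1) d, X)"
  proof (rule step.trade)
    show "finite (C - C1)" using fin by simp
    show "pick I Ab M1 X b (d b)" if "b \<in> C - C1" for b
      unfolding M1_def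
      by (rule assignment_problem.trade_pick[OF assignment_problem_axioms fin1 _ C1(2) pk])
        (use that out pk C1 in auto)
    have "(\<lambda>b. M1 (d b)) ` (C - C1) = (\<lambda>b. M (d b)) ` (C - C1)" using same by simp
    also have "\<dots> = Some ` C - Some ` C1"
      using inj_on_image_set_diff[OF trade_inj, of C C1] C1 cyc by simp
    also have "\<dots> = Some ` (C - C1)" by auto
    finally show "(\<lambda>b. M1 (d b)) ` (C - C1) = Some ` (C - C1)" .
  qed
  moreover have "exchange M1 (C - C1) d = exchange M C d"
  proof (rule exchange_eqI[OF trade_inj_d])
    fix b assume b: "b \<in> C"
    show "exchange M1 (C - C1) d (d b) = Some b"
    proof (cases "b \<in> C1")
      case True
      then have "d b \<notin> d ` (C - C1)" using out by (metis imageE imageI)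
      then show ?thesis using exchange_simps(2)[OF injd] exchange_simps(1)[OF inj1 True] by (simp add: M1_def)
    next
      case False then show ?thesis using exchange_simps(1)[OF injd] b by simp
    qed
  next
    fix a assume "a \<notin> d ` C"
    then have "a \<notin> d ` (C - C1)" "a \<notin> d ` C1" using C1 by auto
    then show "exchange M1 (C - C1) d a = M a"
      using exchange_simps(2)[OF injd] exchange_simps(2)[OF inj1] by (simp add: M1_def)
  qed
  ultimately show ?thesis by (simp add: M1_def)
qed

end

section \<open>Commutation of steps and confluence\<close>

lemma settle_commutes_trade:
  assumes b: "blocked I Ab M X b0"
    and t: "finite C" "\<And>b. b \<in> C \<Longrightarrow> pick I Ab M X b (d b)" "(\<lambda>b. M (d b)) ` C = Some ` C"
  shows "\<exists>u. step I Ab (M, insert b0 X) u \<and> step I Ab (exchange M C d, X) u"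
proof (intro exI conjI)
  show "step I Ab (exchange M C d, X) (exchange M C d, insert b0 X)"
    by (rule step.settle) (rule trade_blocked[OF t b])
  \<comment> \<open>A blocked school has no pick and takes no part in the trade. So every trading
    student sits at a school of \<open>C\<close> other than \<open>b0\<close> and remains unsettled
    when \<open>b0\<close> is settled.\<close>
  have "b0 \<notin> C" using t(2) b pick_not_blocked by blast
  show "step I Ab (M, insert b0 X) (exchange M C d, insert b0 X)"
  proof (rule step.trade)
    show "finite C" "(\<lambda>b. M (d b)) ` C = Some ` C" by (rule t)+
    fix b assume c: "b \<in> C"
    then obtain c where c': "c \<in> C" "M (d b) = Some c" using trade_from[OF t] by blast
    moreover have "c \<notin> X" using trade_disjoint[OF t] c' by blast
    ultimately have "\<not> settled (insert b0 X) M (d b)" using \<open>b0 \<notin> C\<close> by (auto simp: settled_def)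
    then show "pick I Ab M (insert b0 X) b (d b)"
      using t(2)[OF c] unfolding pick_def by (auto simp: settled_def)
  qed
qed

lemma trades_commute:
  assumes t1: "finite C1" "\<And>b. b \<in> C1 \<Longrightarrow> pick I Ab M X b (d1 b)" "(\<lambda>b. M (d1 b)) ` C1 = Some ` C1"
    and t2: "finite C2" "\<And>b. b \<in> C2 \<Longrightarrow> pick I Ab M X b (d2 b)" "(\<lambda>b. M (d2 b)) ` C2 = Some ` C2"
  shows "\<exists>u. step I Ab (exchange M C1 d1, X) u \<and> step I Ab (exchange M C2 d2, X) u"
proof -
  \<comment> \<open>Picks are unique, so \<open>d1\<close> and \<open>d2\<close> agree where both
    apply, and together they permute \<open>C1 \<union> C2\<close>.\<close>
  define d where "d b = (if b \<in> C1 then d1 b else d2 b)" for b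
  have d1: "d b = d1 b" if "b \<in> C1" for b using that by (simp add: d_def)
  have d2: "d b = d2 b" if "b \<in> C2" for b
    using that t1(2)[of b] t2(2)[OF that] pick_unique[of Ab M X b] by (auto simp: d_def)
  have pk: "pick I Ab M X b (d b)" if "b \<in> C1 \<union> C2" for b using that t1(2) t2(2) by (auto simp: d_def)
  have c1: "(\<lambda>b. M (d b)) ` C1 = Some ` C1" using t1(3) d1 by simp
  have c2: "(\<lambda>b. M (d b)) ` C2 = Some ` C2" using t2(3) d2 by simp
  have c: "(\<lambda>b. M (d b)) ` (C1 \<union> C2) = Some ` (C1 \<union> C2)" using c1 c2 by (simp add: image_Un)
  have f: "finite (C1 \<union> C2)" using t1 t2 by simp
  have inj: "inj_on d (C1 \<union> C2)" by (rule trade_inj_d[OF f pk c])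
  have i1: "inj_on d C1" and i2: "inj_on d C2" using inj by (auto intro: inj_on_subset)
  have x1: "exchange M C1 d1 = exchange M C1 d"
    by (rule exchange_eqI[OF i1])
      (use exchange_simps[OF trade_inj_d[OF t1]] d1 in \<open>auto simp: image_iff\<close>)
  have x2: "exchange M C2 d2 = exchange M C2 d"
    by (rule exchange_eqI[OF i2])
      (use exchange_simps[OF trade_inj_d[OF t2]] d2 in \<open>auto simp: image_iff\<close>)
  show ?thesis unfolding x1 x2
    using trade_sub[OF f pk c _ c1] trade_sub[OF f pk c _ c2] by blast
qed

lemma step_confluent: "confluentp (step I Ab)"
proof (rule strong_confluentp_imp_confluentp, rule strong_confluentpI)
  fix x y z assume "step I Ab x y" "step I Ab x z"
  then have "\<exists>u. step I Ab y u \<and> step I Ab z u"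
  proof cases
    case s1: (settle M X b)
    from \<open>step I Ab x z\<close> show ?thesis unfolding s1(1)
    proof cases
      case s2: (settle b')
      have "step I Ab (M, insert b X) (M, insert b' (insert b X))"
        "step I Ab (M, insert b' X) (M, insert b (insert b' X))"
        using s1 s2 by (auto simp: blocked_def settled_def intro!: step.settle) blast+
      then show ?thesis using s1 s2 by (metis insert_commute)
    next
      case s2: (trade C d)
      show ?thesis unfolding s1 s2 by (rule settle_commutes_trade) (use s1 s2 in auto)
    qed
  next
    case s1: (trade C M X d)
    from \<open>step I Ab x z\<close> show ?thesis unfolding s1(1)
    proof cases
      case s2: (settle b)
      show ?thesis unfolding s1 s2 using settle_commutes_trade[of Ab M X b C d] s1 s2 by blast
    next
      case s2: (trade C' d')
      show ?thesis unfolding s1 s2 by (rule trades_commute) (use s1 s2 in auto)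
    qed
  qed
  then show "\<exists>u. (step I Ab)\<^sup>*\<^sup>* y u \<and> (step I Ab)\<^sup>=\<^sup>= z u" by blast
qed

text \<open>Steps never run out, as the empty trade is always possible; normal forms are therefore
  of no use. A nonempty trade, however, involves only unsettled schools that have edges, so here the
  assignment is final although \<open>X\<close> may still grow.\<close>

lemma all_settled_final:
  assumes "(step I Ab)\<^sup>*\<^sup>* s s'" "snd ` edges I \<subseteq> snd s"
  shows "fst s' = fst s \<and> snd s \<subseteq> snd s'"
  using assms
proof (induction rule: rtranclp_induct)
  case (step y z)
  from step.hyps(2) have "fst z = fst y \<and> snd y \<subseteq> snd z"
  proof cases
    case (trade C M X d)
    have "C = {}"
    proof (rule ccontr)
      assume "C \<noteq> {}"
      then obtain b where b: "b \<in> C" by blast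
      then have "(d b, b) \<in> edges I" using trade(4) by (auto simp: pick_def wants_def)
      then have "b \<in> snd ` edges I" by (metis imageI snd_conv)
      then have "b \<in> X" using step.IH step.prems trade(1) by auto
      moreover have "C \<inter> X = {}" by (rule trade_disjoint) (use trade in auto)
      ultimately show False using b by blast
    qed
    then show ?thesis using trade by (auto simp: exchange_def)
  qed auto
  then show ?case using step by auto
qed simp

text \<open>By confluence the final assignment stays within reach of every state met on the way, so
  a run may be rearranged.\<close>

lemma final_from_reachable:
  assumes "(step I Ab)\<^sup>*\<^sup>* s (M, X)" "snd ` edges I \<subseteq> X" "(step I Ab)\<^sup>*\<^sup>* s s'"
  obtains X' where "(step I Ab)\<^sup>*\<^sup>* s' (M, X')" "X \<subseteq> X'"
proof -
  obtain u where "(step I Ab)\<^sup>*\<^sup>* (M, X) u" "(step I Ab)\<^sup>*\<^sup>* s' u"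
    using confluentpD[OF step_confluent assms(1,3)] by blast
  then show thesis using that all_settled_final[of Ab "(M, X)" u] assms(2) by (metis fst_conv snd_conv surj_pair)
qed

section \<open>Rural hospitals and rotations\<close>

lemma stable_improvement:
  assumes N: "stable I N" and N': "stable I N'" and le: "\<And>a b. N a = Some b \<Longrightarrow> \<not> wants I N' a b"
  shows "N' a = Some b \<Longrightarrow> N a \<noteq> Some b \<Longrightarrow> wants I N a b"
    and "card (assigned N b) = card (assigned N' b)"
    and "N a = None \<longleftrightarrow> N' a = None"
proof -
  have asN: "assignment I N" and asN': "assignment I N'" using N N' by (auto simp: stable_def)
  have want: "wants I N a b" if "N' a = Some b" "N a \<noteq> Some b" for a b
    unfolding wants_def
  proof (intro conjI allI impI)
    show e: "(a, b) \<in> edges I" using that asN' by (simp add: assignment_def)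
    fix c assume c: "N a = Some c"
    have "(a, c) \<in> edges I" using c asN by (simp add: assignment_def)
    then show "(c, b) \<in> student_pref I a"
      using le[OF c] that c student_pref_linear(1)[OF e, of c] by (auto simp: wants_def)
  qed
  then show "N' a = Some b \<Longrightarrow> N a \<noteq> Some b \<Longrightarrow> wants I N a b" .
  \<comment> \<open>A school with more students under \<open>N'\<close> has a newcomer who wants it
    under \<open>N\<close>; so it is full under \<open>N\<close> and cannot have more.\<close>
  have leq: "card (assigned N' c) \<le> card (assigned N c)" for c
  proof (rule ccontr)
    assume "\<not> ?thesis"
    then have gt: "card (assigned N c) < card (assigned N' c)" by simp
    then have "\<not> assigned N' c \<subseteq> assigned N c" using card_mono[OF finite_assigned[OF asN, of c], of "assigned N' c"] by linarith
    then obtain x where "N' x = Some c" "N x \<noteq> Some c" by (auto simp: assigned_def)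
    then have "card (assigned N c) = quota I c" using want N by (auto simp: stable_def)
    then show False using gt asN' by (simp add: assignment_def leD)
  qed
  define B where "B = snd ` edges I"
  have fB: "finite B" using finite_edges by (simp add: B_def)
  have dom: "{a. M a \<noteq> None} = (\<Union>c\<in>B. assigned M c)" if "assignment I M" for M
    using that by (force simp: assigned_def assignment_def B_def)
  have card_dom: "card {a. M a \<noteq> None} = (\<Sum>c\<in>B. card (assigned M c))" if "assignment I M" for M
    unfolding dom[OF that]
    by (rule card_UN_disjoint) (use fB finite_assigned[OF that] in \<open>auto simp: assigned_def\<close>)
  have fd: "finite {a. M a \<noteq> None}" if "assignment I M" for M
    unfolding dom[OF that] using fB finite_assigned[OF that] by simp
  have sub: "{a. N a \<noteq> None} \<subseteq> {a. N' a \<noteq> None}"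
    using le asN by (force simp: wants_def assignment_def)
  \<comment> \<open>Students assigned under \<open>N\<close> stay assigned under \<open>N'\<close>,
    so the total load does not shrink; since no single load grows, all loads agree. This is the
    rural hospitals theorem for comparable assignments.\<close>
  have 1: "(\<Sum>c\<in>B. card (assigned N c)) \<le> (\<Sum>c\<in>B. card (assigned N' c))"
    using card_mono[OF fd[OF asN'] sub] card_dom[OF asN] card_dom[OF asN'] by simp
  have 2: "(\<Sum>c\<in>B. card (assigned N' c)) \<le> (\<Sum>c\<in>B. card (assigned N c))"
    by (rule sum_mono) (rule leq)
  have eq: "(\<Sum>c\<in>B. card (assigned N' c)) = (\<Sum>c\<in>B. card (assigned N c))" using 1 2 by simp
  show "card (assigned N b) = card (assigned N' b)"
  proof (cases "b \<in> B")
    case True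
    show ?thesis by (rule sum_mono_inv[OF eq leq True fB, symmetric])
  next
    case False
    then have "(a, b) \<notin> edges I" for a by (force simp: B_def)
    then have "assigned N b = {}" "assigned N' b = {}"
      using asN asN' unfolding assigned_def assignment_def by blast+
    then show ?thesis by simp
  qed
  have "{a. N a \<noteq> None} = {a. N' a \<noteq> None}"
    by (rule card_subset_eq[OF fd[OF asN'] sub]) (use eq card_dom[OF asN] card_dom[OF asN'] in simp)
  then show "N a = None \<longleftrightarrow> N' a = None" by blast
qed

text \<open>\<open>F\<close> collects the schools that gain a student on the way to
  \<open>N'\<close>, and \<open>d b\<close> heads the line of \<open>b\<close>. Stability of
  \<open>N'\<close> forces \<open>d b\<close> to leave its school, which gains another student
  because its load is the same under \<open>N\<close> and \<open>N'\<close>. So following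
  \<open>d\<close> and then \<open>N\<close> leads from \<open>F\<close> into \<open>F\<close>, and
  \<open>invariant_core\<close> yields a permuted part.\<close>

lemma rotation_exists:
  assumes N: "stable I N" and N': "stable I N'" and le: "\<And>a b. N a = Some b \<Longrightarrow> \<not> wants I N' a b"
    and ne: "N \<noteq> N'"
  obtains C d where "finite C" "C \<noteq> {}" "\<And>b. b \<in> C \<Longrightarrow> wants I N (d b) b"
    "\<And>b a. b \<in> C \<Longrightarrow> wants I N a b \<Longrightarrow> a \<noteq> d b \<Longrightarrow> (a, d b) \<in> school_pref I b"
    "\<And>b. b \<in> C \<Longrightarrow> \<not> wants I N' (d b) b" "(\<lambda>b. N (d b)) ` C = Some ` C"
proof -
  have imp: "N' a = Some b \<Longrightarrow> N a \<noteq> Some b \<Longrightarrow> wants I N a b"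
    "card (assigned N b) = card (assigned N' b)" "N a = None \<longleftrightarrow> N' a = None" for a b
    by (rule stable_improvement[OF N N' le]; assumption)+
  have asN: "assignment I N" and asN': "assignment I N'" using N N' by (auto simp: stable_def)
  define F where "F = {b. \<exists>a. N' a = Some b \<and> N a \<noteq> Some b}"
  have "\<exists>x. wants I N x b \<and> (\<forall>a. wants I N a b \<longrightarrow> a \<noteq> x \<longrightarrow> (a, x) \<in> school_pref I b)" if b: "b \<in> F" for b
  proof -
    obtain a where "N' a = Some b" "N a \<noteq> Some b" using b unfolding F_def by blast
    then have a: "wants I N a b" by (rule imp(1))
    obtain x where "x \<in> {a. wants I N a b}"
      "\<And>y. y \<in> {a. wants I N a b} \<Longrightarrow> y \<noteq> x \<Longrightarrow> (y, x) \<in> school_pref I b"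
      by (rule ex_favourite[of "{a. wants I N a b}" b]) (use a wants_edge in auto)
    then show ?thesis by auto
  qed
  then obtain d where d: "\<And>b. b \<in> F \<Longrightarrow> wants I N (d b) b"
    and top: "\<And>b a. b \<in> F \<Longrightarrow> wants I N a b \<Longrightarrow> a \<noteq> d b \<Longrightarrow> (a, d b) \<in> school_pref I b"
    by metis
  have nw: "\<not> wants I N' (d b) b" if b: "b \<in> F" for b
  proof
    assume w: "wants I N' (d b) b"
    obtain a where a: "N' a = Some b" "wants I N a b" using b imp(1) by (auto simp: F_def)
    have "(d b, a) \<in> school_pref I b" using N' w a by (auto simp: stable_def)
    moreover have "a \<noteq> d b" using w a not_wants_own by blast
    ultimately show False
      using top[OF b a(2)] school_pref_linear(5)[OF wants_edge[OF a(2)]] by blast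
  qed
  have f: "\<exists>c\<in>F. N (d b) = Some c" if b: "b \<in> F" for b
  proof -
    have neq: "N (d b) \<noteq> N' (d b)" using nw[OF b] d[OF b] by (auto simp: wants_def)
    then obtain c where c: "N (d b) = Some c" using imp(3)[of "d b"] by (cases "N (d b)") auto
    have "\<not> assigned N' c \<subseteq> assigned N c"
    proof
      assume "assigned N' c \<subseteq> assigned N c"
      then have "assigned N' c = assigned N c"
        using card_subset_eq[OF finite_assigned[OF asN]] imp(2)[of c] by metis
      moreover have "d b \<in> assigned N c" using c by (simp add: assigned_def)
      ultimately have "d b \<in> assigned N' c" by simp
      then show False using c neq by (simp add: assigned_def)
    qed
    then show ?thesis using c by (auto simp: F_def assigned_def)
  qed
  define g where "g b = the (N (d b))" for b
  have "finite F"
    by (rule finite_subset[of _ "snd ` edges I"])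
      (use finite_edges asN' in \<open>force simp: F_def assignment_def\<close>)+
  moreover have "F \<noteq> {}"
  proof -
    obtain a where a: "N a \<noteq> N' a" using ne by blast
    then obtain b where "N' a = Some b" using imp(3)[of a] by (cases "N' a") auto
    then show ?thesis using a by (auto simp: F_def)
  qed
  moreover have "g ` F \<subseteq> F" using f by (force simp: g_def)
  ultimately obtain C where C: "C \<subseteq> F" "C \<noteq> {}" "g ` C = C" by (rule invariant_core)
  have "(\<lambda>b. N (d b)) ` C = (\<lambda>b. Some (g b)) ` C"
  proof (rule image_cong[OF refl])
    fix b assume "b \<in> C"
    then have "b \<in> F" using C(1) by blast
    from f[OF this] show "N (d b) = Some (g b)" by (auto simp: g_def)
  qed
  also have "\<dots> = Some ` C" using C(3) by (metis image_image)
  finally have "(\<lambda>b. N (d b)) ` C = Some ` C" .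
  moreover have "finite C" using C(1) \<open>finite F\<close> finite_subset by blast
  ultimately show thesis
    by (intro that[of C d]) (use C(1,2) d top nw in \<open>simp_all add: subset_iff\<close>)
qed

text \<open>Loads are kept, lines shrink by \<open>mono\<close>, and each school of \<open>C\<close>
  takes in the first of its line.\<close>

lemma exchange_stable:
  assumes N: "stable I N" and fin: "finite C" and inj: "inj_on d C" "inj_on (\<lambda>b. N (d b)) C"
    and w: "\<And>b. b \<in> C \<Longrightarrow> wants I N (d b) b"
    and top: "\<And>b a. b \<in> C \<Longrightarrow> wants I N a b \<Longrightarrow> a \<noteq> d b \<Longrightarrow> (a, d b) \<in> school_pref I b"
    and cyc: "(\<lambda>b. N (d b)) ` C = Some ` C"
    and mono: "\<And>a b. wants I (exchange N C d) a b \<Longrightarrow> wants I N a b"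
  shows "stable I (exchange N C d)"
proof -
  have asN: "assignment I N" using N by (auto simp: stable_def)
  let ?M = "exchange N C d"
  note ex = exchange_simps[OF inj(1), where M = N]
  have card: "card (assigned ?M b) = card (assigned N b)" for b
  proof (cases "b \<in> C")
    case True
    then have "Some b \<in> (\<lambda>b. N (d b)) ` C" using cyc by simp
    then obtain b' where b': "b' \<in> C" "N (d b') = Some b" by force
    have out: "d b \<notin> assigned N b" using w[OF True] not_wants_own by (auto simp: assigned_def)
    \<comment> \<open>The school \<open>b\<close> loses the one student \<open>d b'\<close> who
      trades away from it and receives \<open>d b\<close>.\<close>
    have "assigned ?M b = insert (d b) (assigned N b - {d b'})"
    proof (rule set_eqI)
      fix a
      show "a \<in> assigned ?M b \<longleftrightarrow> a \<in> insert (d b) (assigned N b - {d b'})"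
      proof (cases "a \<in> d ` C")
        case T: True
        then obtain c where c: "c \<in> C" "a = d c" by blast
        have "N (d c) = Some b \<Longrightarrow> c = b'" using inj_onD[OF inj(2), of c b'] b' c by simp
        moreover have "d c = d b \<longleftrightarrow> c = b" using inj(1) c True by (simp add: inj_on_eq_iff)
        ultimately show ?thesis using c ex(1)[OF c(1)] by (auto simp: assigned_def)
      next
        case False
        then show ?thesis using ex(2)[OF False] True b' by (auto simp: assigned_def)
      qed
    qed
    then show ?thesis using out b' finite_assigned[OF asN, of b]
      by (simp add: assigned_def card_Diff_singleton card_insert_if)
        (metis (mono_tags, lifting) Suc_pred card_gt_0_iff empty_iff mem_Collect_eq)
  next
    case False
    have "?M a = Some b \<longleftrightarrow> N a = Some b" for a
    proof (cases "a \<in> d ` C")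
      case True
      then obtain c where c: "c \<in> C" "a = d c" by blast
      then have "N a \<in> Some ` C" using cyc by blast
      then show ?thesis using False c ex(1) by auto
    qed (simp add: ex)
    then show ?thesis by (simp add: assigned_def)
  qed
  show ?thesis unfolding stable_def assignment_def
  proof (intro conjI allI impI)
    fix a b
    show "(a, b) \<in> edges I" if "?M a = Some b"
    proof (cases "a \<in> d ` C")
      case True
      then have "b \<in> C" "a = d b" using that ex(1) by auto
      then show ?thesis using wants_edge[OF w] by simp
    next
      case False
      then show ?thesis using that ex(2) asN by (simp add: assignment_def)
    qed
    show "card (assigned ?M b) \<le> quota I b" using asN by (simp add: card assignment_def)
    assume wa: "wants I ?M a b"
    then have wN: "wants I N a b" by (rule mono)
    show "card (assigned ?M b) = quota I b" using N wN by (simp add: card stable_def)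
    fix a' assume a': "?M a' = Some b"
    show "(a, a') \<in> school_pref I b"
    proof (cases "a' \<in> d ` C")
      case True
      then have b: "b \<in> C" "a' = d b" using a' ex(1) by auto
      have "a \<noteq> d b" using wa a' b not_wants_own by blast
      then show ?thesis using top[OF b(1) wN] b(2) by simp
    next
      case False
      then show ?thesis using a' ex(2) N wN by (simp add: stable_def)
    qed
  qed
qed

text \<open>By the theory of rotations, the student-optimal stable assignment is reached from every other
  one by trades among the students that top the waiting lists of the schools.\<close>

lemma stable_reaches_G:
  assumes "stable I N"
  shows "(step I Ab)\<^sup>*\<^sup>* (N, {}) (G, {})"
  using assms
proof (induction "card {(a, b). wants I N a b}" arbitrary: N rule: less_induct)
  case less
  show ?case
  proof (cases "N = G")
    case False
    obtain C d where C: "finite C" "C \<noteq> {}" and w: "\<And>b. b \<in> C \<Longrightarrow> wants I N (d b) b"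
      and top: "\<And>b a. b \<in> C \<Longrightarrow> wants I N a b \<Longrightarrow> a \<noteq> d b \<Longrightarrow> (a, d b) \<in> school_pref I b"
      and cyc: "(\<lambda>b. N (d b)) ` C = Some ` C"
      using rotation_exists[OF less.prems stable_G stable_le_G[OF less.prems] False] by metis
    \<comment> \<open>\<open>d b\<close> is unsettled because it is assigned and no school is
      settled yet; nobody stands above it in the line, so the clause on settled consenting students
      holds vacuously.\<close>
    have pk: "pick I Ab N {} b (d b)" if b: "b \<in> C" for b
    proof -
      have "N (d b) \<in> Some ` C" using cyc b by blast
      then have "\<not> settled {} N (d b)" by (auto simp: settled_def)
      moreover have "False" if "wants I N a b" "(d b, a) \<in> school_pref I b" for a
        using top[OF b that(1)] that school_pref_linear(4,5)[OF wants_edge[OF w[OF b]]] by blast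
      ultimately show ?thesis using w[OF b] by (auto simp: pick_def)
    qed
    let ?M = "exchange N C d"
    have mono: "wants I ?M a b \<Longrightarrow> wants I N a b" for a b by (rule trade_wants[OF C(1) pk cyc])
    have st: "stable I ?M"
      by (rule exchange_stable[OF less.prems C(1) trade_inj_d[OF C(1) pk cyc] trade_inj[OF C(1) pk cyc] w top cyc mono])
    obtain b where b: "b \<in> C" using C(2) by blast
    have "{(a, b). wants I ?M a b} \<subset> {(a, b). wants I N a b}"
    proof
      show "{(a, b). wants I ?M a b} \<subseteq> {(a, b). wants I N a b}" using mono by blast
      have "\<not> wants I ?M (d b) b"
        using not_wants_own[of ?M "d b" b] exchange_simps(1)[OF trade_inj_d[OF C(1) pk cyc] b] by blast
      then show "{(a, b). wants I ?M a b} \<noteq> {(a, b). wants I N a b}" using w[OF b] by auto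
    qed
    moreover have "finite {(a, b). wants I N a b}"
      by (rule finite_subset[OF _ finite_edges]) (auto simp: wants_edge)
    ultimately have "card {(a, b). wants I ?M a b} < card {(a, b). wants I N a b}"
      by (rule psubset_card_mono[rotated])
    then have "(step I Ab)\<^sup>*\<^sup>* (?M, {}) (G, {})" using less.hyps st by blast
    moreover have "step I Ab (N, {}) (?M, {})" by (rule step.trade[OF C(1) pk cyc])
    ultimately show ?thesis by (simp add: converse_rtranclp_into_rtranclp)
  qed simp
qed

text \<open>A chain of picks of unsettled schools has ever later arrival times: if the pick of a school
  had been rejected before the arrival of one of its students, then that arrival would have displaced
  an interrupter that the pick permits to be passed over.\<close>

lemma late_arrival_settled:
  assumes quiet: "\<And>k. k > k' \<Longrightarrow> consenting_interrupting_pairs I Ab k = {}"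
    and pk: "\<And>b. b \<in> snd ` edges I - X \<Longrightarrow> \<exists>d. pick I Ab G X b d"
    and a: "k' < arrival a"
  shows "settled X G a"
proof (rule ccontr)
  assume "\<not> settled X G a"
  \<comment> \<open>Unassigned students count as settled, so all members of \<open>U\<close> are
    assigned. For them \<open>arrival\<close>, an arbitrary number for an unassigned student, is a
    genuine step.\<close>
  define U where "U = {a. \<not> settled X G a \<and> k' < arrival a}"
  have sub: "U \<subseteq> fst ` edges I"
  proof
    fix x assume "x \<in> U"
    then obtain c where "G x = Some c" by (auto simp: U_def settled_def)
    then have "(x, c) \<in> edges I" using stable_G by (simp add: stable_def assignment_def)
    then show "x \<in> fst ` edges I" by force
  qed
  have "finite U" by (rule finite_subset[OF sub]) (simp add: finite_edges)
  moreover have "U \<noteq> {}" using \<open>\<not> settled X G a\<close> a by (auto simp: U_def)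
  ultimately have "Max (arrival ` U) \<in> arrival ` U" by simp
  then obtain x where x: "x \<in> U" and "arrival x = Max (arrival ` U)" by force
  then have mx: "arrival y \<le> arrival x" if "y \<in> U" for y
    using that \<open>finite U\<close> by simp
  obtain c where c: "G x = Some c" "c \<notin> X" using x by (auto simp: U_def settled_def)
  have "(x, c) \<in> edges I" using c stable_G by (simp add: stable_def assignment_def)
  then have "c \<in> snd ` edges I - X" using c by force
  then obtain d where d: "pick I Ab G X c d" using pk by blast
  then have dg: "(d, c) \<in> gone T" by (auto simp: pick_def wants_G_iff)
  obtain c1 where c1: "G d = Some c1" using d by (auto simp: pick_def settled_def)
  obtain n where n: "arrival x = Suc n" "(x, c) \<in> H (Suc n)" "(x, c) \<notin> H n" by (rule arrival[OF c(1)])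
  have "(d, c) \<notin> gone n"
  proof
    assume g: "(d, c) \<in> gone n"
    then obtain e where e: "(e, c) \<in> H n" "(e, c) \<in> gs_rejected I (Suc n)" "(d, e) \<in> school_pref I c"
      using gone_displaced n by metis
    have "wants I G e c" using e(2) gone_le_T[of _ "Suc n"] by (auto simp: wants_G_iff gone_Suc)
    then have "e \<in> Ab" using d e(3) by (auto simp: pick_def)
    then have "(e, c) \<in> consenting_interrupting_pairs I Ab (Suc n)"
      using displaced_interrupts[OF g e(1,2)] by (simp add: consenting_interrupting_pairs_def)
    then show False using quiet[of "Suc n"] x n by (auto simp: U_def)
  qed
  then have "Suc n < arrival d" by (rule arrival_gt[OF c1 dg])
  moreover have "d \<in> U" using d calculation x n by (auto simp: pick_def U_def)
  ultimately show False using mx n by fastforce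
qed

end

section \<open>Settling without trades\<close>

inductive settling :: "('a, 'b) assignment_instance \<Rightarrow> 'a set \<Rightarrow> ('a \<Rightarrow> 'b option) \<Rightarrow> 'b set \<Rightarrow> bool"
  for I Ab M where
  "settling I Ab M {}"
| "settling I Ab M X \<Longrightarrow> blocked I Ab M X b \<Longrightarrow> settling I Ab M (insert b X)"

lemma settling_steps: "settling I Ab M X \<Longrightarrow> (step I Ab)\<^sup>*\<^sup>* (M, {}) (M, X)"
  by (induction rule: settling.induct) (auto intro: rtranclp.rtrancl_into_rtrancl step.settle)

lemma (in assignment_problem) maximal_settling:
  obtains X where "settling I Ab M X" "\<And>b. b \<in> snd ` edges I - X \<Longrightarrow> \<exists>d. pick I Ab M X b d"
proof -
  define Q where "Q n \<longleftrightarrow> (\<exists>X. settling I Ab M X \<and> X \<subseteq> snd ` edges I \<and> card X = n)" for n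
  have fB: "finite (snd ` edges I)" using finite_edges by simp
  have "Q 0" unfolding Q_def by (intro exI[of _ "{}"]) (simp add: settling.intros)
  moreover have "\<And>n. Q n \<Longrightarrow> n \<le> card (snd ` edges I)"
    unfolding Q_def using card_mono[OF fB] by blast
  ultimately have "Q (Greatest Q)" and gr: "\<And>n. Q n \<Longrightarrow> n \<le> Greatest Q"
    using GreatestI_nat Greatest_le_nat by metis+
  then obtain X where X: "settling I Ab M X" "X \<subseteq> snd ` edges I" "card X = Greatest Q"
    unfolding Q_def by blast
  have "\<not> blocked I Ab M X b" if b: "b \<in> snd ` edges I - X" for b
  proof
    assume "blocked I Ab M X b"
    then have "settling I Ab M (insert b X)" using X(1) by (rule settling.intros(2)[rotated])
    then have "Q (card (insert b X))" using X b by (auto simp: Q_def)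
    moreover have "card (insert b X) = Suc (card X)"
      using b X fB finite_subset by (metis DiffD2 card_insert_disjoint)
    ultimately show False using gr[of "card (insert b X)"] X(3) by simp
  qed
  then have "\<exists>d. pick I Ab M X b d" if "b \<in> snd ` edges I - X" for b
    using that not_blocked_pick by blast
  then show thesis using that[OF X(1)] by simp
qed

section \<open>Deleting edges of consenting students\<close>

lemma remove_edges_simps:
  "edges (remove_edges I D) = edges I - D"
  "quota (remove_edges I D) = quota I"
  "students (remove_edges I D) = students I"
  "schools (remove_edges I D) = schools I"
  "(c, b) \<in> student_pref (remove_edges I D) a \<longleftrightarrow>
     (c, b) \<in> student_pref I a \<and> (a, c) \<in> edges I - D \<and> (a, b) \<in> edges I - D"
  "(a, a') \<in> school_pref (remove_edges I D) b \<longleftrightarrow>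
     (a, a') \<in> school_pref I b \<and> (a, b) \<in> edges I - D \<and> (a', b) \<in> edges I - D"
  by (auto simp: remove_edges_def)

lemma strict_linear_order_on_Restr:
  "strict_linear_order_on A r \<Longrightarrow> B \<subseteq> A \<Longrightarrow> strict_linear_order_on B (Restr r B)"
  by (auto simp: strict_linear_order_on_def irrefl_def total_on_def trans_def) blast+

lemma remove_edges_instance:
  assumes "stable_assignment_instance I"
  shows "stable_assignment_instance (remove_edges I D)"
proof -
  let ?J = "remove_edges I D"
  have J: "student_pref ?J a = Restr (student_pref I a) (student_nbrs ?J a)"
    "school_pref ?J b = Restr (school_pref I b) (school_nbrs ?J b)"
    "student_nbrs ?J a \<subseteq> student_nbrs I a" "school_nbrs ?J b \<subseteq> school_nbrs I b" for a b
    by (auto simp: remove_edges_def student_nbrs_def school_nbrs_def)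
  have "strict_linear_order_on (student_nbrs ?J a) (student_pref ?J a)" if "a \<in> students I" for a
    unfolding J(1) by (rule strict_linear_order_on_Restr[OF _ J(3)])
      (use assms that in \<open>simp add: stable_assignment_instance_def\<close>)
  moreover have "strict_linear_order_on (school_nbrs ?J b) (school_pref ?J b)" if "b \<in> schools I" for b
    unfolding J(2) by (rule strict_linear_order_on_Restr[OF _ J(4)])
      (use assms that in \<open>simp add: stable_assignment_instance_def\<close>)
  moreover have "student_pref ?J a \<subseteq> student_nbrs ?J a \<times> student_nbrs ?J a"
    "school_pref ?J b \<subseteq> school_nbrs ?J b \<times> school_nbrs ?J b" for a b
    unfolding J(1,2) by blast+
  ultimately show ?thesis
    using assms by (auto simp: stable_assignment_instance_def remove_edges_simps)
qed

lemma wants_remove_edges: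
  assumes "\<And>a b. M a = Some b \<Longrightarrow> (a, b) \<in> edges I - D"
  shows "wants (remove_edges I D) M a b \<longleftrightarrow> wants I M a b \<and> (a, b) \<notin> D"
  using assms by (auto simp: wants_def remove_edges_simps)

text \<open>The students that block do not consent, so they lose no edge.\<close>

lemma blocked_remove_edges:
  assumes M: "\<And>a b. M a = Some b \<Longrightarrow> (a, b) \<in> edges I - D" and D: "fst ` D \<subseteq> Ab"
    and b: "blocked I Ab M X b"
  shows "blocked (remove_edges I D) Ab M X b"
  unfolding blocked_def
proof (intro allI impI)
  fix d assume d: "wants (remove_edges I D) M d b \<and> \<not> settled X M d"
  then have "wants I M d b" "(d, b) \<notin> D" by (simp_all add: wants_remove_edges[OF M])
  then obtain a where a: "wants I M a b" "settled X M a" "a \<notin> Ab" "(d, a) \<in> school_pref I b"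
    using b d unfolding blocked_def by blast
  have "(a, b) \<notin> D" using a(3) D by force
  then show "\<exists>a. wants (remove_edges I D) M a b \<and> settled X M a \<and> a \<notin> Ab \<and>
      (d, a) \<in> school_pref (remove_edges I D) b"
    using a \<open>wants I M d b\<close> \<open>(d, b) \<notin> D\<close>
    by (intro exI[of _ a]) (auto simp: wants_remove_edges[OF M] remove_edges_simps, auto simp: wants_def)
qed

text \<open>Pure settling carries over whether or not the students of \<open>D\<close> are settled.
  It is therefore transferred first, and the general transfer below, which needs these students
  settled from the start, takes over afterwards.\<close>

lemma settling_remove_edges:
  assumes "\<And>a b. M a = Some b \<Longrightarrow> (a, b) \<in> edges I - D" "fst ` D \<subseteq> Ab" "settling I Ab M X"
  shows "settling (remove_edges I D) Ab M X"
  using assms(3) by (induction rule: settling.induct) (auto intro: settling.intros blocked_remove_edges[OF assms(1,2)])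

text \<open>A student of \<open>D\<close> is settled throughout, hence never a pick; so no trade
  uses a deleted edge.\<close>

lemma (in assignment_problem) steps_remove_edges:
  assumes D: "fst ` D \<subseteq> Ab"
    and run: "(step I Ab)\<^sup>*\<^sup>* s s'"
    and s: "\<And>a. a \<in> fst ` D \<Longrightarrow> settled (snd s) (fst s) a"
      "\<And>a b. fst s a = Some b \<Longrightarrow> (a, b) \<in> edges I - D"
  shows "(step (remove_edges I D) Ab)\<^sup>*\<^sup>* s s' \<and>
    (\<forall>a\<in>fst ` D. settled (snd s') (fst s') a) \<and> (\<forall>a b. fst s' a = Some b \<longrightarrow> (a, b) \<in> edges I - D)"
  using run
proof (induction rule: rtranclp_induct)
  case base
  then show ?case using s by blast
next
  case (step y z)
  then have IH: "(step (remove_edges I D) Ab)\<^sup>*\<^sup>* s y" "\<And>a. a \<in> fst ` D \<Longrightarrow> settled (snd y) (fst y) a"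
    "\<And>a b. fst y a = Some b \<Longrightarrow> (a, b) \<in> edges I - D" by blast+
  from step.hyps(2) have "step (remove_edges I D) Ab y z \<and>
    (\<forall>a\<in>fst ` D. settled (snd z) (fst z) a) \<and> (\<forall>a b. fst z a = Some b \<longrightarrow> (a, b) \<in> edges I - D)"
  proof cases
    case (settle M X b)
    have "blocked (remove_edges I D) Ab M X b"
      by (rule blocked_remove_edges) (use IH settle D in auto)
    then show ?thesis using IH(2,3) unfolding settle(1,2) by (auto simp: settled_def intro: step.settle)
  next
    case (trade C M X d)
    note t = trade(3,4,5)
    have M: "\<And>a b. M a = Some b \<Longrightarrow> (a, b) \<in> edges I - D" using IH(3) trade(1) by simp
    have dD: "(d b, b) \<notin> D" if "b \<in> C" for b
    proof
      assume "(d b, b) \<in> D"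
      then have "settled X M (d b)" using IH(2)[of "d b"] trade(1) by force
      then show False using t(2)[OF that] by (simp add: pick_def)
    qed
    have "step (remove_edges I D) Ab (M, X) (exchange M C d, X)"
    proof (rule step.trade)
      show "finite C" "(\<lambda>b. M (d b)) ` C = Some ` C" by (rule t)+
      fix b assume b: "b \<in> C"
      show "pick (remove_edges I D) Ab M X b (d b)"
        using t(2)[OF b] dD[OF b] by (auto simp: pick_def wants_remove_edges[OF M] remove_edges_simps)
    qed
    moreover have "settled X (exchange M C d) a" if "a \<in> fst ` D" for a
      using IH(2)[OF that] trade(1) trade_settled[OF t] by simp
    moreover have "(a, b) \<in> edges I - D" if "exchange M C d a = Some b" for a b
    proof (cases "a \<in> d ` C")
      case True
      then have b: "b \<in> C" "a = d b" using that exchange_simps(1)[OF trade_inj_d[OF t]] by auto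
      then show ?thesis using t(2)[OF b(1)] dD[OF b(1)] by (auto simp: pick_def wants_def)
    next
      case False
      then show ?thesis using that exchange_simps(2)[OF trade_inj_d[OF t] False] M by simp
    qed
    ultimately show ?thesis using trade(1,2) by auto
  qed
  then show ?case using IH(1) by auto
qed

theorem eadam_of_settled:
  assumes "stable_assignment_instance I" "stable I N"
    "(step I Ab)\<^sup>*\<^sup>* (N, {}) (M, X)" "snd ` edges I \<subseteq> X"
  shows "eadam Ab I {(a, b). M a = Some b}"
  using assms
proof (induction "card (edges I)" arbitrary: I N X rule: less_induct)
  case less
  interpret assignment_problem I by unfold_locales (rule less.prems)
  \<comment> \<open>Arrival times are available for \<open>G\<close> only, so the run from
    \<open>N\<close> is replaced by one from \<open>G\<close>.\<close>
  obtain X1 where X1: "(step I Ab)\<^sup>*\<^sup>* (G, {}) (M, X1)" "X \<subseteq> X1"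
    using final_from_reachable[OF less.prems(3,4) stable_reaches_G[OF less.prems(2)]] by blast
  \<comment> \<open>Settling comes first; every school left over has a pick, as
    \<open>late_arrival_settled\<close> requires.\<close>
  obtain X0 where X0: "settling I Ab G X0" and pk: "\<And>b. b \<in> snd ` edges I - X0 \<Longrightarrow> \<exists>d. pick I Ab G X0 b d"
    using maximal_settling[of Ab G] by blast
  obtain X2 where X2: "(step I Ab)\<^sup>*\<^sup>* (G, X0) (M, X2)" "X1 \<subseteq> X2"
    using final_from_reachable[OF X1(1) _ settling_steps[OF X0]] X1 less.prems(4) by blast
  define K where "K = {k. consenting_interrupting_pairs I Ab k \<noteq> {}}"
  have K_T: "k \<le> T" if "k \<in> K" for k
    using that rejected_le_T by (auto simp: K_def consenting_interrupting_pairs_def interrupting_pair_def)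
  show ?case
  proof (cases "K = {}")
    case True
    \<comment> \<open>Without interrupters the bound on their steps is 0, and every assigned student
      arrives after step 0.\<close>
    have "arrival a > 0" if "G a = Some c" for a c by (rule arrival[OF that]) simp
    then have st: "settled X0 G a" for a
      using late_arrival_settled[of 0 Ab X0 a] pk True by (cases "G a") (auto simp: K_def settled_def)
    have "snd ` edges I \<subseteq> X0"
    proof
      fix b assume "b \<in> snd ` edges I"
      then show "b \<in> X0" using pk[of b] st by (auto simp: pick_def)
    qed
    then have "M = G" using all_settled_final[OF X2(1)] by simp
    then show ?thesis using eadam.stop[of I Ab] True by (simp add: G_output K_def)
  next
    case False
    have "finite K" using K_T finite_nat_set_iff_bounded_le by blast
    define k' where "k' = Max K"
    have k': "k' \<in> K" "\<And>k. k > k' \<Longrightarrow> consenting_interrupting_pairs I Ab k = {}"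
    proof -
      show "k' \<in> K" unfolding k'_def by (rule Max_in[OF \<open>finite K\<close> False])
      fix k assume "k > k'"
      then have "k \<notin> K" using Max_ge[OF \<open>finite K\<close>, of k] by (auto simp: k'_def)
      then show "consenting_interrupting_pairs I Ab k = {}" by (simp add: K_def)
    qed
    define D where "D = consenting_interrupting_pairs I Ab k'"
    have DAb: "fst ` D \<subseteq> Ab" by (auto simp: D_def consenting_interrupting_pairs_def)
    have D: "(a, b) \<in> gone T \<and> (a, b) \<notin> gone (k' - 1) \<and> 0 < k'" if "(a, b) \<in> D" for a b
    proof -
      have r: "(a, b) \<in> gs_rejected I k'" "0 < k'"
        using that by (auto simp: D_def consenting_interrupting_pairs_def interrupting_pair_def)
      then obtain k where "k' = Suc k" by (cases k') auto
      then show ?thesis using r rejected_not_gone gone_le_T[of _ "Suc k"] gone_Suc by auto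
    qed
    have Dset: "settled X0 G a" if "a \<in> fst ` D" for a
    proof (cases "G a")
      case (Some c)
      from that obtain x where "x \<in> D" "a = fst x" by blast
      then have "(a, snd x) \<in> D" by simp
      note d = D[OF this]
      \<comment> \<open>The rejection happens at step \<open>k'\<close> itself, so the pair is not
        yet gone at \<open>k' - 1\<close>; the subtraction is exact because \<open>k'\<close> is
        positive.\<close>
      have "Suc (k' - 1) < arrival a" by (rule arrival_gt[OF Some]) (use d in auto)
      then show ?thesis using d late_arrival_settled[OF k'(2) pk, where a = a] by simp
    qed (simp add: settled_def)
    have GD: "(a, b) \<in> edges I - D" if "G a = Some b" for a b
      using that D[of a b] stable_G by (auto simp: stable_def assignment_def gone_def G_iff)
    let ?J = "remove_edges I D"
    have "(step ?J Ab)\<^sup>*\<^sup>* (G, X0) (M, X2)"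
      by (rule steps_remove_edges[OF DAb X2(1), THEN conjunct1]) (use Dset GD in simp_all)
    moreover have "(step ?J Ab)\<^sup>*\<^sup>* (G, {}) (G, X0)"
      by (rule settling_steps[OF settling_remove_edges[OF GD DAb X0]])
    ultimately have run: "(step ?J Ab)\<^sup>*\<^sup>* (G, {}) (M, X2)" by simp
    \<comment> \<open>Deleting edges that \<open>G\<close> does not use only shortens the waiting
      lines.\<close>
    have "stable ?J G"
      using stable_G GD unfolding stable_def assignment_def
      by (auto simp: wants_remove_edges[OF GD] remove_edges_simps wants_def)
    moreover have "card (edges ?J) < card (edges I)"
    proof (rule psubset_card_mono[OF finite_edges])
      have "D \<noteq> {}" using k' by (simp add: D_def K_def)
      then obtain a b where "(a, b) \<in> D" by auto
      moreover have "(a, b) \<in> edges I" using D calculation P_subset_edges by (auto simp: gone_def)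
      ultimately show "edges ?J \<subset> edges I" by (auto simp: remove_edges_simps)
    qed
    moreover have "snd ` edges ?J \<subseteq> X2"
      using less.prems(4) X1 X2 by (auto simp: remove_edges_simps)
    ultimately have "eadam Ab ?J {(a, b). M a = Some b}"
      using less.hyps run remove_edges_instance[OF less.prems(1)] by blast
    then show ?thesis using eadam.continue[of I Ab k'] k' by (auto simp: D_def K_def)
  qed
qed

section \<open>Running times of programs\<close>

fun loop_free :: "com \<Rightarrow> bool" where
  "loop_free (Seq c1 c2) \<longleftrightarrow> loop_free c1 \<and> loop_free c2"
| "loop_free (Cond b c1 c2) \<longleftrightarrow> loop_free c1 \<and> loop_free c2"
| "loop_free (While b c) \<longleftrightarrow> False"
| "loop_free _ \<longleftrightarrow> True"

text \<open>A function, so that simplification can run loop bodies symbolically. The last equation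
  gives loops a dummy value, which \<open>loop_free\<close> excludes in
  \<open>exec_loop_free\<close>.\<close>

fun outcome :: "com \<Rightarrow> store \<Rightarrow> store" where
  "outcome (Assign x e) s = s\<lparr>scalars := (scalars s)(x := aval e s)\<rparr>"
| "outcome (Store X i e) s = s\<lparr>arrays := (arrays s)(X := (arrays s X)(aval i s := aval e s))\<rparr>"
| "outcome (Seq c1 c2) s = outcome c2 (outcome c1 s)"
| "outcome (Cond b c1 c2) s = (if bval b s then outcome c1 s else outcome c2 s)"
| "outcome _ s = s"

text \<open>Both branches of a conditional are added, which makes the bound independent of the
  store.\<close>

fun cost :: "com \<Rightarrow> nat" where
  "cost (Assign x e) = 1 + acost e"
| "cost (Store X i e) = 1 + acost i + acost e"
| "cost (Seq c1 c2) = cost c1 + cost c2"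
| "cost (Cond b c1 c2) = 1 + bcost b + cost c1 + cost c2"
| "cost _ = 1"

lemma exec_loop_free: "loop_free c \<Longrightarrow> \<exists>t\<le>cost c. exec c s t (outcome c s)"
proof (induction c arbitrary: s)
  case Skip
  then show ?case using exec.Skip by auto
next
  case (Assign x e)
  then show ?case using exec.Assign by auto
next
  case (Store X i e)
  then show ?case using exec.Store by auto
next
  case (Seq c1 c2)
  obtain t1 where "t1 \<le> cost c1" "exec c1 s t1 (outcome c1 s)" using Seq by auto
  moreover obtain t2 where "t2 \<le> cost c2" "exec c2 (outcome c1 s) t2 (outcome c2 (outcome c1 s))"
    using Seq by (meson loop_free.simps(1))
  ultimately show ?case using exec.Seq by (metis add_mono cost.simps(3) outcome.simps(3))
next
  case (Cond b c1 c2)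
  obtain t1 where t1: "t1 \<le> cost c1" "exec c1 s t1 (outcome c1 s)" using Cond by auto
  obtain t2 where t2: "t2 \<le> cost c2" "exec c2 s t2 (outcome c2 s)" using Cond by auto
  show ?case
  proof (cases "bval b s")
    case True
    then show ?thesis using exec.Cond_True[OF True t1(2)] t1(1) by (intro exI[of _ "1 + bcost b + t1"]) simp
  next
    case False
    then show ?thesis using exec.Cond_False[OF False t2(2)] t2(1) by (intro exI[of _ "1 + bcost b + t2"]) simp
  qed
qed simp

definition runs :: "com \<Rightarrow> store \<Rightarrow> nat \<Rightarrow> (store \<Rightarrow> bool) \<Rightarrow> bool" where
  "runs c s t Q \<longleftrightarrow> (\<exists>t' s'. exec c s t' s' \<and> t' \<le> t \<and> Q s')"

lemma runs_loop_free: "loop_free c \<Longrightarrow> Q (outcome c s) \<Longrightarrow> cost c \<le> t \<Longrightarrow> runs c s t Q"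
  unfolding runs_def using exec_loop_free by (meson order_trans)

lemma runs_Seq:
  assumes "runs c1 s t1 P" "\<And>s'. P s' \<Longrightarrow> runs c2 s' t2 Q"
  shows "runs (Seq c1 c2) s (t1 + t2) Q"
  using assms unfolding runs_def by (meson add_mono exec.Seq)

lemma runs_mono: "runs c s t P \<Longrightarrow> (\<And>s'. P s' \<Longrightarrow> Q s') \<Longrightarrow> t \<le> t' \<Longrightarrow> runs c s t' Q"
  unfolding runs_def by (meson order_trans)

text \<open>The index of the invariant is a potential: an iteration that lowers it by \<open>d\<close> may
  take \<open>K * d\<close> time units.\<close>

lemma runs_While:
  assumes body: "\<And>n s. Inv n s \<Longrightarrow> bval b s \<Longrightarrow>
      \<exists>n'<n. runs c s (K * (n - n') - (1 + bcost b)) (Inv n') \<and> 1 + bcost b \<le> K * (n - n')"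
    and init: "Inv n s"
  shows "runs (While b c) s (K * n + 1 + bcost b) (\<lambda>s. \<not> bval b s \<and> (\<exists>n. Inv n s))"
  using init
proof (induction n arbitrary: s rule: less_induct)
  case (less n)
  show ?case
  proof (cases "bval b s")
    case False
    then show ?thesis unfolding runs_def
      using exec.While_False[OF False] less.prems by (intro exI[of _ "1 + bcost b"] exI[of _ s]) auto
  next
    case True
    obtain n' where n': "n' < n" "1 + bcost b \<le> K * (n - n')"
      and "runs c s (K * (n - n') - (1 + bcost b)) (Inv n')"
      using body[OF less.prems True] by blast
    then obtain t1 s1 where s1: "exec c s t1 s1" "t1 \<le> K * (n - n') - (1 + bcost b)" "Inv n' s1"
      by (auto simp: runs_def)
    obtain t2 s2 where s2: "exec (While b c) s1 t2 s2" "t2 \<le> K * n' + 1 + bcost b"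
      "\<not> bval b s2 \<and> (\<exists>n. Inv n s2)"
      using less.IH[OF n'(1) s1(3)] by (auto simp: runs_def)
    have "K * (n - n') + K * n' = K * n" using n'(1) by (simp add: diff_mult_distrib2)
    then have "1 + bcost b + t1 + t2 \<le> K * n + 1 + bcost b" using s1(2) s2(2) n'(2) by linarith
    then show ?thesis unfolding runs_def using exec.While_True[OF True s1(1) s2(1)] s2(3) by blast
  qed
qed

lemma runs_While_loop_free:
  assumes "loop_free c" "cost c + 1 + bcost b \<le> K"
    and body: "\<And>n s. Inv n s \<Longrightarrow> bval b s \<Longrightarrow> \<exists>n'<n. Inv n' (outcome c s)"
    and "Inv n s"
  shows "runs (While b c) s (K * n + 1 + bcost b) (\<lambda>s. \<not> bval b s \<and> (\<exists>n. Inv n s))"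
proof (rule runs_While)
  fix n s assume "Inv n s" "bval b s"
  then obtain n' where n': "n' < n" "Inv n' (outcome c s)" using body by blast
  have "K * 1 \<le> K * (n - n')" using n'(1) by (intro mult_le_mono2) simp
  then show "\<exists>n'<n. runs c s (K * (n - n') - (1 + bcost b)) (Inv n') \<and> 1 + bcost b \<le> K * (n - n')"
    using n' assms(1,2) by (intro exI[of _ n'] conjI runs_loop_free) linarith+
qed fact

lemma runs_loop:
  assumes "runs c0 s u (Inv n)" "loop_free c" "cost c + 1 + bcost b \<le> K"
    and "\<And>n s. Inv n s \<Longrightarrow> bval b s \<Longrightarrow> \<exists>n'<n. Inv n' (outcome c s)"
    and "\<And>n s. Inv n s \<Longrightarrow> \<not> bval b s \<Longrightarrow> Q s" and "u + (K * n + 1 + bcost b) \<le> t"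
  shows "runs (Seq c0 (While b c)) s t Q"
proof (rule runs_mono[OF runs_Seq[OF assms(1)]])
  fix s' assume "Inv n s'"
  show "runs (While b c) s' (K * n + 1 + bcost b) (\<lambda>s. \<not> bval b s \<and> (\<exists>n. Inv n s))"
    by (rule runs_While_loop_free[where Inv = Inv, OF assms(2,3) _ \<open>Inv n s'\<close>]) (use assms(4) in blast)
qed (use assms(5,6) in auto)

abbreviation seq (infixr ";;" 60) where "c1 ;; c2 \<equiv> Seq c1 c2"

section \<open>Cross-linking the preference lists\<close>

text \<open>The arrays \<open>offer\<close> and \<open>wait\<close> are cursors into the lists of the schools. Entry \<open>j\<close> of
  \<open>link\<close> is the position in the lists of the students of the edge at position \<open>j\<close> of the lists of the
  schools. The positions of the edges of a school in the students' lists form a linked list, stored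
  in \<open>head\<close> and \<open>next\<close> with positions shifted by one since \<open>0\<close> marks the end; it is emptied into
  \<open>slot\<close>, indexed by students, when the scan of the schools' lists enters the block of that school.\<close>

definition start_body :: com where
  "start_body =
     Assign ''j'' (Dec (Var ''j'')) ;;
     Store ''offer'' (Read ''school_lists_school'' (Var ''j'')) (Var ''j'') ;;
     Store ''wait'' (Read ''school_lists_school'' (Var ''j'')) (Var ''j'')"

definition start_program :: com where
  "start_program = Assign ''j'' (Var ''edges'') ;; While (Less (Const 0) (Var ''j'')) start_body"

definition bucket_body :: com where
  "bucket_body =
     Assign ''b'' (Read ''student_lists_school'' (Var ''i'')) ;;
     Store ''next'' (Var ''i'') (Read ''head'' (Var ''b'')) ;;
     Store ''head'' (Var ''b'') (Inc (Var ''i'')) ;;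
     Assign ''i'' (Inc (Var ''i''))"

definition bucket_program :: com where
  "bucket_program = Assign ''i'' (Const 0) ;; While (Less (Var ''i'') (Var ''edges'')) bucket_body"

definition link_body :: com where
  "link_body =
     Assign ''b'' (Read ''school_lists_school'' (Var ''j'')) ;;
     Cond (Equal (Read ''head'' (Var ''b'')) (Const 0))
       (Store ''link'' (Var ''j'') (Read ''slot'' (Read ''school_lists_student'' (Var ''j''))) ;;
        Assign ''j'' (Inc (Var ''j'')))
       (Assign ''i'' (Dec (Read ''head'' (Var ''b''))) ;;
        Store ''slot'' (Read ''student_lists_student'' (Var ''i'')) (Var ''i'') ;;
        Store ''head'' (Var ''b'') (Read ''next'' (Var ''i'')))"

definition link_program :: com where
  "link_program = Assign ''j'' (Const 0) ;; While (Less (Var ''j'') (Var ''edges'')) link_body"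

fun chain :: "(nat \<Rightarrow> nat) \<Rightarrow> nat list \<Rightarrow> nat \<Rightarrow> bool" where
  "chain nx [] h \<longleftrightarrow> h = 0"
| "chain nx (i # L) h \<longleftrightarrow> h = Suc i \<and> chain nx L (nx i)"

lemma chain_cong: "(\<And>i. i \<in> set L \<Longrightarrow> nx i = nx' i) \<Longrightarrow> chain nx L h = chain nx' L h"
  by (induction L arbitrary: h) auto

text \<open>The edge at position \<open>i\<close> of the students' lists is \<open>(sa i, sb i)\<close>, the one at position \<open>j\<close>
  of the schools' lists is \<open>(ca j, cb j)\<close>.\<close>

locale encoding = assignment_problem I for I :: "(nat, nat) assignment_instance" +
  fixes Ab :: "nat set" and m :: nat and sa sb ca cb qa co :: "nat \<Rightarrow> nat"
  assumes student_index: "bij_betw (\<lambda>i. (sa i, sb i)) {..<m} (edges I)"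
    and school_index: "bij_betw (\<lambda>j. (ca j, cb j)) {..<m} (edges I)"
    and student_order: "\<And>i i'. i < i' \<Longrightarrow> i' < m \<Longrightarrow> sa i = sa i' \<Longrightarrow> (sb i', sb i) \<in> student_pref I (sa i)"
    and school_order: "\<And>j j'. j < j' \<Longrightarrow> j' < m \<Longrightarrow> cb j = cb j' \<Longrightarrow> (ca j', ca j) \<in> school_pref I (cb j)"
    and contiguous: "\<And>j k l. j \<le> k \<Longrightarrow> k \<le> l \<Longrightarrow> l < m \<Longrightarrow> cb j = cb l \<Longrightarrow> cb k = cb l"
    and quota_array: "\<And>b. b \<in> schools I \<Longrightarrow> qa b = quota I b"
    and consent_array: "\<And>a. co a = (if a \<in> Ab then 1 else 0)"
begin

definition input :: "store \<Rightarrow> bool" where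
  "input s \<longleftrightarrow> scalars s ''edges'' = m \<and>
     arrays s ''student_lists_student'' = sa \<and> arrays s ''student_lists_school'' = sb \<and>
     arrays s ''school_lists_student'' = ca \<and> arrays s ''school_lists_school'' = cb \<and>
     arrays s ''quota'' = qa \<and> arrays s ''consent'' = co"

lemma student_index_inj: "i < m \<Longrightarrow> i' < m \<Longrightarrow> sa i = sa i' \<Longrightarrow> sb i = sb i' \<Longrightarrow> i = i'"
  using bij_betw_imp_inj_on[OF student_index] by (auto simp: inj_on_def)

lemma school_index_inj: "j < m \<Longrightarrow> j' < m \<Longrightarrow> ca j = ca j' \<Longrightarrow> cb j = cb j' \<Longrightarrow> j = j'"
  using bij_betw_imp_inj_on[OF school_index] by (auto simp: inj_on_def)

lemma student_index_ex:
  assumes "(a, b) \<in> edges I" obtains i where "i < m" "sa i = a" "sb i = b"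
proof -
  have "(a, b) \<in> (\<lambda>i. (sa i, sb i)) ` {..<m}"
    using bij_betw_imp_surj_on[OF student_index] assms by simp
  then show thesis using that by auto
qed

lemma school_index_ex:
  assumes "(a, b) \<in> edges I" obtains j where "j < m" "ca j = a" "cb j = b"
proof -
  have "(a, b) \<in> (\<lambda>j. (ca j, cb j)) ` {..<m}"
    using bij_betw_imp_surj_on[OF school_index] assms by simp
  then show thesis using that by auto
qed

lemma index_edges: "i < m \<Longrightarrow> (sa i, sb i) \<in> edges I" "j < m \<Longrightarrow> (ca j, cb j) \<in> edges I"
  using bij_betw_apply[OF student_index] bij_betw_apply[OF school_index] by auto

section \<open>Cursors into the lists of the schools\<close>

definition Bs :: "nat set" where "Bs = cb ` {..<m}"

lemma finite_Bs: "finite Bs" and card_Bs: "card Bs \<le> m"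
  using card_image_le[of "{..<m}" cb] by (auto simp: Bs_def)

lemma Bs_schools: "b \<in> Bs \<Longrightarrow> b \<in> schools I"
  using index_edges(2) edge_ends by (auto simp: Bs_def)

text \<open>A cursor has at least reached the block of its school. As blocks are contiguous, a
  cursor that does not point into its block has run past the end of it.\<close>

definition cursor :: "(nat \<Rightarrow> nat) \<Rightarrow> bool" where
  "cursor p \<longleftrightarrow> (\<forall>b\<in>Bs. \<exists>j\<le>p b. cb j = b)"

lemma cursor_exhausted:
  assumes "cursor p" "j < m" "\<not> (p (cb j) < m \<and> cb (p (cb j)) = cb j)"
  shows "j < p (cb j)"
proof (rule ccontr)
  assume "\<not> j < p (cb j)"
  moreover obtain j0 where "j0 \<le> p (cb j)" "cb j0 = cb j" using assms by (auto simp: cursor_def Bs_def)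
  ultimately show False using contiguous[of j0 "p (cb j)" j] assms by auto
qed

lemma cursor_Suc: "cursor p \<Longrightarrow> cursor (p(b := Suc (p b)))"
  unfolding cursor_def by (auto simp: le_Suc_eq)

definition at_start :: "(nat \<Rightarrow> nat) \<Rightarrow> bool" where
  "at_start p \<longleftrightarrow> cursor p \<and> (\<forall>j<m. p (cb j) \<le> j)"

text \<open>The entries still ahead of the cursors, a potential both for the offers and for the
  trades.\<close>

definition left :: "(nat \<Rightarrow> nat) \<Rightarrow> nat" where
  "left p = card {j. j < m \<and> p (cb j) \<le> j}"

lemma left_le: "left p \<le> m"
  using card_mono[of "{..<m}" "{j. j < m \<and> p (cb j) \<le> j}"] by (auto simp: left_def)

lemma left_Suc:
  assumes "p b < m" "cb (p b) = b"
  shows "Suc (left (p(b := Suc (p b)))) = left p"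
proof -
  have "{j. j < m \<and> (p(b := Suc (p b))) (cb j) \<le> j} = {j. j < m \<and> p (cb j) \<le> j} - {p b}"
    using assms by auto
  moreover have "p b \<in> {j. j < m \<and> p (cb j) \<le> j}" using assms by simp
  ultimately show ?thesis unfolding left_def
    using card_Suc_Diff1[of "{j. j < m \<and> p (cb j) \<le> j}" "p b"] by simp
qed

definition unchanged :: "aname set \<Rightarrow> store \<Rightarrow> store \<Rightarrow> bool" where
  "unchanged A s s' \<longleftrightarrow> (\<forall>X. X \<notin> A \<longrightarrow> arrays s' X = arrays s X)"

text \<open>The scan runs backwards, so the last position written for a school is the first one of
  its block.\<close>

lemma start_correct:
  assumes "input s"
  shows "runs start_program s (20 * m + 20) (\<lambda>s'. input s' \<and>
    at_start (arrays s' ''offer'') \<and> at_start (arrays s' ''wait'') \<and> unchanged {''offer'', ''wait''} s s')"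
proof -
  define Inv where "Inv n s' \<longleftrightarrow> input s' \<and> scalars s' ''j'' = n \<and> n \<le> m \<and>
    (\<forall>j. n \<le> j \<and> j < m \<longrightarrow> arrays s' ''offer'' (cb j) \<le> j \<and> (\<exists>j0\<le>arrays s' ''offer'' (cb j). cb j0 = cb j)) \<and>
    (\<forall>j. n \<le> j \<and> j < m \<longrightarrow> arrays s' ''wait'' (cb j) \<le> j \<and> (\<exists>j0\<le>arrays s' ''wait'' (cb j). cb j0 = cb j)) \<and>
    unchanged {''offer'', ''wait''} s s'" for n s'
  show ?thesis unfolding start_program_def
  proof (rule runs_loop[where K = 20 and n = m and Inv = Inv and u = 2])
    show "runs (Assign ''j'' (Var ''edges'')) s 2 (Inv m)"
      by (rule runs_loop_free) (use assms in \<open>auto simp: Inv_def input_def unchanged_def\<close>)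
  next
    fix n s assume I: "Inv n s" and "bval (Less (Const 0) (Var ''j'')) s"
    then obtain k where k: "n = Suc k" by (cases n) (auto simp: Inv_def)
    have "((arrays s X)(cb k := k)) (cb j) \<le> j \<and> (\<exists>j0\<le>((arrays s X)(cb k := k)) (cb j). cb j0 = cb j)"
      if "X \<in> {''offer'', ''wait''}" "k \<le> j" "j < m" for j X
      using I that k by (cases "cb j = cb k"; cases "j = k") (auto simp: Inv_def)
    then show "\<exists>n'<n. Inv n' (outcome start_body s)"
      using I k by (intro exI[of _ k]) (auto simp: Inv_def input_def unchanged_def start_body_def)
  qed (auto simp: start_body_def Inv_def at_start_def cursor_def Bs_def)
qed

lemma bucket_correct:
  assumes "input s" "arrays s ''head'' = (\<lambda>_. 0)"
  shows "runs bucket_program s (20 * m + 20) (\<lambda>s'. input s' \<and> unchanged {''head'', ''next''} s s' \<and>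
    (\<exists>L. \<forall>b. chain (arrays s' ''next'') (L b) (arrays s' ''head'' b) \<and> distinct (L b) \<and>
       set (L b) = {i. i < m \<and> sb i = b}))"
proof -
  define Inv where "Inv n s' \<longleftrightarrow> input s' \<and> scalars s' ''i'' \<le> m \<and> n = m - scalars s' ''i'' \<and>
    unchanged {''head'', ''next''} s s' \<and>
    (\<exists>L. \<forall>b. chain (arrays s' ''next'') (L b) (arrays s' ''head'' b) \<and> distinct (L b) \<and>
       set (L b) = {i. i < scalars s' ''i'' \<and> sb i = b})" for n s'
  let ?B = "Less (Var ''i'') (Var ''edges'')"
  show ?thesis unfolding bucket_program_def
  proof (rule runs_loop[where K = 20 and n = m and Inv = Inv and u = 2])
    show "runs (Assign ''i'' (Const 0)) s 2 (Inv m)"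
      by (rule runs_loop_free)
        (use assms in \<open>auto simp: Inv_def input_def unchanged_def intro!: exI[of _ "\<lambda>_. []"]\<close>)
  next
    fix n s assume I: "Inv n s" and "bval ?B s"
    define i where "i = scalars s ''i''"
    have im: "i < m" using I \<open>bval ?B s\<close> by (auto simp: Inv_def input_def i_def)
    obtain L where L: "\<And>b. chain (arrays s ''next'') (L b) (arrays s ''head'' b)" "\<And>b. distinct (L b)"
      "\<And>b. set (L b) = {k. k < i \<and> sb k = b}" using I unfolding Inv_def i_def by blast
    define L' where "L' = L(sb i := i # L (sb i))"
    let ?nx = "(arrays s ''next'')(i := arrays s ''head'' (sb i))"
    let ?hd = "(arrays s ''head'')(sb i := Suc i)"
    \<comment> \<open>Position \<open>i\<close> lies in no list yet, so writing \<open>next\<close>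
      there changes none of them.\<close>
    have ch: "chain ?nx (L b) h = chain (arrays s ''next'') (L b) h" for b h
      by (rule chain_cong) (auto simp: L(3))
    have "chain ?nx (L' b) (?hd b) \<and> distinct (L' b) \<and> set (L' b) = {k. k < Suc i \<and> sb k = b}" for b
      using L(1,2) by (auto simp: L'_def ch L(3) less_Suc_eq)
    then have "\<exists>L. \<forall>b. chain ?nx (L b) (?hd b) \<and> distinct (L b) \<and> set (L b) = {k. k < Suc i \<and> sb k = b}"
      by blast
    moreover have "outcome bucket_body s = s\<lparr>scalars := (scalars s)(''b'' := sb i, ''i'' := Suc i),
        arrays := (arrays s)(''next'' := ?nx, ''head'' := ?hd)\<rparr>"
      using I by (auto simp: bucket_body_def Inv_def input_def i_def)
    ultimately show "\<exists>n'<n. Inv n' (outcome bucket_body s)"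
      using I im by (intro exI[of _ "m - Suc i"]) (auto simp: Inv_def input_def unchanged_def i_def)
  qed (auto simp: bucket_body_def Inv_def input_def)
qed

definition linked :: "(nat \<Rightarrow> nat) \<Rightarrow> bool" where
  "linked l \<longleftrightarrow> (\<forall>j<m. l j < m \<and> sa (l j) = ca j \<and> sb (l j) = cb j)"

text \<open>Each iteration either advances \<open>j\<close> or takes a position out of a list, so
  \<open>m - j + card (pool L)\<close> decreases. Entries of \<open>slot\<close> left from earlier
  schools do no harm: once the list of the current school is empty, all its students have been
  written anew.\<close>

lemma link_correct:
  assumes "input s" "\<And>b. chain (arrays s ''next'') (L b) (arrays s ''head'' b)" "\<And>b. distinct (L b)"
    "\<And>b. set (L b) = {i. i < m \<and> sb i = b}"
  shows "runs link_program s (100 * m + 20) (\<lambda>s'. input s' \<and>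
    unchanged {''head'', ''slot'', ''link''} s s' \<and> linked (arrays s' ''link''))"
proof -
  define pool where "pool L = {i. i < m \<and> i \<in> set (L (sb i))}" for L :: "nat \<Rightarrow> nat list"
  define Q where "Q j L nx hd slot link \<longleftrightarrow> j \<le> m \<and>
    (\<forall>b. chain nx (L b) (hd b) \<and> distinct (L b) \<and> set (L b) \<subseteq> {i. i < m \<and> sb i = b}) \<and>
    (\<forall>j'. j < j' \<and> j' < m \<and> cb j' \<noteq> cb j \<longrightarrow> {i. i < m \<and> sb i = cb j'} \<subseteq> set (L (cb j'))) \<and>
    (\<forall>i. j < m \<and> i < m \<and> sb i = cb j \<longrightarrow> i \<in> set (L (cb j)) \<or> slot (sa i) = i) \<and>
    (\<forall>j'<j. link j' < m \<and> sa (link j') = ca j' \<and> sb (link j') = cb j')"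
    for j L and nx hd slot link :: "nat \<Rightarrow> nat"
  define Inv where "Inv n s' \<longleftrightarrow> input s' \<and> unchanged {''head'', ''slot'', ''link''} s s' \<and>
    (\<exists>L. Q (scalars s' ''j'') L (arrays s' ''next'') (arrays s' ''head'') (arrays s' ''slot'') (arrays s' ''link'')
      \<and> n = m - scalars s' ''j'' + card (pool L))" for n s'
  have InvI: "Inv (m - j + card (pool L)) s'"
    if "input s'" "unchanged {''head'', ''slot'', ''link''} s s'" "scalars s' ''j'' = j"
      "Q j L (arrays s' ''next'') (arrays s' ''head'') (arrays s' ''slot'') (arrays s' ''link'')" for j L s'
    using that unfolding Inv_def by blast
  let ?B = "Less (Var ''j'') (Var ''edges'')"
  have pm: "card (pool L) \<le> m"
    using card_mono[of "{..<m}" "pool L"] by (auto simp: pool_def)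
  show ?thesis unfolding link_program_def
  proof (rule runs_loop[where K = 50 and n = "m + card (pool L)" and Inv = Inv and u = 2])
    have "Inv (m + card (pool L)) (outcome (Assign ''j'' (Const 0)) s)"
      unfolding Inv_def using assms
      by (auto simp: input_def unchanged_def Q_def intro!: exI[of _ L])
    then show "runs (Assign ''j'' (Const 0)) s 2 (Inv (m + card (pool L)))"
      by (rule runs_loop_free[rotated]) auto
  next
    fix n s' assume I: "Inv n s'" and "bval ?B s'"
    define j nx hd slot link where "j = scalars s' ''j''" and "nx = arrays s' ''next''"
      and "hd = arrays s' ''head''" and "slot = arrays s' ''slot''" and "link = arrays s' ''link''"
    note defs = this
    have in': "input s'" "unchanged {''head'', ''slot'', ''link''} s s'" using I by (simp_all add: Inv_def)
    have jm: "j < m" using I \<open>bval ?B s'\<close> by (auto simp: Inv_def input_def j_def)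
    obtain L where L: "Q j L nx hd slot link" "n = m - j + card (pool L)"
      using I unfolding Inv_def defs by blast
    have ch: "\<And>b. chain nx (L b) (hd b)" "\<And>b. distinct (L b)" "\<And>b. set (L b) \<subseteq> {i. i < m \<and> sb i = b}"
      and rest: "\<And>j'. j < j' \<Longrightarrow> j' < m \<Longrightarrow> cb j' \<noteq> cb j \<Longrightarrow> {i. i < m \<and> sb i = cb j'} \<subseteq> set (L (cb j'))"
      and slot: "\<And>i. i < m \<Longrightarrow> sb i = cb j \<Longrightarrow> i \<in> set (L (cb j)) \<or> slot (sa i) = i"
      and link: "\<And>j'. j' < j \<Longrightarrow> link j' < m \<and> sa (link j') = ca j' \<and> sb (link j') = cb j'"
      using L(1) jm by (simp_all add: Q_def)
    show "\<exists>n'<n. Inv n' (outcome link_body s')"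
    proof (cases "hd (cb j) = 0")
      case True
      then have e: "L (cb j) = []" using ch(1)[of "cb j"] by (cases "L (cb j)") auto
      obtain i where i: "i < m" "sa i = ca j" "sb i = cb j" using student_index_ex[OF index_edges(2)[OF jm]] .
      then have sl: "slot (ca j) = i" using slot[of i] e by auto
      have "Q (Suc j) L nx hd slot (link(j := slot (ca j)))"
        unfolding Q_def
      proof (intro conjI allI impI)
        \<comment> \<open>A block that has been left does not resume, so every later block with a
          new school is still untouched.\<close>
        show "{i. i < m \<and> sb i = cb j'} \<subseteq> set (L (cb j'))"
          if "Suc j < j' \<and> j' < m \<and> cb j' \<noteq> cb (Suc j)" for j'
          using rest[of j'] contiguous[of j "Suc j" j'] that by (cases "cb j' = cb j") auto
        show "k \<in> set (L (cb (Suc j))) \<or> slot (sa k) = k"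
          if "Suc j < m \<and> k < m \<and> sb k = cb (Suc j)" for k
          using slot[of k] rest[of "Suc j"] that by (cases "cb (Suc j) = cb j") auto
      qed (use jm ch link sl i in \<open>auto simp: less_Suc_eq\<close>)
      moreover have "outcome link_body s' = s'\<lparr>scalars := (scalars s')(''b'' := cb j, ''j'' := Suc j),
          arrays := (arrays s')(''link'' := link(j := slot (ca j)))\<rparr>"
        using I True by (auto simp: link_body_def Inv_def input_def defs)
      ultimately have "Inv (m - Suc j + card (pool L)) (outcome link_body s')"
        using in' by (intro InvI) (auto simp: input_def unchanged_def nx_def hd_def slot_def)
      then show ?thesis using jm L(2) by (intro exI[of _ "m - Suc j + card (pool L)"]) simp
    next
      case False
      then obtain i R where iR: "L (cb j) = i # R" "hd (cb j) = Suc i" "chain nx R (nx i)"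
        using ch(1)[of "cb j"] by (cases "L (cb j)") auto
      have i: "i < m" "sb i = cb j" "i \<notin> set R" using ch(2,3)[of "cb j"] iR by auto
      define L' where "L' = L(cb j := R)"
      have sub: "set (L' b) \<subseteq> set (L b)" for b using iR by (auto simp: L'_def)
      have Q': "Q j L' nx (hd(cb j := nx i)) (slot(sa i := i)) link"
        unfolding Q_def
      proof (intro conjI allI impI)
        fix b
        show "chain nx (L' b) ((hd(cb j := nx i)) b)" using ch(1) iR by (auto simp: L'_def)
        show "distinct (L' b)" using ch(2)[of b] ch(2)[of "cb j"] iR by (auto simp: L'_def)
        show "set (L' b) \<subseteq> {i. i < m \<and> sb i = b}" using sub ch(3) by blast
      next
        \<comment> \<open>Edges at the same school belong to different students, so the write to
          \<open>slot\<close> destroys no entry needed for this block.\<close>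
        fix k assume "j < m \<and> k < m \<and> sb k = cb j"
        then show "k \<in> set (L' (cb j)) \<or> (slot(sa i := i)) (sa k) = k"
          using slot[of k] i iR student_index_inj[of k i] by (auto simp: L'_def)
      qed (use jm rest link in \<open>auto simp: L'_def\<close>)
      have "pool L' = pool L - {i}" using i iR ch(3) by (auto simp: pool_def L'_def split: if_splits)
      moreover have "i \<in> pool L" using i iR by (simp add: pool_def)
      ultimately have "card (pool L') < card (pool L)"
        by (intro psubset_card_mono) (auto simp: pool_def)
      moreover have "outcome link_body s' = s'\<lparr>scalars := (scalars s')(''b'' := cb j, ''i'' := i),
          arrays := (arrays s')(''slot'' := slot(sa i := i), ''head'' := hd(cb j := nx i))\<rparr>"
        using I False iR by (auto simp: link_body_def Inv_def input_def defs)
      moreover from this have "Inv (m - j + card (pool L')) (outcome link_body s')"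
        using in' Q' by (intro InvI) (auto simp: input_def unchanged_def nx_def j_def link_def)
      ultimately show ?thesis using L(2) by (intro exI[of _ "m - j + card (pool L')"]) simp
    qed
  qed (use pm in \<open>auto simp: link_body_def Inv_def Q_def input_def linked_def\<close>)
qed

end

section \<open>Computing a stable assignment\<close>

text \<open>One push per edge: every school with an edge is on the stack, and a repeated entry costs
  only one more pop.\<close>

definition fill_body :: com where
  "fill_body =
     Store ''stack'' (Inc (Var ''top'')) (Read ''school_lists_school'' (Var ''top'')) ;;
     Assign ''top'' (Inc (Var ''top''))"

definition fill_program :: com where
  "fill_program = Assign ''top'' (Const 0) ;; While (Less (Var ''top'') (Var ''edges'')) fill_body"

text \<open>Deferred acceptance with the schools making the offers: the trading phase may start from any
  stable assignment, and this one needs no data besides \<open>link\<close>. Entry \<open>a\<close> of \<open>place\<close> is the position of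
  the assignment of student \<open>a\<close> in the students' lists.\<close>

definition offer_body :: com where
  "offer_body =
     Assign ''b'' (Read ''stack'' (Var ''top'')) ;;
     Assign ''j'' (Read ''offer'' (Var ''b'')) ;;
     Assign ''a'' (Read ''school_lists_student'' (Var ''j'')) ;;
     Assign ''i'' (Read ''link'' (Var ''j'')) ;;
     Cond (Conj (Less (Read ''count'' (Var ''b'')) (Read ''quota'' (Var ''b'')))
           (Conj (Less (Var ''j'') (Var ''edges'')) (Equal (Read ''school_lists_school'' (Var ''j'')) (Var ''b''))))
       (Store ''offer'' (Var ''b'') (Inc (Var ''j'')) ;;
        Cond (Equal (Read ''output'' (Var ''a'')) (Const 0))
          (Store ''count'' (Var ''b'') (Inc (Read ''count'' (Var ''b''))) ;;
           Store ''output'' (Var ''a'') (Inc (Var ''b'')) ;;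
           Store ''place'' (Var ''a'') (Var ''i''))
          (Cond (Less (Var ''i'') (Read ''place'' (Var ''a'')))
            (Assign ''c'' (Dec (Read ''output'' (Var ''a''))) ;;
             Store ''count'' (Var ''c'') (Dec (Read ''count'' (Var ''c''))) ;;
             Store ''count'' (Var ''b'') (Inc (Read ''count'' (Var ''b''))) ;;
             Store ''output'' (Var ''a'') (Inc (Var ''b'')) ;;
             Store ''place'' (Var ''a'') (Var ''i'') ;;
             Assign ''top'' (Inc (Var ''top'')) ;;
             Store ''stack'' (Var ''top'') (Var ''c''))
            Skip))
       (Assign ''top'' (Dec (Var ''top'')))"

definition offer_program :: com where
  "offer_program = fill_program ;; While (Less (Const 0) (Var ''top'')) offer_body"

definition asg :: "(nat \<Rightarrow> nat) \<Rightarrow> nat \<Rightarrow> nat option" where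
  "asg out a = (if out a = 0 then None else Some (out a - 1))"

lemma asg_upd: "asg (out(a := Suc b)) = (asg out)(a := Some b)"
  by (auto simp: asg_def)

lemma asg_Some: "asg out a = Some b \<longleftrightarrow> out a = Suc b"
  by (auto simp: asg_def)

context encoding
begin

definition placed :: "(nat \<Rightarrow> nat) \<Rightarrow> (nat \<Rightarrow> nat) \<Rightarrow> bool" where
  "placed out rk \<longleftrightarrow> (\<forall>a. out a \<noteq> 0 \<longrightarrow> rk a < m \<and> sa (rk a) = a \<and> out a = Suc (sb (rk a)))"

lemma placed_edge: "placed out rk \<Longrightarrow> out a = Suc b \<Longrightarrow> (a, b) \<in> edges I"
  using index_edges(1)[of "rk a"] unfolding placed_def by (metis diff_Suc_1 nat.distinct(1))

lemma placed_upd: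
  "placed out rk \<Longrightarrow> linked l \<Longrightarrow> j < m \<Longrightarrow> placed (out(ca j := Suc (cb j))) (rk(ca j := l j))"
  by (auto simp: placed_def linked_def)

lemma finite_asg: "placed out rk \<Longrightarrow> finite (assigned (asg out) b)"
  by (rule finite_subset[OF _ finite_held(1)[of b]]) (auto simp: assigned_def asg_Some placed_edge)

text \<open>Within the block of a student better schools have smaller positions, so comparing two
  positions decides whether a school is wanted.\<close>

lemma wants_asg:
  assumes "placed out rk" "linked l" "j < m"
  shows "wants I (asg out) (ca j) (cb j) \<longleftrightarrow> out (ca j) = 0 \<or> l j < rk (ca j)"
proof (cases "out (ca j) = 0")
  case True
  then show ?thesis using index_edges(2)[OF assms(3)] by (simp add: wants_def asg_def)
next
  case False
  let ?a = "ca j" and ?c = "sb (rk (ca j))"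
  have r: "rk ?a < m" "sa (rk ?a) = ?a" "out ?a = Suc ?c" using assms(1) False by (auto simp: placed_def)
  have l: "l j < m" "sa (l j) = ?a" "sb (l j) = cb j" using assms(2,3) by (auto simp: linked_def)
  have e: "(?a, cb j) \<in> edges I" by (rule index_edges(2)[OF assms(3)])
  have w: "wants I (asg out) ?a (cb j) \<longleftrightarrow> (?c, cb j) \<in> student_pref I ?a"
    using r e by (simp add: wants_def asg_def)
  consider "l j < rk ?a" | "l j = rk ?a" | "rk ?a < l j" by linarith
  then show ?thesis
  proof cases
    case 1
    then show ?thesis using w student_order[of "l j" "rk ?a"] r l by simp
  next
    case 2
    then have "?c = cb j" using l by simp
    then show ?thesis using w student_pref_linear(4)[OF e] 2 False by simp
  next
    case 3
    then have "(cb j, ?c) \<in> student_pref I ?a" using student_order[of "rk ?a" "l j"] r l by simp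
    then show ?thesis using w student_pref_linear(5)[OF e] 3 False by auto
  qed
qed

text \<open>Entries before a cursor are the offers already made. The stack only has to contain every
  school that can still make offers; it may hold others, and repetitions.\<close>

definition offers ::
  "(nat \<Rightarrow> nat) \<Rightarrow> (nat \<Rightarrow> nat) \<Rightarrow> (nat \<Rightarrow> nat) \<Rightarrow> (nat \<Rightarrow> nat) \<Rightarrow> (nat \<Rightarrow> nat) \<Rightarrow> (nat \<Rightarrow> nat) \<Rightarrow> nat \<Rightarrow> bool" where
  "offers l out rk cnt p stack ht \<longleftrightarrow> placed out rk \<and> cursor p \<and>
     (\<forall>b. cnt b = card (assigned (asg out) b)) \<and> (\<forall>b\<in>Bs. cnt b \<le> qa b) \<and>
     (\<forall>j<m. j < p (cb j) \<longrightarrow> out (ca j) \<noteq> 0 \<and> rk (ca j) \<le> l j) \<and>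
     (\<forall>a b. out a = Suc b \<longrightarrow> (\<exists>j<m. j < p b \<and> ca j = a \<and> cb j = b)) \<and>
     (\<forall>b\<in>Bs. cnt b = qa b \<or> (\<forall>j<m. cb j = b \<longrightarrow> j < p b) \<or> (\<exists>k\<le>ht. 0 < k \<and> stack k = b))"

text \<open>An offer already made leaves its student at least as well off, so a student who wants
  \<open>b\<close> has had none from it. Then \<open>b\<close> is not through with its list and must
  be full, with students that come earlier in the list.\<close>

lemma offers_stable:
  assumes l: "linked l" and o: "offers l out rk cnt p stack 0"
  shows "stable I (asg out)"
proof -
  have pl: "placed out rk" and cnt: "\<And>b. cnt b = card (assigned (asg out) b)" "\<And>b. b \<in> Bs \<Longrightarrow> cnt b \<le> qa b"
    and made: "\<And>j. j < m \<Longrightarrow> j < p (cb j) \<Longrightarrow> out (ca j) \<noteq> 0 \<and> rk (ca j) \<le> l j"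
    and held: "\<And>a b. out a = Suc b \<Longrightarrow> \<exists>j<m. j < p b \<and> ca j = a \<and> cb j = b"
    and fin: "\<And>b. b \<in> Bs \<Longrightarrow> cnt b = qa b \<or> (\<forall>j<m. cb j = b \<longrightarrow> j < p b)"
    using o by (auto simp: offers_def)
  show ?thesis unfolding stable_def assignment_def
  proof (intro conjI allI impI)
    fix a b
    show "(a, b) \<in> edges I" if "asg out a = Some b" using that placed_edge[OF pl] by (simp add: asg_Some)
    show "card (assigned (asg out) b) \<le> quota I b"
    proof (cases "b \<in> Bs")
      case True
      then show ?thesis using cnt quota_array[OF Bs_schools[OF True]] by metis
    next
      case False
      have "(a, b) \<notin> edges I" for a
      proof
        assume "(a, b) \<in> edges I"
        then obtain j where "j < m" "cb j = b" by (rule school_index_ex)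
        then show False using False by (auto simp: Bs_def)
      qed
      then have "assigned (asg out) b = {}" using placed_edge[OF pl] by (auto simp: assigned_def asg_Some)
      then show ?thesis by simp
    qed
    assume w: "wants I (asg out) a b"
    obtain j where j: "j < m" "ca j = a" "cb j = b" using school_index_ex[OF wants_edge[OF w]] .
    have b: "b \<in> Bs" using j by (auto simp: Bs_def)
    have nj: "\<not> j < p b" using w made[of j] wants_asg[OF pl l j(1)] j by auto
    then have "cnt b = qa b" using fin[OF b] j by blast
    then show "card (assigned (asg out) b) = quota I b"
      using cnt(1)[of b] quota_array[OF Bs_schools[OF b]] by simp
    fix a' assume "asg out a' = Some b"
    then obtain j' where "j' < m" "j' < p b" "ca j' = a'" "cb j' = b" using held by (auto simp: asg_Some)
    then show "(a, a') \<in> school_pref I b" using school_order[of j' j] nj j by auto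
  qed
qed

context
  fixes l out rk cnt p stack :: "nat \<Rightarrow> nat" and ht b :: nat
  assumes l: "linked l" and o: "offers l out rk cnt p stack ht" and ht: "0 < ht" and b: "stack ht = b"
begin

lemma offers_pop:
  assumes "\<not> (cnt b < qa b \<and> p b < m \<and> cb (p b) = b)"
  shows "offers l out rk cnt p stack (ht - 1)"
proof -
  have "cnt b' = qa b' \<or> (\<forall>j<m. cb j = b' \<longrightarrow> j < p b') \<or> (\<exists>k\<le>ht - 1. 0 < k \<and> stack k = b')"
    if b': "b' \<in> Bs" for b'
  proof (cases "b' = b")
    case True
    have "cnt b \<le> qa b" "cursor p" using o True b' by (auto simp: offers_def)
    then have "cnt b = qa b \<or> (\<forall>j<m. cb j = b \<longrightarrow> j < p b)"
      using assms cursor_exhausted[of p] by (metis le_neq_implies_less)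
    then show ?thesis using True by blast
  next
    case False
    have "k \<le> ht - 1" if "k \<le> ht" "stack k = b'" for k
      using that False b by (cases "k = ht") auto
    then show ?thesis using o b' unfolding offers_def by blast
  qed
  then show ?thesis using o unfolding offers_def by blast
qed

context
  fixes j a
  assumes j: "j = p b" "j < m" "cb j = b" "cnt b < qa b" and a: "a = ca j"
begin

lemma offers_declined:
  assumes "out a \<noteq> 0" "\<not> l j < rk a"
  shows "offers l out rk cnt (p(b := Suc j)) stack ht"
proof -
  have "out (ca k) \<noteq> 0 \<and> rk (ca k) \<le> l k" if "k < m" "k < (p(b := Suc j)) (cb k)" for k
  proof (cases "k = j")
    case True then show ?thesis using assms a by simp
  next
    case False
    then have "k < p (cb k)" using that j by (auto split: if_splits)
    then show ?thesis using o that(1) by (simp add: offers_def)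
  qed
  moreover have "\<exists>k<m. k < (p(b := Suc j)) b' \<and> ca k = a' \<and> cb k = b'" if "out a' = Suc b'" for a' b'
    using o that j unfolding offers_def by (metis fun_upd_apply less_SucI)
  moreover have "cursor (p(b := Suc j))" using o cursor_Suc j(1) by (simp add: offers_def)
  moreover have "cnt b' = qa b' \<or> (\<forall>k<m. cb k = b' \<longrightarrow> k < (p(b := Suc j)) b') \<or> (\<exists>k\<le>ht. 0 < k \<and> stack k = b')"
    if "b' \<in> Bs" for b'
    using o that ht b by (cases "b' = b") (auto simp: offers_def)
  ultimately show ?thesis using o unfolding offers_def by blast
qed

text \<open>Covers an unassigned student as well as one who leaves another school; in the latter
  case that school has a vacancy again and must be on the stack.\<close>

lemma offers_taken:
  assumes better: "out a = 0 \<or> l j < rk a"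
    and cnt': "\<And>b'. cnt' b' = (if b' = b then Suc (cnt b) else if out a = Suc b' then cnt b' - 1 else cnt b')"
    and stack': "ht \<le> ht'" "\<And>k. k \<le> ht \<Longrightarrow> stack' k = stack k"
      "\<And>c. out a = Suc c \<Longrightarrow> \<exists>k\<le>ht'. 0 < k \<and> stack' k = c"
  shows "offers l (out(a := Suc b)) (rk(a := l j)) cnt' (p(b := Suc j)) stack' ht'"
proof -
  have pl: "placed out rk" and cnt: "\<And>b. cnt b = card (assigned (asg out) b)" "\<And>b. b \<in> Bs \<Longrightarrow> cnt b \<le> qa b"
    and made: "\<And>j. j < m \<Longrightarrow> j < p (cb j) \<Longrightarrow> out (ca j) \<noteq> 0 \<and> rk (ca j) \<le> l j"
    and held: "\<And>a b. out a = Suc b \<Longrightarrow> \<exists>j<m. j < p b \<and> ca j = a \<and> cb j = b"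
    and fin: "\<And>b. b \<in> Bs \<Longrightarrow> cnt b = qa b \<or> (\<forall>j<m. cb j = b \<longrightarrow> j < p b) \<or> (\<exists>k\<le>ht. 0 < k \<and> stack k = b)"
    using o by (auto simp: offers_def)
  \<comment> \<open>Each entry is offered once: if \<open>b\<close> held \<open>a\<close> already,
    \<open>j\<close> would lie before the cursor.\<close>
  have nb: "out a \<noteq> Suc b"
  proof
    assume "out a = Suc b"
    then obtain k where "k < m" "k < p b" "ca k = a" "cb k = b" using held by blast
    then show False using school_index_inj[of k j] j a by simp
  qed
  have 1: "placed (out(a := Suc b)) (rk(a := l j))" using placed_upd[OF pl l j(2)] j a by simp
  have 2: "cursor (p(b := Suc j))" using o cursor_Suc j(1) by (simp add: offers_def)
  have 3: "cnt' b' = card (assigned (asg (out(a := Suc b))) b')" for b'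
  proof -
    consider "b' = b" | "b' \<noteq> b" "out a = Suc b'" | "b' \<noteq> b" "out a \<noteq> Suc b'" by blast
    then show ?thesis
    proof cases
      case 1
      have "assigned (asg (out(a := Suc b))) b = insert a (assigned (asg out) b)"
        by (auto simp: assigned_def asg_upd)
      moreover have "a \<notin> assigned (asg out) b" using nb by (simp add: assigned_def asg_Some)
      ultimately show ?thesis using 1 cnt' cnt(1) finite_asg[OF pl] by simp
    next
      case 2
      have "assigned (asg (out(a := Suc b))) b' = assigned (asg out) b' - {a}"
        using 2 by (auto simp: assigned_def asg_upd)
      moreover have "a \<in> assigned (asg out) b'" using 2 by (simp add: assigned_def asg_Some)
      ultimately show ?thesis using 2 cnt' cnt(1) by simp
    next
      case 3
      have "assigned (asg (out(a := Suc b))) b' = assigned (asg out) b'"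
        using 3 by (auto simp: assigned_def asg_upd asg_Some)
      then show ?thesis using 3 cnt' cnt(1) by simp
    qed
  qed
  have 4: "cnt' b' \<le> qa b'" if "b' \<in> Bs" for b'
    using cnt(2)[OF that] j(4) cnt'[of b'] by auto
  have 5: "(out(a := Suc b)) (ca k) \<noteq> 0 \<and> (rk(a := l j)) (ca k) \<le> l k"
    if k: "k < m" "k < (p(b := Suc j)) (cb k)" for k
  proof (cases "k = j")
    case True then show ?thesis using a by simp
  next
    case False
    then have "k < p (cb k)" using k j by (auto split: if_splits)
    then have "out (ca k) \<noteq> 0" "rk (ca k) \<le> l k" using made k by auto
    then show ?thesis using better by auto
  qed
  have 6: "\<exists>k<m. k < (p(b := Suc j)) b' \<and> ca k = a' \<and> cb k = b'" if "(out(a := Suc b)) a' = Suc b'" for a' b'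
  proof (cases "a' = a")
    case True
    then show ?thesis using that j a by (intro exI[of _ j]) simp
  next
    case False
    then have "out a' = Suc b'" using \<open>(out(a := Suc b)) a' = Suc b'\<close> by simp
    then obtain k where "k < m" "k < p b'" "ca k = a'" "cb k = b'" using held by blast
    then show ?thesis using j by (intro exI[of _ k]) auto
  qed
  have 7: "cnt' b' = qa b' \<or> (\<forall>k<m. cb k = b' \<longrightarrow> k < (p(b := Suc j)) b') \<or> (\<exists>k\<le>ht'. 0 < k \<and> stack' k = b')"
    if b': "b' \<in> Bs" for b'
  proof -
    have up: "\<exists>k\<le>ht'. 0 < k \<and> stack' k = b'" if "\<exists>k\<le>ht. 0 < k \<and> stack k = b'"
      using that stack'(1,2) by (metis order_trans)
    show ?thesis
    proof (cases "b' = b \<or> out a = Suc b'")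
      case True
      then show ?thesis using up ht b stack'(3) by blast
    next
      case False
      then show ?thesis using fin[OF b'] up cnt'[of b'] by auto
    qed
  qed
  show ?thesis unfolding offers_def using 1 2 3 4 5 6 7 by blast
qed

end

end

lemma fill_correct:
  assumes "input s"
  shows "runs fill_program s (20 * m + 20)
    (\<lambda>s'. input s' \<and> unchanged {''stack''} s s' \<and> scalars s' ''top'' = m \<and>
       (\<forall>k<m. arrays s' ''stack'' (Suc k) = cb k))"
proof -
  define Inv where "Inv n s' \<longleftrightarrow> input s' \<and> unchanged {''stack''} s s' \<and> scalars s' ''top'' \<le> m \<and>
    n = m - scalars s' ''top'' \<and> (\<forall>k<scalars s' ''top''. arrays s' ''stack'' (Suc k) = cb k)" for n s'
  let ?B = "Less (Var ''top'') (Var ''edges'')"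
  show ?thesis unfolding fill_program_def
  proof (rule runs_loop[where K = 20 and n = m and Inv = Inv and u = 2])
    show "runs (Assign ''top'' (Const 0)) s 2 (Inv m)"
      by (rule runs_loop_free) (use assms in \<open>auto simp: Inv_def input_def unchanged_def\<close>)
  next
    fix n s assume "Inv n s" "bval ?B s"
    then show "\<exists>n'<n. Inv n' (outcome fill_body s)"
      by (intro exI[of _ "m - Suc (scalars s ''top'')"])
        (auto simp: Inv_def input_def unchanged_def fill_body_def less_Suc_eq)
  qed (auto simp: fill_body_def Inv_def input_def)
qed

text \<open>An offer consumes a list entry worth 2 and pushes at most one school, so
  \<open>top + 2 * left\<close> decreases; it is at most \<open>3 * m\<close> initially.\<close>

lemma offer_correct:
  assumes in_s: "input s" and link: "linked (arrays s ''link'')" and p: "at_start (arrays s ''offer'')"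
    and zero: "arrays s ''output'' = (\<lambda>_. 0)" "arrays s ''count'' = (\<lambda>_. 0)"
  shows "runs offer_program s (300 * m + 100) (\<lambda>s'. input s' \<and>
    unchanged {''stack'', ''offer'', ''output'', ''place'', ''count''} s s' \<and>
    placed (arrays s' ''output'') (arrays s' ''place'') \<and> stable I (asg (arrays s' ''output'')))"
proof -
  define A where "A = {''stack'', ''offer'', ''output'', ''place'', ''count''}"
  define l where "l = arrays s ''link''"
  define Inv where "Inv n s' \<longleftrightarrow> input s' \<and> unchanged A s s' \<and>
    offers l (arrays s' ''output'') (arrays s' ''place'') (arrays s' ''count'') (arrays s' ''offer'')
      (arrays s' ''stack'') (scalars s' ''top'') \<and>
    n = scalars s' ''top'' + 2 * left (arrays s' ''offer'')" for n s'
  have l: "linked l" using link by (simp add: l_def)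
  let ?B = "Less (Const 0) (Var ''top'')"
  show ?thesis unfolding offer_program_def
  proof (rule runs_loop[where K = 90 and n = "m + 2 * left (arrays s ''offer'')" and Inv = Inv and u = "20 * m + 20"],
      rule runs_mono[OF fill_correct[OF in_s]])
    fix s' assume s': "input s' \<and> unchanged {''stack''} s s' \<and> scalars s' ''top'' = m \<and>
       (\<forall>k<m. arrays s' ''stack'' (Suc k) = cb k)"
    have "offers l (\<lambda>_. 0) (arrays s' ''place'') (\<lambda>_. 0) (arrays s ''offer'') (arrays s' ''stack'') m"
    proof -
      have "\<exists>k\<le>m. 0 < k \<and> arrays s' ''stack'' k = b" if "b \<in> Bs" for b
      proof -
        obtain k where "k < m" "b = cb k" using \<open>b \<in> Bs\<close> by (auto simp: Bs_def)
        then show ?thesis using s' by (intro exI[of _ "Suc k"]) simp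
      qed
      then show ?thesis using p unfolding offers_def at_start_def
        by (auto simp: placed_def assigned_def asg_def leD)
    qed
    then show "Inv (m + 2 * left (arrays s ''offer'')) s'"
      using s' zero by (auto simp: Inv_def unchanged_def A_def)
  next
    fix n s' assume I: "Inv n s'" and B: "bval ?B s'"
    define out rk cnt p stack ht b j a where "out = arrays s' ''output''" and "rk = arrays s' ''place''"
      and "cnt = arrays s' ''count''" and "p = arrays s' ''offer''" and "stack = arrays s' ''stack''"
      and "ht = scalars s' ''top''" and "b = stack ht" and "j = p b" and "a = ca j"
    note defs = out_def rk_def cnt_def p_def stack_def ht_def b_def j_def a_def
    have in': "input s'" "unchanged A s s'" and o: "offers l out rk cnt p stack ht"
      and n: "n = ht + 2 * left p" using I by (simp_all add: Inv_def defs)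
    have l': "arrays s' ''link'' = l" using in'(2) by (simp add: unchanged_def A_def l_def)
    have ht: "0 < ht" using B by (simp add: ht_def)
    note ctx = l o ht b_def[symmetric]
    let ?sc = "(scalars s')(''b'' := b, ''j'' := j, ''a'' := a, ''i'' := l j)"
    show "\<exists>n'<n. Inv n' (outcome offer_body s')"
    proof (cases "cnt b < qa b \<and> j < m \<and> cb j = b")
      case False
      then have "offers l out rk cnt p stack (ht - 1)" using offers_pop[OF ctx] by (simp add: j_def)
      moreover have "outcome offer_body s' = s'\<lparr>scalars := ?sc(''top'' := ht - 1)\<rparr>"
        using in' l' False by (auto simp: offer_body_def input_def defs)
      ultimately show ?thesis using in' n ht
        by (intro exI[of _ "ht - 1 + 2 * left p"]) (auto simp: Inv_def input_def unchanged_def defs)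
    next
      case True
      then have jb: "j = p b" "j < m" "cb j = b" "cnt b < qa b" by (auto simp: j_def)
      note ctx2 = ctx jb a_def
      have lf: "Suc (left (p(b := Suc j))) = left p" using left_Suc[of p b] jb by simp
      consider "out a = 0" | "out a \<noteq> 0" "l j < rk a" | "out a \<noteq> 0" "\<not> l j < rk a" by blast
      then show ?thesis
      proof cases
        case 1
        have "offers l (out(a := Suc b)) (rk(a := l j)) (cnt(b := Suc (cnt b))) (p(b := Suc j)) stack ht"
          by (rule offers_taken[OF ctx2]) (use 1 in auto)
        moreover have "outcome offer_body s' = s'\<lparr>scalars := ?sc, arrays := (arrays s')
            (''offer'' := p(b := Suc j), ''count'' := cnt(b := Suc (cnt b)),
             ''output'' := out(a := Suc b), ''place'' := rk(a := l j))\<rparr>"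
          using in' l' True 1 by (auto simp: offer_body_def input_def defs)
        ultimately show ?thesis using in' n lf
          by (intro exI[of _ "ht + 2 * left (p(b := Suc j))"])
            (auto simp: Inv_def input_def unchanged_def A_def stack_def ht_def)
      next
        case 2
        define c where "c = out a - 1"
        have ac: "out a = Suc c" using 2 by (simp add: c_def)
        \<comment> \<open>Otherwise injectivity of positions would give \<open>l j = rk a\<close>.
          So the two updates of \<open>count\<close> hit different cells.\<close>
        have cb: "c \<noteq> b"
        proof
          assume "c = b"
          have "placed out rk" using o by (simp add: offers_def)
          then have "rk a < m" "sa (rk a) = a" "out a = Suc (sb (rk a))"
            using 2 by (auto simp: placed_def)
          then have "rk a < m \<and> sa (rk a) = a \<and> sb (rk a) = b" using ac \<open>c = b\<close> by simp
          moreover have "l j < m \<and> sa (l j) = a \<and> sb (l j) = b" using l jb a_def by (auto simp: linked_def)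
          ultimately show False using student_index_inj[of "rk a" "l j"] 2 by auto
        qed
        let ?cnt = "cnt(c := cnt c - 1, b := Suc (cnt b))"
        have "offers l (out(a := Suc b)) (rk(a := l j)) ?cnt (p(b := Suc j)) (stack(Suc ht := c)) (Suc ht)"
          by (rule offers_taken[OF ctx2]) (use 2 ac cb in auto)
        moreover have "outcome offer_body s' = s'\<lparr>scalars := ?sc(''c'' := c, ''top'' := Suc ht), arrays := (arrays s')
            (''offer'' := p(b := Suc j), ''count'' := ?cnt, ''output'' := out(a := Suc b),
             ''place'' := rk(a := l j), ''stack'' := stack(Suc ht := c))\<rparr>"
          using in' l' True 2 cb by (auto simp: offer_body_def input_def defs c_def)
        ultimately show ?thesis using in' n lf
          by (intro exI[of _ "Suc ht + 2 * left (p(b := Suc j))"])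
            (auto simp: Inv_def input_def unchanged_def A_def)
      next
        case 3
        have "offers l out rk cnt (p(b := Suc j)) stack ht" by (rule offers_declined[OF ctx2 3])
        moreover have "outcome offer_body s' = s'\<lparr>scalars := ?sc, arrays := (arrays s')
            (''offer'' := p(b := Suc j))\<rparr>"
          using in' l' True 3 by (auto simp: offer_body_def input_def defs)
        ultimately show ?thesis using in' n lf
          by (intro exI[of _ "ht + 2 * left (p(b := Suc j))"])
            (auto simp: Inv_def input_def unchanged_def A_def stack_def ht_def out_def rk_def cnt_def)
      qed
    qed
  next
    fix n s' assume "Inv n s'" "\<not> bval ?B s'"
    then have "input s'" "unchanged A s s'" "offers l (arrays s' ''output'') (arrays s' ''place'')
      (arrays s' ''count'') (arrays s' ''offer'') (arrays s' ''stack'') 0" by (auto simp: Inv_def)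
    then show "input s' \<and> unchanged {''stack'', ''offer'', ''output'', ''place'', ''count''} s s' \<and>
      placed (arrays s' ''output'') (arrays s' ''place'') \<and> stable I (asg (arrays s' ''output''))"
      using offers_stable[OF l] by (auto simp: A_def offers_def)
  qed (use left_le[of "arrays s ''offer''"] in \<open>auto simp: offer_body_def\<close>)
qed

end

section \<open>Computing the outcome of the trading process\<close>

definition push :: "vname \<Rightarrow> com" where
  "push x =
     Assign ''top'' (Inc (Var ''top'')) ;;
     Store ''path'' (Var ''top'') (Var x) ;;
     Store ''depth'' (Var x) (Var ''top'')"

definition settle_top :: com where
  "settle_top =
     Store ''done'' (Var ''b'') (Const 1) ;;
     Store ''depth'' (Var ''b'') (Const 0) ;;
     Assign ''top'' (Dec (Var ''top''))"

text \<open>The stack \<open>path\<close> holds distinct unsettled schools, each followed by the school to which its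
  pick is assigned; \<open>depth\<close> is the position of a school on it. When the path runs into itself at
  position \<open>base\<close>, the schools from there on trade and are popped.\<close>

definition walk_body :: com where
  "walk_body =
     Assign ''base'' (Const 0) ;;
     Cond (Equal (Var ''top'') (Const 0))
       (Assign ''b'' (Read ''school_lists_school'' (Var ''i'')) ;;
        Cond (Equal (Read ''done'' (Var ''b'')) (Const 0))
          (push ''b'')
          (Assign ''i'' (Inc (Var ''i''))))
       (Assign ''b'' (Read ''path'' (Var ''top'')) ;;
        Assign ''j'' (Read ''wait'' (Var ''b'')) ;;
        Assign ''a'' (Read ''school_lists_student'' (Var ''j'')) ;;
        Assign ''c'' (Dec (Read ''output'' (Var ''a''))) ;;
        Cond (Conj (Less (Var ''j'') (Var ''edges'')) (Equal (Read ''school_lists_school'' (Var ''j'')) (Var ''b'')))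
          (Cond (Conj (Neg (Equal (Read ''output'' (Var ''a'')) (Const 0)))
              (Neg (Less (Read ''link'' (Var ''j'')) (Read ''place'' (Var ''a'')))))
            (Store ''wait'' (Var ''b'') (Inc (Var ''j'')))
            (Cond (Conj (Neg (Equal (Read ''output'' (Var ''a'')) (Const 0)))
                (Equal (Read ''done'' (Var ''c'')) (Const 0)))
              (Cond (Equal (Read ''depth'' (Var ''c'')) (Const 0))
                (push ''c'')
                (Assign ''base'' (Read ''depth'' (Var ''c''))))
              (Cond (Equal (Read ''consent'' (Var ''a'')) (Const 0))
                settle_top
                (Store ''wait'' (Var ''b'') (Inc (Var ''j''))))))
          settle_top)"

definition pop_body :: com where
  "pop_body =
     Assign ''b'' (Read ''path'' (Var ''top'')) ;;
     Assign ''j'' (Read ''wait'' (Var ''b'')) ;;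
     Assign ''a'' (Read ''school_lists_student'' (Var ''j'')) ;;
     Store ''output'' (Var ''a'') (Inc (Var ''b'')) ;;
     Store ''place'' (Var ''a'') (Read ''link'' (Var ''j'')) ;;
     Store ''wait'' (Var ''b'') (Inc (Var ''j'')) ;;
     Store ''depth'' (Var ''b'') (Const 0) ;;
     Assign ''top'' (Dec (Var ''top''))"

definition pop_guard :: bexp where
  "pop_guard = Conj (Neg (Equal (Var ''base'') (Const 0))) (Neg (Less (Var ''top'') (Var ''base'')))"

definition trade_program :: com where
  "trade_program =
     (Assign ''i'' (Const 0) ;; Assign ''top'' (Const 0)) ;;
     While (Less (Var ''i'') (Var ''edges'')) (walk_body ;; While pop_guard pop_body)"

lemma exchange_insert:
  assumes "inj_on d (insert b C)" "b \<notin> C"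
  shows "exchange M (insert b C) d = (exchange M C d)(d b := Some b)"
proof -
  have i: "inj_on d C" using assms by (auto intro: inj_on_subset)
  have nb: "d c \<noteq> d b" if "c \<in> C" for c using assms that by (metis inj_onD insertI1 insertI2)
  show ?thesis
    by (rule exchange_eqI[OF assms(1), symmetric])
      (use exchange_simps[OF i] nb in auto)
qed

context encoding
begin

section \<open>Invariant and potential of the walk\<close>

definition front :: "(nat \<Rightarrow> nat) \<Rightarrow> (nat \<Rightarrow> nat) \<Rightarrow> nat \<Rightarrow> nat \<Rightarrow> bool" where
  "front out q b c \<longleftrightarrow> q b < m \<and> cb (q b) = b \<and> wants I (asg out) (ca (q b)) b \<and> out (ca (q b)) = Suc c"

text \<open>The clause on passed entries is what allows cursors never to move back: who ceases to
  want a school never wants it again, and settled students stay settled and in place.\<close>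

definition walk :: "(nat \<Rightarrow> nat option) \<Rightarrow> (nat \<Rightarrow> nat) \<Rightarrow> (nat \<Rightarrow> nat) \<Rightarrow> (nat \<Rightarrow> nat) \<Rightarrow> (nat \<Rightarrow> nat)
    \<Rightarrow> (nat \<Rightarrow> nat) \<Rightarrow> (nat \<Rightarrow> nat) \<Rightarrow> nat \<Rightarrow> nat \<Rightarrow> bool" where
  "walk N out rk q dn path dp h i \<longleftrightarrow> placed out rk \<and> cursor q \<and>
     (step I Ab)\<^sup>*\<^sup>* (N, {}) (asg out, {b. dn b \<noteq> 0}) \<and>
     (\<forall>j<m. j < q (cb j) \<longrightarrow> \<not> wants I (asg out) (ca j) (cb j) \<or>
        ca j \<in> Ab \<and> settled {b. dn b \<noteq> 0} (asg out) (ca j)) \<and>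
     (\<forall>k. 0 < k \<and> k \<le> h \<longrightarrow> dp (path k) = k \<and> dn (path k) = 0 \<and> path k \<in> Bs) \<and>
     (\<forall>b. dp b \<noteq> 0 \<longrightarrow> dp b \<le> h \<and> path (dp b) = b) \<and>
     (\<forall>k. 0 < k \<and> k < h \<longrightarrow> front out q (path k) (path (Suc k))) \<and>
     i \<le> m \<and> (\<forall>j<i. dn (cb j) \<noteq> 0)"

text \<open>A push is paid for by its school becoming occupied; a pop in a trade frees the school again
  but advances its cursor, and a pop in a settlement settles the school.\<close>

definition pot :: "(nat \<Rightarrow> nat) \<Rightarrow> (nat \<Rightarrow> nat) \<Rightarrow> (nat \<Rightarrow> nat) \<Rightarrow> nat \<Rightarrow> nat" where
  "pot q dn dp i = (m - i) + 3 * left q + 2 * card {b\<in>Bs. dn b = 0} + card {b\<in>Bs. dn b = 0 \<and> dp b = 0}"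

lemma pot_le: "pot q dn dp i \<le> 7 * m"
proof -
  have "card {b\<in>Bs. dn b = 0} \<le> card Bs" "card {b\<in>Bs. dn b = 0 \<and> dp b = 0} \<le> card Bs"
    by (rule card_mono[OF finite_Bs]; auto)+
  then show ?thesis using card_Bs left_le[of q] unfolding pot_def by linarith
qed

context
  fixes N :: "nat \<Rightarrow> nat option" and out rk q dn path dp :: "nat \<Rightarrow> nat" and h i :: nat
  assumes w: "walk N out rk q dn path dp h i"
begin

abbreviation "M \<equiv> asg out"
abbreviation "X \<equiv> {b. dn b \<noteq> 0}"

lemma walkD:
  shows "placed out rk" "cursor q" "(step I Ab)\<^sup>*\<^sup>* (N, {}) (M, X)"
    and "\<And>j. j < m \<Longrightarrow> j < q (cb j) \<Longrightarrow> \<not> wants I M (ca j) (cb j) \<or> ca j \<in> Ab \<and> settled X M (ca j)"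
    and "\<And>k. 0 < k \<Longrightarrow> k \<le> h \<Longrightarrow> dp (path k) = k" "\<And>k. 0 < k \<Longrightarrow> k \<le> h \<Longrightarrow> dn (path k) = 0"
      "\<And>k. 0 < k \<Longrightarrow> k \<le> h \<Longrightarrow> path k \<in> Bs"
    and "\<And>b. dp b \<noteq> 0 \<Longrightarrow> dp b \<le> h" "\<And>b. dp b \<noteq> 0 \<Longrightarrow> path (dp b) = b"
    and "\<And>k. 0 < k \<Longrightarrow> k < h \<Longrightarrow> front out q (path k) (path (Suc k))"
    and "i \<le> m" "\<And>j. j < i \<Longrightarrow> dn (cb j) \<noteq> 0"
  using w by (simp_all add: walk_def)

text \<open>Everybody before the cursor who still wants \<open>b\<close> is settled and consents,
  just what a pick tolerates above itself.\<close>

lemma walk_pick: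
  assumes j: "q b < m" "cb (q b) = b" and d: "wants I M (ca (q b)) b" "\<not> settled X M (ca (q b))"
  shows "pick I Ab M X b (ca (q b))"
proof -
  have "a \<in> Ab \<and> settled X M a" if a: "wants I M a b" "(ca (q b), a) \<in> school_pref I b" for a
  proof -
    obtain k where k: "k < m" "ca k = a" "cb k = b" using school_index_ex[OF wants_edge[OF a(1)]] .
    have "(a, ca (q b)) \<notin> school_pref I b" "a \<noteq> ca (q b)"
      using school_pref_linear(4,5)[OF wants_edge[OF d(1)]] a(2) by blast+
    then have "k < q b" using school_order[of "q b" k] k j by (metis not_less_iff_gr_or_eq)
    then show ?thesis using walkD(4)[of k] k a by blast
  qed
  then show ?thesis using d by (simp add: pick_def)
qed

lemma walk_advance:
  assumes "i < m" "dn (cb i) \<noteq> 0"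
  shows "walk N out rk q dn path dp h (Suc i)" "pot q dn dp (Suc i) < pot q dn dp i"
  using w assms by (auto simp: walk_def pot_def less_Suc_eq)

lemma walk_push:
  assumes c: "c \<in> Bs" "dn c = 0" "dp c = 0" and f: "0 < h \<Longrightarrow> front out q (path h) c"
  shows "walk N out rk q dn (path(Suc h := c)) (dp(c := Suc h)) (Suc h) i"
    and "pot q dn (dp(c := Suc h)) i < pot q dn dp i"
proof -
  have ne: "path k \<noteq> c" if "0 < k" "k \<le> h" for k using walkD(5)[OF that] that c by auto
  show "walk N out rk q dn (path(Suc h := c)) (dp(c := Suc h)) (Suc h) i"
    unfolding walk_def
  proof (intro conjI allI impI)
    fix k assume "0 < k \<and> k \<le> Suc h"
    then show "(dp(c := Suc h)) ((path(Suc h := c)) k) = k" "dn ((path(Suc h := c)) k) = 0"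
      "(path(Suc h := c)) k \<in> Bs"
      using ne[of k] walkD(5-7)[of k] c by (auto simp: le_Suc_eq)
  next
    fix b assume "(dp(c := Suc h)) b \<noteq> 0"
    then show "(dp(c := Suc h)) b \<le> Suc h" "(path(Suc h := c)) ((dp(c := Suc h)) b) = b"
      using walkD(8,9)[of b] by (auto split: if_splits)
  next
    fix k assume "0 < k \<and> k < Suc h"
    then show "front out q ((path(Suc h := c)) k) ((path(Suc h := c)) (Suc k))"
      using walkD(10)[of k] f by (auto simp: less_Suc_eq)
  qed (use w in \<open>auto simp: walk_def\<close>)
  have "{b\<in>Bs. dn b = 0 \<and> (dp(c := Suc h)) b = 0} \<subset> {b\<in>Bs. dn b = 0 \<and> dp b = 0}" using c by auto
  then have "card {b\<in>Bs. dn b = 0 \<and> (dp(c := Suc h)) b = 0} < card {b\<in>Bs. dn b = 0 \<and> dp b = 0}"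
    by (rule psubset_card_mono[rotated]) (simp add: finite_Bs)
  then show "pot q dn (dp(c := Suc h)) i < pot q dn dp i" by (simp add: pot_def)
qed

context
  fixes b
  assumes h: "0 < h" and b: "b = path h"
begin

lemma top_distinct: "0 < k \<Longrightarrow> k < h \<Longrightarrow> path k \<noteq> b"
  using walkD(5)[of k] walkD(5)[of h] h b by auto

lemma walk_skip:
  assumes j: "q b < m" "cb (q b) = b"
    and s: "\<not> wants I M (ca (q b)) b \<or> ca (q b) \<in> Ab \<and> settled X M (ca (q b))"
  shows "walk N out rk (q(b := Suc (q b))) dn path dp h i"
    and "pot (q(b := Suc (q b))) dn dp i < pot q dn dp i"
proof -
  show "walk N out rk (q(b := Suc (q b))) dn path dp h i"
    unfolding walk_def
  proof (intro conjI allI impI)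
    fix k assume "k < m" "k < (q(b := Suc (q b))) (cb k)"
    then show "\<not> wants I M (ca k) (cb k) \<or> ca k \<in> Ab \<and> settled X M (ca k)"
      using walkD(4)[of k] s j by (cases "cb k = b"; cases "k = q b") auto
  next
    fix k assume "0 < k \<and> k < h"
    then show "front out (q(b := Suc (q b))) (path k) (path (Suc k))"
      using walkD(10)[of k] top_distinct[of k] by (auto simp: front_def)
  qed (use w cursor_Suc in \<open>auto simp: walk_def\<close>)
  show "pot (q(b := Suc (q b))) dn dp i < pot q dn dp i"
    using left_Suc[of q b] j by (simp add: pot_def)
qed

text \<open>The school below on the path keeps its cursor. The student there has become settled
  through \<open>b\<close> and is judged anew now that this school is on top.\<close>

lemma walk_settle:
  assumes bl: "blocked I Ab M X b"
  shows "walk N out rk q (dn(b := 1)) path (dp(b := 0)) (h - 1) i"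
    and "pot q (dn(b := 1)) (dp(b := 0)) i < pot q dn dp i"
proof -
  have X': "{c. (dn(b := 1)) c \<noteq> 0} = insert b X" by auto
  show "walk N out rk q (dn(b := 1)) path (dp(b := 0)) (h - 1) i"
    unfolding walk_def X'
  proof (intro conjI allI impI)
    show "(step I Ab)\<^sup>*\<^sup>* (N, {}) (M, insert b X)"
      using walkD(3) step.settle[OF bl] by (rule rtranclp.rtrancl_into_rtrancl)
  next
    fix k assume "k < m" "k < q (cb k)"
    then show "\<not> wants I M (ca k) (cb k) \<or> ca k \<in> Ab \<and> settled (insert b X) M (ca k)"
      using walkD(4)[of k] by (auto simp: settled_def)
  next
    fix k assume "0 < k \<and> k \<le> h - 1"
    then have "0 < k" "k < h" using h by auto
    then show "(dp(b := 0)) (path k) = k" "(dn(b := 1)) (path k) = 0" "path k \<in> Bs"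
      using walkD(5-7)[of k] top_distinct[of k] h by auto
  next
    fix c assume c: "(dp(b := 0)) c \<noteq> 0"
    then have "c \<noteq> b" by auto
    then have "dp c \<noteq> h" using c walkD(9)[of c] b by auto
    then show "(dp(b := 0)) c \<le> h - 1" "path ((dp(b := 0)) c) = c"
      using walkD(8,9)[of c] c \<open>c \<noteq> b\<close> by auto
  next
    fix j assume "j < i"
    then show "(dn(b := 1)) (cb j) \<noteq> 0" using walkD(12) by simp
  qed (use w in \<open>auto simp: walk_def\<close>)
  have "b \<in> Bs" "dn b = 0" "dp b \<noteq> 0" using walkD(5-7)[of h] h b by auto
  then have "{c\<in>Bs. (dn(b := 1)) c = 0} \<subset> {c\<in>Bs. dn c = 0}" by auto
  then have "card {c\<in>Bs. (dn(b := 1)) c = 0} < card {c\<in>Bs. dn c = 0}"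
    by (rule psubset_card_mono[rotated]) (simp add: finite_Bs)
  moreover have "card {c\<in>Bs. (dn(b := 1)) c = 0 \<and> (dp(b := 0)) c = 0} \<le> card {c\<in>Bs. dn c = 0 \<and> dp c = 0}"
    by (rule card_mono) (auto simp: finite_Bs)
  ultimately show "pot q (dn(b := 1)) (dp(b := 0)) i < pot q dn dp i" by (simp add: pot_def)
qed

lemma exhausted_blocked:
  assumes "\<not> (q b < m \<and> cb (q b) = b)"
  shows "blocked I Ab M X b"
proof -
  have "settled X M d" if d: "wants I M d b" for d
  proof -
    obtain k where k: "k < m" "ca k = d" "cb k = b" using school_index_ex[OF wants_edge[OF d]] .
    then have "k < q (cb k)" using cursor_exhausted[OF walkD(2) k(1)] assms by simp
    then show ?thesis using walkD(4)[of k] k d by blast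
  qed
  then show ?thesis by (auto simp: blocked_def)
qed

text \<open>Unsettled students who want \<open>b\<close> come after the cursor in its list, hence
  below the settled student there who does not consent.\<close>

lemma objection_blocked:
  assumes j: "q b < m" "cb (q b) = b"
    and a: "wants I M (ca (q b)) b" "settled X M (ca (q b))" "ca (q b) \<notin> Ab"
  shows "blocked I Ab M X b"
  unfolding blocked_def
proof (intro allI impI)
  fix d assume d: "wants I M d b \<and> \<not> settled X M d"
  then obtain k where k: "k < m" "ca k = d" "cb k = b" using school_index_ex wants_edge by metis
  then have "\<not> k < q b" using walkD(4)[of k] d by blast
  moreover have "k \<noteq> q b" using d a k by auto
  ultimately have "(d, ca (q b)) \<in> school_pref I b" using school_order[of "q b" k] k j by simp
  then show "\<exists>a. wants I M a b \<and> settled X M a \<and> a \<notin> Ab \<and> (d, a) \<in> school_pref I b"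
    using a by blast
qed

section \<open>Closing a cycle\<close>

context
  fixes c k0 :: nat and d :: "nat \<Rightarrow> nat" and C :: "nat set"
  assumes f: "front out q b c" and k0: "k0 = dp c" "k0 \<noteq> 0"
  defines "d \<equiv> \<lambda>b. ca (q b)" and "C \<equiv> path ` {k0..h}"
begin

lemma cycle_succ:
  assumes "k0 \<le> k" "k \<le> h"
  shows "front out q (path k) (if k = h then path k0 else path (Suc k))"
  using walkD(10)[of k] walkD(9)[of c] assms f k0 b by auto

lemma cycle_trade:
  shows "finite C" "\<And>b. b \<in> C \<Longrightarrow> pick I Ab M X b (d b)" "(\<lambda>b. M (d b)) ` C = Some ` C"
proof -
  show "finite C" by (simp add: C_def)
  have kh: "k0 \<le> h" using walkD(8)[of c] k0 by simp
  fix b' assume "b' \<in> C"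
  then obtain k where k: "k0 \<le> k" "k \<le> h" "b' = path k" by (auto simp: C_def)
  let ?c = "if k = h then path k0 else path (Suc k)"
  have fr: "front out q b' ?c" using cycle_succ k by simp
  have "dn ?c = 0" using walkD(6)[of k0] walkD(6)[of "Suc k"] k kh k0 by auto
  then have "\<not> settled X M (ca (q b'))" using fr by (auto simp: settled_def front_def asg_Some)
  then show "pick I Ab M X b' (d b')" unfolding d_def using fr by (intro walk_pick) (auto simp: front_def)
next
  have kh: "k0 \<le> h" using walkD(8)[of c] k0 by simp
  have "(\<lambda>k. M (d (path k))) ` {k0..h} = (\<lambda>k. Some (if k = h then path k0 else path (Suc k))) ` {k0..h}"
  proof (rule image_cong[OF refl])
    fix k assume "k \<in> {k0..h}"
    then show "M (d (path k)) = Some (if k = h then path k0 else path (Suc k))"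
      using cycle_succ[of k] unfolding front_def d_def asg_Some by simp
  qed
  also have "\<dots> = (\<lambda>k. Some (path k)) ` {k0..h}"
  \<comment> \<open>Both inclusions shift the index cyclically in \<open>{k0..h}\<close>: forwards
    with \<open>h\<close> going to \<open>k0\<close>, backwards with \<open>k0\<close> going to
    \<open>h\<close>.\<close>
  proof (intro equalityI subsetI)
    fix x assume "x \<in> (\<lambda>k. Some (if k = h then path k0 else path (Suc k))) ` {k0..h}"
    then obtain k where "k \<in> {k0..h}" "x = Some (if k = h then path k0 else path (Suc k))" by blast
    then show "x \<in> (\<lambda>k. Some (path k)) ` {k0..h}"
      using kh by (intro image_eqI[of _ _ "if k = h then k0 else Suc k"]) auto
  next
    fix x assume "x \<in> (\<lambda>k. Some (path k)) ` {k0..h}"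
    then obtain k where "k \<in> {k0..h}" "x = Some (path k)" by blast
    then show "x \<in> (\<lambda>k. Some (if k = h then path k0 else path (Suc k))) ` {k0..h}"
      using kh k0 by (intro image_eqI[of _ _ "if k = k0 then h else k - 1"]) auto
  qed
  finally show "(\<lambda>b. M (d b)) ` C = Some ` C" by (simp add: C_def image_image)
qed

lemma walk_trade:
  assumes out': "asg out' = exchange M C d" and pl': "placed out' rk'"
    and q': "q' = (\<lambda>b. if b \<in> C then Suc (q b) else q b)" and dp': "dp' = (\<lambda>b. if b \<in> C then 0 else dp b)"
  shows "walk N out' rk' q' dn path dp' (k0 - 1) i"
proof -
  note t = cycle_trade
  have kh: "k0 \<le> h" using walkD(8)[of c] k0 by simp
  have inj: "inj_on d C" by (rule trade_inj_d[OF t])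
  note ex = exchange_simps[OF inj, where M = M]
  have below: "path k \<notin> C" if "0 < k" "k < k0" for k
  proof
    assume "path k \<in> C"
    then obtain k' where "k0 \<le> k'" "k' \<le> h" "path k = path k'" by (auto simp: C_def)
    then show False using walkD(5)[of k] walkD(5)[of k'] that kh by simp
  qed
  show ?thesis unfolding walk_def out'
  proof (intro conjI allI impI)
    show "placed out' rk'" by (rule pl')
    show "cursor q'" using walkD(2) unfolding cursor_def q' by (auto intro: le_SucI)
    have "step I Ab (M, X) (exchange M C d, X)" by (rule step.trade[OF t])
    then show "(step I Ab)\<^sup>*\<^sup>* (N, {}) (exchange M C d, X)"
      by (rule rtranclp.rtrancl_into_rtrancl[OF walkD(3)])
  next
    fix j assume j: "j < m" "j < q' (cb j)"
    show "\<not> wants I (exchange M C d) (ca j) (cb j) \<or> ca j \<in> Ab \<and> settled X (exchange M C d) (ca j)"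
    proof (cases "j < q (cb j)")
      case True
      then show ?thesis using walkD(4)[OF j(1) True] trade_wants[OF t] trade_settled[OF t] by blast
    next
      case False
      \<comment> \<open>The entry just passed is the student that the school has received in the
        trade.\<close>
      then have "j = q (cb j)" "cb j \<in> C" using j by (auto simp: q' split: if_splits)
      then have "exchange M C d (ca j) = Some (cb j)" using ex(1)[of "cb j"] by (simp add: d_def)
      then show ?thesis using not_wants_own by blast
    qed
  next
    fix k assume "0 < k \<and> k \<le> k0 - 1"
    then have k: "0 < k" "k < k0" "k \<le> h" using kh by auto
    then show "dp' (path k) = k" "dn (path k) = 0" "path k \<in> Bs"
      using walkD(5-7)[of k] below by (auto simp: dp')
  next
    fix c' assume c': "dp' c' \<noteq> 0"
    then have n: "c' \<notin> C" "dp c' \<noteq> 0" by (auto simp: dp' split: if_splits)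
    have "dp c' < k0"
    proof (rule ccontr)
      assume "\<not> dp c' < k0"
      then have "path (dp c') \<in> C" using walkD(8)[of c'] n by (simp add: C_def)
      then show False using walkD(9)[of c'] n by simp
    qed
    then show "dp' c' \<le> k0 - 1" "path (dp' c') = c'" using n walkD(9)[of c'] by (auto simp: dp')
  next
    fix k assume "0 < k \<and> k < k0 - 1"
    then have k: "0 < k" "Suc k < k0" "k < h" using kh by auto
    have fr: "front out q (path k) (path (Suc k))" using walkD(10)[of k] k by simp
    have qk: "q' (path k) = q (path k)" using below[of k] k by (simp add: q')
    let ?x = "ca (q (path k))"
    \<comment> \<open>The student in front of a school below the cycle is assigned to the next
      school of the path, still below the cycle; so it does not trade and this part of the path
      stays valid.\<close>
    have "?x \<notin> d ` C"
    proof
      assume "?x \<in> d ` C"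
      then obtain b' where "b' \<in> C" "?x = d b'" by blast
      then have "M ?x \<in> (\<lambda>b. M (d b)) ` C" by simp
      then have "M ?x \<in> Some ` C" using t(3) by simp
      moreover have "M ?x = Some (path (Suc k))" using fr by (simp add: front_def asg_Some)
      ultimately show False using below[of "Suc k"] k by auto
    qed
    then have same: "exchange M C d ?x = M ?x" by (rule ex(2))
    have "out' ?x = Suc (path (Suc k))"
      using same fr by (simp add: out'[symmetric] front_def asg_Some) (simp add: asg_def split: if_splits)
    moreover have "wants I (asg out') ?x (path k)"
      using fr same by (simp add: front_def wants_def out')
    ultimately show "front out' q' (path k) (path (Suc k))"
      using fr qk by (simp add: front_def)
  qed (use w in \<open>auto simp: walk_def\<close>)
qed

end

end

end

text \<open>A list entry weighs 3 and freeing a school costs 1. The surplus of 2 pays for the pop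
  and for the iteration of \<open>walk_body\<close> that found the cycle.\<close>

lemma pot_pop:
  assumes "q b < m" "cb (q b) = b" "b \<in> Bs" "dn b = 0" "dp b \<noteq> 0"
  shows "pot (q(b := Suc (q b))) dn (dp(b := 0)) i + 2 = pot q dn dp i"
proof -
  have "{c\<in>Bs. dn c = 0 \<and> (dp(b := 0)) c = 0} = insert b {c\<in>Bs. dn c = 0 \<and> dp c = 0}"
    using assms by auto
  then have "card {c\<in>Bs. dn c = 0 \<and> (dp(b := 0)) c = 0} = Suc (card {c\<in>Bs. dn c = 0 \<and> dp c = 0})"
    using assms finite_Bs by simp
  then show ?thesis using left_Suc[of q b] assms by (simp add: pot_def)
qed

definition walk_vars :: "aname set" where
  "walk_vars = {''output'', ''place'', ''wait'', ''done'', ''path'', ''depth''}"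

definition walking :: "(nat \<Rightarrow> nat option) \<Rightarrow> store \<Rightarrow> nat \<Rightarrow> store \<Rightarrow> bool" where
  "walking N s n s' \<longleftrightarrow> input s' \<and> unchanged walk_vars s s' \<and>
     walk N (arrays s' ''output'') (arrays s' ''place'') (arrays s' ''wait'') (arrays s' ''done'')
       (arrays s' ''path'') (arrays s' ''depth'') (scalars s' ''top'') (scalars s' ''i'') \<and>
     n = pot (arrays s' ''wait'') (arrays s' ''done'') (arrays s' ''depth'') (scalars s' ''i'')"

definition cycle_found :: "store \<Rightarrow> bool" where
  "cycle_found s \<longleftrightarrow> 0 < scalars s ''top'' \<and> (\<exists>c. scalars s ''base'' = arrays s ''depth'' c \<and>
     arrays s ''depth'' c \<noteq> 0 \<and>
     front (arrays s ''output'') (arrays s ''wait'') (arrays s ''path'' (scalars s ''top'')) c)"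

text \<open>Finding a cycle leaves the potential unchanged; the pops that follow pay for that
  iteration.\<close>

lemma walk_body_correct:
  assumes l: "linked (arrays s ''link'')" and W: "walking N s n s'" and im: "scalars s' ''i'' < m"
  shows "(\<exists>n'<n. walking N s n' (outcome walk_body s') \<and> scalars (outcome walk_body s') ''base'' = 0) \<or>
    walking N s n (outcome walk_body s') \<and> cycle_found (outcome walk_body s')"
proof -
  define l where "l = arrays s ''link''"
  define out rk q dn path dp h i where "out = arrays s' ''output''" and "rk = arrays s' ''place''"
    and "q = arrays s' ''wait''" and "dn = arrays s' ''done''" and "path = arrays s' ''path''"
    and "dp = arrays s' ''depth''" and "h = scalars s' ''top''" and "i = scalars s' ''i''"
  note defs = out_def rk_def q_def dn_def path_def dp_def h_def i_def
  have in': "input s'" "unchanged walk_vars s s'" and w: "walk N out rk q dn path dp h i"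
    and n: "n = pot q dn dp i" using W by (simp_all add: walking_def defs)
  have l': "arrays s' ''link'' = l" using in'(2) by (simp add: unchanged_def walk_vars_def l_def)
  have ll: "linked l" using l by (simp add: l_def)
  note D = walkD[OF w]
  have progress: ?thesis if "walk N out2 rk2 q2 dn2 path2 dp2 h2 i2" "pot q2 dn2 dp2 i2 < pot q dn dp i"
      "outcome walk_body s' = s2" "input s2" "unchanged walk_vars s s2"
      "arrays s2 ''output'' = out2" "arrays s2 ''place'' = rk2" "arrays s2 ''wait'' = q2"
      "arrays s2 ''done'' = dn2" "arrays s2 ''path'' = path2" "arrays s2 ''depth'' = dp2"
      "scalars s2 ''top'' = h2" "scalars s2 ''i'' = i2" "scalars s2 ''base'' = 0"
    for out2 rk2 q2 dn2 path2 dp2 h2 i2 s2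
    using that n by (auto simp: walking_def)
  note bodies = walk_body_def push_def settle_top_def
  show ?thesis
  proof (cases "h = 0")
    case h0: True
    define b where "b = cb i"
    show ?thesis
    proof (cases "dn b = 0")
      case True
      have b: "b \<in> Bs" using im by (simp add: b_def Bs_def i_def)
      have "dp b = 0" using D(8)[of b] h0 by auto
      note P = walk_push[OF w b True this]
      have o: "outcome walk_body s' = s'\<lparr>scalars := (scalars s')(''base'' := 0, ''b'' := b, ''top'' := Suc h),
          arrays := (arrays s')(''path'' := path(Suc h := b), ''depth'' := dp(b := Suc h))\<rparr>"
        using in' h0 True by (auto simp: bodies input_def defs b_def)
      show ?thesis by (rule progress[OF P o]) (use in' h0 in \<open>auto simp: input_def unchanged_def walk_vars_def defs\<close>)
    next
      case False
      note P = walk_advance[OF w im[folded i_def] False[unfolded b_def]]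
      have o: "outcome walk_body s' = s'\<lparr>scalars := (scalars s')(''base'' := 0, ''b'' := b, ''i'' := Suc i)\<rparr>"
        using in' h0 False by (auto simp: bodies input_def defs b_def)
      show ?thesis by (rule progress[OF P o]) (use in' in \<open>auto simp: input_def unchanged_def walk_vars_def defs\<close>)
    qed
  next
    case False
    then have h: "0 < h" by simp
    \<comment> \<open>If \<open>a\<close> is unassigned, \<open>c\<close> is 0 by truncated
      subtraction; tests on \<open>c\<close> count only together with
      \<open>out a \<noteq> 0\<close>.\<close>
    define b j a c where "b = path h" and "j = q b" and "a = ca j" and "c = out a - 1"
    note defs' = defs b_def j_def a_def c_def
    let ?sc = "(scalars s')(''base'' := 0, ''b'' := b, ''j'' := j, ''a'' := a, ''c'' := c)"
    have settle: ?thesis if bl: "blocked I Ab (asg out) {b. dn b \<noteq> 0} b"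
      and o: "outcome walk_body s' = s'\<lparr>scalars := ?sc(''top'' := h - 1),
        arrays := (arrays s')(''done'' := dn(b := 1), ''depth'' := dp(b := 0))\<rparr>"
    proof -
      note P = walk_settle[OF w h b_def bl]
      show ?thesis by (rule progress[OF P o]) (use in' in \<open>auto simp: input_def unchanged_def walk_vars_def defs\<close>)
    qed
    have skip: ?thesis if j: "q b < m" "cb (q b) = b"
      and s: "\<not> wants I (asg out) (ca (q b)) b \<or> ca (q b) \<in> Ab \<and> settled {b. dn b \<noteq> 0} (asg out) (ca (q b))"
      and o: "outcome walk_body s' = s'\<lparr>scalars := ?sc, arrays := (arrays s')(''wait'' := q(b := Suc (q b)))\<rparr>"
    proof -
      note P = walk_skip[OF w h b_def j s]
      show ?thesis by (rule progress[OF P o]) (use in' in \<open>auto simp: input_def unchanged_def walk_vars_def defs\<close>)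
    qed
    show ?thesis
    proof (cases "j < m \<and> cb j = b")
      case False
      show ?thesis
      proof (rule settle)
        show "blocked I Ab (asg out) {b. dn b \<noteq> 0} b"
          using exhausted_blocked[OF w h b_def] False by (simp add: j_def)
        show "outcome walk_body s' = s'\<lparr>scalars := ?sc(''top'' := h - 1),
            arrays := (arrays s')(''done'' := dn(b := 1), ''depth'' := dp(b := 0))\<rparr>"
          using in' h False by (cases "j < m") (simp_all add: bodies input_def defs')
      qed
    next
      case True
      then have jb: "q b < m" "cb (q b) = b" "j < m" "cb j = b" by (auto simp: j_def)
      have wa: "wants I (asg out) a b \<longleftrightarrow> out a = 0 \<or> l j < rk a"
        using wants_asg[OF D(1) ll jb(3)] jb by (simp add: a_def)
      have a': "ca (q b) = a" by (simp add: a_def j_def)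
      show ?thesis
      proof (cases "out a \<noteq> 0 \<and> \<not> l j < rk a")
        case T: True
        show ?thesis
        proof (rule skip[OF jb(1,2)])
          show "\<not> wants I (asg out) (ca (q b)) b \<or>
              ca (q b) \<in> Ab \<and> settled {b. dn b \<noteq> 0} (asg out) (ca (q b))" using wa T a' by simp
        qed (use in' l' h True T in \<open>auto simp: bodies input_def defs'\<close>)
      next
        case F: False
        then have wab: "wants I (asg out) (ca (q b)) b" using wa a' by auto
        show ?thesis
        proof (cases "out a \<noteq> 0 \<and> dn c = 0")
          case T: True
          then have oc: "out a = Suc c" by (simp add: c_def)
          have fr: "front out q (path h) c" using jb wab oc a' by (simp add: front_def b_def)
          show ?thesis
          proof (cases "dp c = 0")
            case T2: True
            have "(a, c) \<in> edges I" using placed_edge[OF D(1) oc] .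
            then obtain k where "k < m" "cb k = c" by (rule school_index_ex)
            then have cB: "c \<in> Bs" by (auto simp: Bs_def)
            have "dn c = 0" using T by simp
            note P = walk_push[OF w cB this T2 fr]
            have o: "outcome walk_body s' = s'\<lparr>scalars := ?sc(''top'' := Suc h),
                arrays := (arrays s')(''path'' := path(Suc h := c), ''depth'' := dp(c := Suc h))\<rparr>"
              using in' l' h True F T T2 by (auto simp: bodies input_def defs')
            show ?thesis by (rule progress[OF P o]) (use in' in \<open>auto simp: input_def unchanged_def walk_vars_def defs\<close>)
          next
            case F2: False
            have o: "outcome walk_body s' = s'\<lparr>scalars := ?sc(''base'' := dp c)\<rparr>"
              using in' l' h True F T F2 by (auto simp: bodies input_def defs')
            have "walking N s (pot q dn dp i) (outcome walk_body s')"
              using in' w unfolding o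
              by (auto simp: walking_def input_def unchanged_def walk_vars_def defs)
            moreover have "cycle_found (outcome walk_body s')"
              unfolding o cycle_found_def using h fr F2 by (auto simp: defs intro!: exI[of _ c])
            ultimately show ?thesis using n by simp
          qed
        next
          case F2: False
          then have st: "settled {b. dn b \<noteq> 0} (asg out) (ca (q b))"
            by (auto simp: settled_def asg_Some c_def a')
          show ?thesis
          proof (cases "a \<in> Ab")
            case T3: True
            show ?thesis
            proof (rule skip[OF jb(1,2)])
              show "\<not> wants I (asg out) (ca (q b)) b \<or>
                  ca (q b) \<in> Ab \<and> settled {b. dn b \<noteq> 0} (asg out) (ca (q b))" using st T3 a' by simp
              have "co a \<noteq> 0" using T3 by (simp add: consent_array)
              then show "outcome walk_body s' = s'\<lparr>scalars := ?sc, arrays := (arrays s')(''wait'' := q(b := Suc (q b)))\<rparr>"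
                using in' l' h True F F2 by (auto simp: bodies input_def defs')
            qed
          next
            case F3: False
            show ?thesis
            proof (rule settle)
              show "blocked I Ab (asg out) {b. dn b \<noteq> 0} b"
                using objection_blocked[OF w h b_def jb(1,2) wab st] F3 a' by simp
              have "co a = 0" using F3 by (simp add: consent_array)
              then show "outcome walk_body s' = s'\<lparr>scalars := ?sc(''top'' := h - 1),
                  arrays := (arrays s')(''done'' := dn(b := 1), ''depth'' := dp(b := 0))\<rparr>"
                using in' l' h True F F2 by (auto simp: bodies input_def defs')
            qed
          qed
        qed
      qed
    qed
  qed
qed

end

section \<open>The whole program and its running time\<close>

definition eadam_code :: com where
  "eadam_code = start_program ;; bucket_program ;; link_program ;; offer_program ;; trade_program"

context encoding
begin

text \<open>While the cycle is popped, the assignment need not be a state of the process, since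
  \<open>R t\<close> is only a part of the cycle; \<open>walk\<close> is restored at the end. Each
  pop still finds the right student because it reads the untouched cursor of its school and not the
  assignments changed so far.\<close>

lemma pop_correct:
  assumes link: "linked (arrays s ''link'')" and W: "walking N s n s0" and cf: "cycle_found s0"
  obtains n' k where "n' + 2 * k = n" "0 < k"
    "runs (While pop_guard pop_body) s0 (60 * k + 1 + bcost pop_guard) (walking N s n')"
proof -
  define l where "l = arrays s ''link''"
  have l: "linked l" using link by (simp add: l_def)
  define out rk q dn path dp h i where "out = arrays s0 ''output''" and "rk = arrays s0 ''place''"
    and "q = arrays s0 ''wait''" and "dn = arrays s0 ''done''" and "path = arrays s0 ''path''"
    and "dp = arrays s0 ''depth''" and "h = scalars s0 ''top''" and "i = scalars s0 ''i''"
  note defs = out_def rk_def q_def dn_def path_def dp_def h_def i_def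
  have w: "walk N out rk q dn path dp h i" and n: "n = pot q dn dp i"
    and in0: "input s0" "unchanged walk_vars s s0"
    using W by (simp_all add: walking_def defs)
  obtain c where c: "0 < h" "scalars s0 ''base'' = dp c" "dp c \<noteq> 0" "front out q (path h) c"
    using cf by (auto simp: cycle_found_def defs)
  define k0 where "k0 = dp c"
  define d where "d = (\<lambda>b. ca (q b))"
  note D = walkD[OF w]
  have kh: "k0 \<le> h" "0 < k0" using D(8)[of c] c by (auto simp: k0_def)
  have k0': "k0 \<noteq> 0" using kh by simp
  have tr: "finite (path ` {k0..h})" "\<And>b. b \<in> path ` {k0..h} \<Longrightarrow> pick I Ab (asg out) {b. dn b \<noteq> 0} b (d b)"
    "(\<lambda>b. asg out (d b)) ` (path ` {k0..h}) = Some ` (path ` {k0..h})"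
    unfolding d_def by (rule cycle_trade[OF w c(1) refl c(4) k0_def k0']; assumption)+
  have inj: "inj_on d (path ` {k0..h})" by (rule trade_inj_d[OF tr])
  define R where "R t = path ` {t<..h}" for t
  define Inv where "Inv r s' \<longleftrightarrow> input s' \<and> unchanged walk_vars s s' \<and> scalars s' ''base'' = k0 \<and>
    scalars s' ''i'' = i \<and> arrays s' ''path'' = path \<and> arrays s' ''done'' = dn \<and>
    scalars s' ''top'' \<le> h \<and> k0 \<le> Suc (scalars s' ''top'') \<and> r = Suc (scalars s' ''top'') - k0 \<and>
    asg (arrays s' ''output'') = exchange (asg out) (R (scalars s' ''top'')) d \<and>
    placed (arrays s' ''output'') (arrays s' ''place'') \<and>
    arrays s' ''wait'' = (\<lambda>b. if b \<in> R (scalars s' ''top'') then Suc (q b) else q b) \<and>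
    arrays s' ''depth'' = (\<lambda>b. if b \<in> R (scalars s' ''top'') then 0 else dp b) \<and>
    pot (arrays s' ''wait'') dn (arrays s' ''depth'') i + 2 * (h - scalars s' ''top'') = n" for r s'
  have "Inv (Suc h - k0) s0"
    unfolding Inv_def using in0 kh c n D(1) by (auto simp: R_def defs k0_def exchange_def)
  then have "runs (While pop_guard pop_body) s0 (60 * (Suc h - k0) + 1 + bcost pop_guard)
      (\<lambda>s. \<not> bval pop_guard s \<and> (\<exists>n. Inv n s))"
  proof (rule runs_While_loop_free[rotated 3])
    fix r s' assume I: "Inv r s'" and B: "bval pop_guard s'"
    define t b out' rk' q' dp' where "t = scalars s' ''top''" and "b = path t" and "out' = arrays s' ''output''"
      and "rk' = arrays s' ''place''" and "q' = arrays s' ''wait''" and "dp' = arrays s' ''depth''"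
    note defs' = t_def out'_def rk'_def q'_def dp'_def
    have I': "input s'" "unchanged walk_vars s s'" "scalars s' ''base'' = k0" "scalars s' ''i'' = i"
      "arrays s' ''path'' = path" "arrays s' ''done'' = dn" "t \<le> h" "r = Suc t - k0"
      and out': "asg out' = exchange (asg out) (R t) d" and pl: "placed out' rk'"
      and q': "q' = (\<lambda>b. if b \<in> R t then Suc (q b) else q b)"
      and dp': "dp' = (\<lambda>b. if b \<in> R t then 0 else dp b)"
      and pt: "pot q' dn dp' i + 2 * (h - t) = n"
      using I unfolding Inv_def defs' by blast+
    have kt: "k0 \<le> t" using B I'(3) kh by (simp add: pop_guard_def t_def)
    have l': "arrays s' ''link'' = l" using I'(2) by (simp add: unchanged_def walk_vars_def l_def)
    have R: "R (t - 1) = insert b (R t)"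
    proof -
      have "{t - 1<..h} = insert t {t<..h}" using kt kh I'(7) by auto
      then show ?thesis by (simp add: R_def b_def)
    qed
    have bR: "b \<notin> R t"
    proof
      assume "b \<in> R t"
      then obtain k where "t < k" "k \<le> h" "path t = path k" by (auto simp: R_def b_def)
      then show False using D(5)[of k] D(5)[of t] kt kh I'(7) by simp
    qed
    have sub: "insert b (R t) \<subseteq> path ` {k0..h}" using kt I'(7) by (auto simp: R_def b_def)
    have fr: "q b < m" "cb (q b) = b"
      using cycle_succ[OF w c(1) refl c(4) k0_def k0' kt I'(7)] by (auto simp: front_def b_def)
    have qb: "q' b = q b" and dpb: "dp' b = dp b" using bR by (simp_all add: q' dp')
    have bb: "b \<in> Bs" "dn b = 0" "dp b \<noteq> 0" using D(5-7)[of t] kt kh I'(7) by (auto simp: b_def)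
    let ?a = "ca (q b)"
    have 1: "asg (out'(?a := Suc b)) = exchange (asg out) (R (t - 1)) d"
      using exchange_insert[OF inj_on_subset[OF inj sub] bR, of "asg out"]
      unfolding R asg_upd out' by (simp add: d_def)
    have 2: "placed (out'(?a := Suc b)) (rk'(?a := l (q b)))"
      using placed_upd[OF pl l fr(1)] fr by simp
    have 3: "q'(b := Suc (q b)) = (\<lambda>b. if b \<in> R (t - 1) then Suc (q b) else q b)"
      using R by (auto simp: q')
    have 4: "dp'(b := 0) = (\<lambda>b. if b \<in> R (t - 1) then 0 else dp b)" using R by (auto simp: dp')
    have 5: "pot (q'(b := Suc (q b))) dn (dp'(b := 0)) i + 2 = pot q' dn dp' i"
      using pot_pop[of q' b dn dp' i] qb dpb fr bb by simp
    have o: "outcome pop_body s' = s'\<lparr>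
        scalars := (scalars s')(''b'' := b, ''j'' := q b, ''a'' := ?a, ''top'' := t - 1),
        arrays := (arrays s')(''output'' := out'(?a := Suc b), ''place'' := rk'(?a := l (q b)),
          ''wait'' := q'(b := Suc (q b)), ''depth'' := dp'(b := 0))\<rparr>"
      using I'(1,5) l' qb by (simp add: pop_body_def input_def defs' b_def)
    define s2 where "s2 = outcome pop_body s'"
    have f: "scalars s2 ''top'' = t - 1" "arrays s2 ''output'' = out'(?a := Suc b)"
      "arrays s2 ''place'' = rk'(?a := l (q b))" "arrays s2 ''wait'' = q'(b := Suc (q b))"
      "arrays s2 ''depth'' = dp'(b := 0)" "scalars s2 ''base'' = k0" "scalars s2 ''i'' = i"
      "arrays s2 ''path'' = path" "arrays s2 ''done'' = dn"
      using I'(3-6) by (simp_all add: s2_def o)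
    have "Inv (Suc (t - 1) - k0) s2"
      unfolding Inv_def f
    proof (intro conjI)
      show "input s2" using I'(1) by (simp add: s2_def o input_def)
      show "unchanged walk_vars s s2" using I'(2) by (auto simp: s2_def o unchanged_def walk_vars_def)
      have "h - (t - 1) = Suc (h - t)" using kt kh I'(7) by simp
      then show "pot (q'(b := Suc (q b))) dn (dp'(b := 0)) i + 2 * (h - (t - 1)) = n"
        using 5 pt by simp
    qed (use 1 2 3 4 kt kh I'(7) in simp_all)
    then have "Inv (Suc (t - 1) - k0) (outcome pop_body s')" by (simp add: s2_def)
    then show "\<exists>n'<r. Inv n' (outcome pop_body s')"
      using I'(8) kt kh by (intro exI[of _ "Suc (t - 1) - k0"]) auto
  qed (auto simp: pop_body_def pop_guard_def)
  then have "runs (While pop_guard pop_body) s0 (60 * (Suc h - k0) + 1 + bcost pop_guard)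
      (\<lambda>s'. walking N s (n - 2 * (Suc h - k0)) s' \<and> 2 * (Suc h - k0) \<le> n)"
  proof (rule runs_mono)
    fix s' assume s': "\<not> bval pop_guard s' \<and> (\<exists>n. Inv n s')"
    then have t: "scalars s' ''top'' = k0 - 1" using kh by (auto simp: Inv_def pop_guard_def)
    have R: "R (k0 - 1) = path ` {k0..h}"
    proof -
      have "{k0 - 1<..h} = {k0..h}" using kh by auto
      then show ?thesis by (simp add: R_def)
    qed
    have I: "input s'" "unchanged walk_vars s s'" "scalars s' ''i'' = i" "arrays s' ''path'' = path" "arrays s' ''done'' = dn"
      "asg (arrays s' ''output'') = exchange (asg out) (path ` {k0..h}) d"
      "placed (arrays s' ''output'') (arrays s' ''place'')"
      "arrays s' ''wait'' = (\<lambda>b. if b \<in> path ` {k0..h} then Suc (q b) else q b)"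
      "arrays s' ''depth'' = (\<lambda>b. if b \<in> path ` {k0..h} then 0 else dp b)"
      "pot (arrays s' ''wait'') dn (arrays s' ''depth'') i + 2 * (h - (k0 - 1)) = n"
      using s' t R by (auto simp: Inv_def)
    have "walk N (arrays s' ''output'') (arrays s' ''place'') (arrays s' ''wait'') dn path (arrays s' ''depth'') (k0 - 1) i"
      by (rule walk_trade[OF w c(1) refl c(4) k0_def k0']) (use I(6-9) in \<open>simp_all add: d_def\<close>)
    then show "walking N s (n - 2 * (Suc h - k0)) s' \<and> 2 * (Suc h - k0) \<le> n"
      unfolding walking_def using I t kh by auto
  qed simp
  then have "2 * (Suc h - k0) \<le> n"
    "runs (While pop_guard pop_body) s0 (60 * (Suc h - k0) + 1 + bcost pop_guard) (walking N s (n - 2 * (Suc h - k0)))"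
    by (auto simp: runs_def)
  then show thesis using kh by (intro that[of "n - 2 * (Suc h - k0)" "Suc h - k0"]) auto
qed

lemma trade_correct:
  assumes in_s: "input s" and l: "linked (arrays s ''link'')" and q: "at_start (arrays s ''wait'')"
    and pl: "placed (arrays s ''output'') (arrays s ''place'')" and st: "stable I (asg (arrays s ''output''))"
    and zero: "arrays s ''done'' = (\<lambda>_. 0)" "arrays s ''depth'' = (\<lambda>_. 0)"
  shows "runs trade_program s (2100 * m + 20)
    (\<lambda>s'. eadam Ab I {(a, b). asg (arrays s' ''output'') a = Some b})"
proof -
  define N where "N = asg (arrays s ''output'')"
  let ?B = "Less (Var ''i'') (Var ''edges'')" and ?c = "walk_body ;; While pop_guard pop_body"
  let ?Q = "\<lambda>s'. \<not> bval ?B s' \<and> (\<exists>n. walking N s n s')"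
  \<comment> \<open>By \<open>pot_le\<close> there are at most \<open>7 * m\<close> units of
    potential, with 300 time units for each.\<close>
  have "runs trade_program s (4 + (300 * (7 * m) + 1 + bcost ?B)) ?Q"
    unfolding trade_program_def
  proof (rule runs_Seq)
    let ?n = "pot (arrays s ''wait'') (\<lambda>_. 0) (\<lambda>_. 0) 0"
    have "walking N s ?n (outcome (Assign ''i'' (Const 0) ;; Assign ''top'' (Const 0)) s)"
      using in_s q pl zero
      by (auto simp: walking_def input_def unchanged_def walk_def at_start_def N_def leD)
    then show "runs (Assign ''i'' (Const 0) ;; Assign ''top'' (Const 0)) s 4 (walking N s ?n)"
      by (rule runs_loop_free[rotated]) auto
    fix s' assume "walking N s ?n s'"
    then have "runs (While ?B ?c) s' (300 * ?n + 1 + bcost ?B)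
      ?Q"
    proof (rule runs_While[rotated])
      fix n s' assume W: "walking N s n s'" and B: "bval ?B s'"
      have im: "scalars s' ''i'' < m" using W B by (simp add: walking_def input_def)
      define s1 where "s1 = outcome walk_body s'"
      \<comment> \<open>150 bounds \<open>cost walk_body\<close>. With 60 per pop and 10 for the
        last test of \<open>pop_guard\<close>, even a cycle of length one fits into its two units of
        potential.\<close>
      have r1: "runs walk_body s' 150 (\<lambda>s2. s2 = s1)"
        by (rule runs_loop_free) (auto simp: walk_body_def push_def settle_top_def s1_def)
      have c1: "bcost pop_guard = 9" by (simp add: pop_guard_def)
      have c2: "bcost ?B = 3" by simp
      show "\<exists>n'<n. runs ?c s' (300 * (n - n') - (1 + bcost ?B))
          (walking N s n') \<and> 1 + bcost ?B \<le> 300 * (n - n')"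
      proof (cases "walking N s n s1 \<and> cycle_found s1")
        case True
        then obtain n' k where n': "n' + 2 * k = n" "0 < k"
          "runs (While pop_guard pop_body) s1 (60 * k + 1 + bcost pop_guard) (walking N s n')"
          using pop_correct[OF l] by blast
        have "runs ?c s' (150 + (60 * k + 1 + bcost pop_guard)) (walking N s n')"
          by (rule runs_Seq[OF r1]) (use n' in simp)
        then have "runs ?c s' (300 * (n - n') - (1 + bcost ?B)) (walking N s n')"
          by (rule runs_mono) (use n' c1 c2 in linarith)+
        then show ?thesis using n' c2 by (intro exI[of _ n']) auto
      next
        case False
        then obtain n' where n': "n' < n" "walking N s n' s1" "scalars s1 ''base'' = 0"
          using walk_body_correct[OF l W im] by (auto simp: s1_def)
        have "runs (While pop_guard pop_body) s1 (1 + bcost pop_guard) (walking N s n')"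
          unfolding runs_def using exec.While_False[of pop_guard s1 pop_body] n' by (auto simp: pop_guard_def)
        then have "runs ?c s' (150 + (1 + bcost pop_guard)) (walking N s n')"
          by (intro runs_Seq[OF r1]) simp
        then have "runs ?c s' (300 * (n - n') - (1 + bcost ?B)) (walking N s n')"
          by (rule runs_mono) (use n' c1 c2 in linarith)+
        then show ?thesis using n' c2 by (intro exI[of _ n']) auto
      qed
    qed
    then show "runs (While ?B ?c) s' (300 * (7 * m) + 1 + bcost ?B)
      ?Q"
      by (rule runs_mono) (use pot_le[of "arrays s ''wait''" "\<lambda>_. 0" "\<lambda>_. 0" 0] in auto)
  qed
  then show ?thesis
  proof (rule runs_mono)
    fix s' assume s': "\<not> bval ?B s' \<and> (\<exists>n. walking N s n s')"
    let ?X = "{b. arrays s' ''done'' b \<noteq> 0}"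
    have run: "(step I Ab)\<^sup>*\<^sup>* (N, {}) (asg (arrays s' ''output''), ?X)"
      and d: "\<And>j. j < scalars s' ''i'' \<Longrightarrow> cb j \<in> ?X" and i: "scalars s' ''i'' \<ge> m"
      using s' by (auto simp: walking_def walk_def input_def)
    have "snd ` edges I \<subseteq> ?X"
    proof
      fix b assume "b \<in> snd ` edges I"
      then obtain a where "(a, b) \<in> edges I" by auto
      then obtain j where "j < m" "cb j = b" by (rule school_index_ex)
      then show "b \<in> ?X" using d[of j] i by simp
    qed
    then show "eadam Ab I {(a, b). asg (arrays s' ''output'') a = Some b}"
      using eadam_of_settled[OF inst _ run] st by (simp add: N_def)
  qed simp
qed

lemma eadam_code_correct:
  assumes in_s: "input s" and zero: "\<And>X. X \<in> {''head'', ''output'', ''count'', ''done'', ''depth''} \<Longrightarrow>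
      arrays s X = (\<lambda>_. 0)"
  shows "runs eadam_code s (3000 * m + 3000) (\<lambda>s'. eadam Ab I {(a, b). arrays s' ''output'' a = Suc b})"
proof -
  define Q where "Q = (\<lambda>s' :: store. eadam Ab I {(a, b). asg (arrays s' ''output'') a = Some b})"
  have "runs eadam_code s ((20 * m + 20) + ((20 * m + 20) + ((100 * m + 20) + ((300 * m + 100) + (2100 * m + 20)))))
      Q"
    unfolding eadam_code_def
  proof (rule runs_Seq[OF start_correct[OF in_s]], elim conjE)
    fix s1 assume 1: "input s1" "at_start (arrays s1 ''offer'')" "at_start (arrays s1 ''wait'')"
      "unchanged {''offer'', ''wait''} s s1"
    have "arrays s1 ''head'' = (\<lambda>_. 0)" using 1(4) zero by (simp add: unchanged_def)
    from bucket_correct[OF 1(1) this]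
    show "runs (bucket_program ;; link_program ;; offer_program ;; trade_program) s1
      ((20 * m + 20) + ((100 * m + 20) + ((300 * m + 100) + (2100 * m + 20))))
      Q"
    proof (rule runs_Seq, elim conjE exE)
      fix s2 L assume 2: "input s2" "unchanged {''head'', ''next''} s1 s2"
        "\<forall>b. chain (arrays s2 ''next'') (L b) (arrays s2 ''head'' b) \<and> distinct (L b) \<and> set (L b) = {i. i < m \<and> sb i = b}"
      have "runs link_program s2 (100 * m + 20) (\<lambda>s'. input s' \<and>
          unchanged {''head'', ''slot'', ''link''} s2 s' \<and> linked (arrays s' ''link''))"
        by (rule link_correct[OF 2(1), of L]) (use 2(3) in auto)
      then show "runs (link_program ;; offer_program ;; trade_program) s2
        ((100 * m + 20) + ((300 * m + 100) + (2100 * m + 20)))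
        Q"
      proof (rule runs_Seq, elim conjE)
        fix s3 assume 3: "input s3" "unchanged {''head'', ''slot'', ''link''} s2 s3" "linked (arrays s3 ''link'')"
        have z3: "at_start (arrays s3 ''offer'')" "arrays s3 ''output'' = (\<lambda>_. 0)" "arrays s3 ''count'' = (\<lambda>_. 0)"
          using 1 2(2) 3(2) zero by (simp_all add: unchanged_def)
        from offer_correct[OF 3(1,3) z3]
        show "runs (offer_program ;; trade_program) s3 ((300 * m + 100) + (2100 * m + 20))
          Q"
        proof (rule runs_Seq, elim conjE)
          fix s4 assume 4: "input s4" "unchanged {''stack'', ''offer'', ''output'', ''place'', ''count''} s3 s4"
            "placed (arrays s4 ''output'') (arrays s4 ''place'')" "stable I (asg (arrays s4 ''output''))"
          have "linked (arrays s4 ''link'')" "at_start (arrays s4 ''wait'')"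
            "arrays s4 ''done'' = (\<lambda>_. 0)" "arrays s4 ''depth'' = (\<lambda>_. 0)"
            using 1 2(2) 3 4(2) zero by (simp_all add: unchanged_def)
          then show "runs trade_program s4 (2100 * m + 20)
            Q"
            using trade_correct 4 unfolding Q_def by blast
        qed
      qed
    qed
  qed
  then show ?thesis by (rule runs_mono) (simp_all add: Q_def asg_Some)
qed

end

section \<open>The preference lists in memory\<close>

text \<open>The definite description in \<open>pref_list\<close> needs existence, by splitting off
  the top element, and uniqueness, because two sorted lists of the same set begin with the same
  element.\<close>

lemma pref_list_spec:
  fixes r :: "('v \<times> 'v) set"
  assumes "finite A" "trans r" "irrefl r" "total_on A r"
  shows "set (pref_list r A) = A" "sorted_wrt (\<lambda>x y. (y, x) \<in> r) (pref_list r A)"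
proof -
  let ?P = "\<lambda>xs. sorted_wrt (\<lambda>x y. (y, x) \<in> r) xs"
  have ex: "\<exists>xs. set xs = A \<and> ?P xs"
    using assms(1,4)
  proof (induction "card A" arbitrary: A)
    case 0
    then show ?case by (intro exI[of _ "[]"]) simp
  next
    case (Suc k)
    then have "A \<noteq> {}" by auto
    then obtain x where x: "x \<in> A" "\<And>y. y \<in> A \<Longrightarrow> y \<noteq> x \<Longrightarrow> (y, x) \<in> r"
      using linear_order_has_top[OF Suc.prems(1) _ assms(2,3) Suc.prems(2)] by blast
    have "\<exists>xs. set xs = A - {x} \<and> ?P xs"
      by (rule Suc.hyps(1)) (use Suc.hyps(2) Suc.prems x in \<open>auto simp: total_on_def\<close>)
    then obtain xs where "set xs = A - {x}" "?P xs" by blast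
    then show ?case using x by (intro exI[of _ "x # xs"]) auto
  qed
  have un: "xs = ys" if "?P xs" "?P ys" "set xs = set ys" for xs ys
    using that
  proof (induction xs arbitrary: ys)
    case (Cons x xs)
    then obtain y ys' where ys: "ys = y # ys'" by (cases ys) auto
    have ir: "(z, z) \<notin> r" for z using assms(3) by (simp add: irrefl_def)
    have "x = y"
    proof (rule ccontr)
      assume "x \<noteq> y"
      then have "x \<in> set ys'" "y \<in> set xs" using Cons.prems(3) ys by auto
      then have "(x, y) \<in> r" "(y, x) \<in> r" using Cons.prems(1,2) ys by auto
      then show False using assms(2) ir transD by metis
    qed
    moreover have "x \<notin> set xs" "y \<notin> set ys'" using Cons.prems(1,2) ys ir by auto
    ultimately have "set xs = set ys'" using Cons.prems(3) ys by auto
    then show ?case using Cons.IH[of ys'] Cons.prems(1,2) ys \<open>x = y\<close> by simp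
  qed simp
  have "set (pref_list r A) = A \<and> ?P (pref_list r A)"
    unfolding pref_list_def by (rule theI') (use ex un in blast)
  then show "set (pref_list r A) = A" "?P (pref_list r A)" by auto
qed

text \<open>The common form of both inputs; the lists of the schools fit it after swapping the
  components of each pair.\<close>

definition blocks :: "('k \<Rightarrow> 'v list) \<Rightarrow> 'k list \<Rightarrow> ('k \<times> 'v) list" where
  "blocks f ks = concat (map (\<lambda>k. map (Pair k) (f k)) ks)"

lemma blocks_Cons: "blocks f (k # ks) = map (Pair k) (f k) @ blocks f ks"
  by (simp add: blocks_def)

lemma set_blocks: "set (blocks f ks) = (SIGMA k:set ks. set (f k))"
  by (auto simp: blocks_def)

lemma blocks_sorted:
  assumes "distinct ks" "\<And>k. k \<in> set ks \<Longrightarrow> sorted_wrt (R k) (f k)"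
  shows "sorted_wrt (\<lambda>p p'. fst p = fst p' \<longrightarrow> R (fst p) (snd p) (snd p')) (blocks f ks)"
  using assms
  by (induction ks) (auto simp: blocks_def blocks_Cons sorted_wrt_append sorted_wrt_map)

lemma blocks_contiguous:
  assumes "distinct ks" "i \<le> j" "j \<le> l" "l < length (blocks f ks)" "fst (blocks f ks ! i) = fst (blocks f ks ! l)"
  shows "fst (blocks f ks ! j) = fst (blocks f ks ! l)"
  using assms
proof (induction ks arbitrary: i j l)
  case (Cons k ks)
  let ?n = "length (f k)"
  have lo: "fst (blocks f (k # ks) ! x) = k" if "x < ?n" for x
    using that by (simp add: blocks_Cons nth_append)
  have hi: "blocks f (k # ks) ! x = blocks f ks ! (x - ?n)" if "?n \<le> x" for x
    using that by (simp add: blocks_Cons nth_append)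
  have len: "length (blocks f (k # ks)) = ?n + length (blocks f ks)" by (simp add: blocks_Cons)
  show ?case
  proof (cases "l < ?n")
    case True
    then show ?thesis using lo Cons.prems by simp
  next
    case False
    then have ln: "l - ?n < length (blocks f ks)" using Cons.prems(4) len by simp
    \<comment> \<open>Otherwise the key \<open>k\<close> would return in a later block, against
      distinctness of the keys.\<close>
    have "?n \<le> i"
    proof (rule ccontr)
      assume "\<not> ?n \<le> i"
      then have "fst (blocks f ks ! (l - ?n)) = k" using lo[of i] hi[of l] False Cons.prems(5) by simp
      moreover have "fst (blocks f ks ! (l - ?n)) \<in> set ks"
        using nth_mem[OF ln] by (auto simp: set_blocks)
      ultimately show False using Cons.prems(1) by simp
    qed
    then show ?thesis
      using Cons.IH[of "i - ?n" "j - ?n" "l - ?n"] hi[of i] hi[of j] hi[of l] ln Cons.prems by simp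
  qed
qed (simp add: blocks_def)

lemma sorted_wrt_irrefl_distinct:
  "sorted_wrt R xs \<Longrightarrow> (\<And>x. x \<in> set xs \<Longrightarrow> \<not> R x x) \<Longrightarrow> distinct xs"
  by (induction xs) auto

lemma initial_encoding:
  fixes I :: "(nat, nat) assignment_instance"
  assumes I: "stable_assignment_instance I" and as: "distinct as" "set as = students I"
    and bs: "distinct bs" "set bs = schools I"
  defines "L \<equiv> student_lists I as" and "K \<equiv> school_lists I bs"
  shows "encoding I Ab (card (edges I)) (array_of_list (map fst L)) (array_of_list (map snd L))
    (array_of_list (map fst K)) (array_of_list (map snd K))
    (\<lambda>b. if b \<in> schools I then quota I b else 0) (\<lambda>a. if a \<in> Ab then 1 else 0)"
proof -
  interpret assignment_problem I by unfold_locales (rule I)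
  let ?f = "\<lambda>a. pref_list (student_pref I a) (student_nbrs I a)"
  let ?g = "\<lambda>b. pref_list (school_pref I b) (school_nbrs I b)"
  have ends: "edges I \<subseteq> students I \<times> schools I" using I by (simp add: stable_assignment_instance_def)
  have f: "set (?f a) = student_nbrs I a" "sorted_wrt (\<lambda>x y. (y, x) \<in> student_pref I a) (?f a)"
    if "a \<in> students I" for a
  proof -
    have "finite (student_nbrs I a)"
      by (rule finite_subset[of _ "snd ` edges I"]) (use finite_edges in \<open>force simp: student_nbrs_def\<close>)+
    moreover have "trans (student_pref I a)" "irrefl (student_pref I a)" "total_on (student_nbrs I a) (student_pref I a)"
      using I that by (auto simp: stable_assignment_instance_def strict_linear_order_on_def)
    ultimately show "set (?f a) = student_nbrs I a" "sorted_wrt (\<lambda>x y. (y, x) \<in> student_pref I a) (?f a)"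
      by (rule pref_list_spec)+
  qed
  have g: "set (?g b) = school_nbrs I b" "sorted_wrt (\<lambda>x y. (y, x) \<in> school_pref I b) (?g b)"
    if "b \<in> schools I" for b
  proof -
    have "finite (school_nbrs I b)" using finite_held(1) by (simp add: school_nbrs_def)
    moreover have "trans (school_pref I b)" "irrefl (school_pref I b)" "total_on (school_nbrs I b) (school_pref I b)"
      using I that by (auto simp: stable_assignment_instance_def strict_linear_order_on_def)
    ultimately show "set (?g b) = school_nbrs I b" "sorted_wrt (\<lambda>x y. (y, x) \<in> school_pref I b) (?g b)"
      by (rule pref_list_spec)+
  qed
  have L: "L = blocks ?f as" by (simp add: L_def student_lists_def blocks_def)
  define K' where "K' = blocks ?g bs"
  have K: "K = map prod.swap K'"
    by (simp add: K_def K'_def school_lists_def blocks_def map_concat comp_def)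
  have setL: "set L = edges I"
    using ends as f(1) by (auto simp: L set_blocks student_nbrs_def)
  have setK': "set K' = {(b, a). (a, b) \<in> edges I}"
    using ends bs g(1) by (auto simp: K'_def set_blocks school_nbrs_def)
  have setK: "set K = edges I" by (force simp: K setK')
  have sL: "sorted_wrt (\<lambda>p p'. fst p = fst p' \<longrightarrow> (snd p', snd p) \<in> student_pref I (fst p)) L"
    unfolding L by (rule blocks_sorted) (use as f(2) in auto)
  have sK: "sorted_wrt (\<lambda>p p'. fst p = fst p' \<longrightarrow> (snd p', snd p) \<in> school_pref I (fst p)) K'"
    unfolding K'_def by (rule blocks_sorted) (use bs g(2) in auto)
  have dL: "distinct L"
    by (rule sorted_wrt_irrefl_distinct[OF sL]) (use setL student_pref_linear(4) in auto)
  have dK': "distinct K'"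
    by (rule sorted_wrt_irrefl_distinct[OF sK]) (use setK' school_pref_linear(4) in auto)
  have dK: "distinct K" using dK' by (simp add: K distinct_map)
  have lenL: "length L = card (edges I)" using distinct_card[OF dL] setL by simp
  have lenK: "length K = card (edges I)" using distinct_card[OF dK] setK by simp
  have lenK': "length K' = card (edges I)" using lenK by (simp add: K)
  have nL: "array_of_list (map fst L) i = fst (L ! i)" "array_of_list (map snd L) i = snd (L ! i)"
    if "i < card (edges I)" for i using that lenL by (simp_all add: array_of_list_def)
  have nK: "array_of_list (map fst K) i = snd (K' ! i)" "array_of_list (map snd K) i = fst (K' ! i)"
    "K ! i = (snd (K' ! i), fst (K' ! i))"
    if "i < card (edges I)" for i using that lenK' by (simp_all add: array_of_list_def K prod.swap_def)
  show ?thesis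
  proof (unfold_locales, goal_cases)
    case 1
    have "bij_betw (\<lambda>i. L ! i) {..<card (edges I)} (edges I)"
      by (rule bij_betw_nth) (use dL lenL setL in auto)
    then show ?case by (rule bij_betw_cong[THEN iffD1, rotated]) (simp add: nL)
  next
    case 2
    have "bij_betw (\<lambda>i. K ! i) {..<card (edges I)} (edges I)"
      by (rule bij_betw_nth) (use dK lenK setK in auto)
    then show ?case by (rule bij_betw_cong[THEN iffD1, rotated]) (simp add: nK)
  next
    case (3 i i')
    then show ?case using sorted_wrt_nth_less[OF sL, of i i'] lenL by (simp add: nL)
  next
    case (4 j j')
    then show ?case using sorted_wrt_nth_less[OF sK, of j j'] lenK' by (simp add: nK)
  next
    case (5 j k l)
    then show ?case
      using blocks_contiguous[OF bs(1), of j k l ?g] lenK' by (simp add: nK K'_def[symmetric])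
  qed auto
qed

theorem theorem8:
  "\<exists>(eadam_program :: com) (T :: nat \<Rightarrow> nat).
     (\<lambda>m. real (T m)) \<in> O(\<lambda>m. real m) \<and>
     (\<forall>(I :: (nat, nat) assignment_instance) (Abar :: nat set) (as :: nat list) (bs :: nat list).
        stable_assignment_instance I \<longrightarrow> Abar \<subseteq> students I \<longrightarrow>
        distinct as \<longrightarrow> set as = students I \<longrightarrow> distinct bs \<longrightarrow> set bs = schools I \<longrightarrow>
        (\<exists>t s M. exec eadam_program (initial_store I Abar as bs) t s \<and>
           t \<le> T (card (edges I)) \<and> eadam Abar I M \<and> outputs s M))"
proof (rule exI[of _ eadam_code], rule exI[of _ "\<lambda>m. 3000 * m + 3000"], intro conjI allI impI)
  show "(\<lambda>m. real (3000 * m + 3000)) \<in> O(\<lambda>m. real m)"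
    \<comment> \<open>The constant 6000 absorbs the additive 3000 as soon as \<open>m\<close> is at
      least 1.\<close>
    by (rule bigoI[where c = 6000], rule eventually_mono[OF eventually_ge_at_top[of 1]]) simp
  fix I :: "(nat, nat) assignment_instance" and Abar :: "nat set" and as bs :: "nat list"
  assume I: "stable_assignment_instance I" and "Abar \<subseteq> students I"
    and as: "distinct as" "set as = students I" and bs: "distinct bs" "set bs = schools I"
  interpret encoding I Abar "card (edges I)"
    "array_of_list (map fst (student_lists I as))" "array_of_list (map snd (student_lists I as))"
    "array_of_list (map fst (school_lists I bs))" "array_of_list (map snd (school_lists I bs))"
    "\<lambda>b. if b \<in> schools I then quota I b else 0" "\<lambda>a. if a \<in> Abar then 1 else 0"
    by (rule initial_encoding[OF I as bs])
  have "input (initial_store I Abar as bs)" by (simp add: input_def initial_store_def)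
  then have "runs eadam_code (initial_store I Abar as bs) (3000 * card (edges I) + 3000)
      (\<lambda>s'. eadam Abar I {(a, b). arrays s' ''output'' a = Suc b})"
    by (rule eadam_code_correct) (auto simp: initial_store_def)
  then obtain t s where "exec eadam_code (initial_store I Abar as bs) t s" "t \<le> 3000 * card (edges I) + 3000"
    "eadam Abar I {(a, b). arrays s ''output'' a = Suc b}" by (auto simp: runs_def)
  then show "\<exists>t s M. exec eadam_code (initial_store I Abar as bs) t s \<and>
      t \<le> 3000 * card (edges I) + 3000 \<and> eadam Abar I M \<and> outputs s M"
    by (intro exI[of _ t] exI[of _ s] exI[of _ "{(a, b). arrays s ''output'' a = Suc b}"])
      (simp add: outputs_def)
qed

end
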